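(* Let $\lambda$ be a strict partition of length $r$, and let $b=(b_1,b_2,\ldots)$, $c=(c_1,c_2,\ldots)$ be two sequences of parameters. Then \[ gq_\lambda(y\,|\,b)=\sum_{\mu\supseteq\lambda,\ \ell(\mu)=\ell(\lambda)}c^{gq}_{\lambda\mu}(b|c)\,gq_\mu(y\,|\,c),\qquad GP_\mu(x\,|\,c)=\sum_{\lambda\subseteq\mu,\ \ell(\lambda)=\ell(\mu)}c^{GP}_{\mu\lambda}(c|b)\,GP_\lambda(x\,|\,b), \] where the sums are over strict partitions, and for strict $\lambda\subseteq\mu$ of the same length $r$, \[ c^{gq}_{\lambda\mu}(b|c)=c^{GP}_{\mu\lambda}(c|b)=\frac{d_\lambda(b)}{d_\mu(c)}\det\Big(\sum_{k=0}^\infty\beta^k\binom{i-j}{k}h_{\mu_i-\lambda_j+k}(b_1,\ldots,b_{\lambda_j};-c_1,\ldots,-c_{\mu_i-1})\Big)_{1\le i,j\le r}. \]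
   Context: $\beta$ indeterminate; $x\oplus y=x+y+\beta xy$, $x\ominus y=\frac{x-y}{1+\beta y}$, $\bar x=\frac{-x}{1+\beta x}$. Strict partitions $\lambda=(\lambda_1>\cdots>\lambda_r>0)$ are identified with shifted Young diagrams; $\subseteq$ is diagram containment. For a parameter sequence $b$, strict $\lambda$ of length $r$ and $n\ge r$, $GP_\lambda(x_1,\ldots,x_n|b)=\frac{1}{(n-r)!}\sum_{w\in S_n}w\big(\prod_{i=1}^rx_i(x_i\ominus b_1)\cdots(x_i\ominus b_{\lambda_i-1})\prod_{i=1}^r\prod_{j=i+1}^n\frac{x_i\oplus x_j}{x_i\ominus x_j}\big)$ ($w$ permutes the $x$'s); stability under $x_{n+1}=0$ defines $GP_\lambda(x|b)$. The functions $gq_\lambda(y|b)$ are the unique completed symmetric functions in $y=(y_1,y_2,\ldots)$ (with coefficients in the ring generated over $\mathbb Z[\beta]$ by the $b_i,\ominus b_i$) such that $\prod_{i,j\ge1}\frac{1-\bar x_iy_j}{1-x_iy_j}=\sum_\lambda GP_\lambda(x|b)gq_\lambda(y|b)$. $d_\lambda(b)=\prod_{i=1}^{\ell(\lambda)}\prod_{l=1}^{\lambda_i-1}(1+\beta b_l)$. Supersymmetric complete functions: $\sum_{n\ge0}h_n(x_1,\ldots,x_p;y_1,\ldots,y_q)t^n=\prod_{j=1}^q(1+y_jt)/\prod_{i=1}^p(1-x_it)$, and $h_n=0$ for $n<0$. $\binom{a}{k}$ is the generalized binomial coefficient $a(a-1)\cdots(a-k+1)/k!$ (so $\binom{-n}{k}=(-1)^k\binom{n+k-1}{k}$).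 *)

theory Defs
  imports
    "HOL-Library.Multiset"
    "HOL-Combinatorics.Permutations"
    "HOL-Computational_Algebra.Formal_Power_Series"
    "HOL-Computational_Algebra.Polynomial_Factorial"
    "HOL-Analysis.Infinite_Sum"
    "Jordan_Normal_Form.Determinant"
begin

section \<open>Formal power series in arbitrarily many indeterminates\<close>

text \<open>A monomial is a finite multiset of indeterminates, and a formal power series is an arbitrary
  family of coefficients indexed by monomials. Infinitely many indeterminates are allowed.\<close>

typedef ('a, 'b) mps = "UNIV :: ('a multiset \<Rightarrow> 'b) set"
  morphisms mcoeff Mps ..

setup_lifting type_definition_mps

lemma mcoeff_Mps [simp]: "mcoeff (Mps f) = f"
  by (simp add: Mps_inverse)

lemma mps_eqI: "(\<And>M. mcoeff f M = mcoeff g M) \<Longrightarrow> f = g"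
  by (metis ext mcoeff_inject)

lemma finite_submultisets: "finite {P. P \<subseteq># (M :: 'a multiset)}"
proof (induction M)
  case (add x M)
  have "{P. P \<subseteq># add_mset x M} \<subseteq> {P. P \<subseteq># M} \<union> add_mset x ` {P. P \<subseteq># M}"
  proof
    fix P assume P: "P \<in> {P. P \<subseteq># add_mset x M}"
    show "P \<in> {P. P \<subseteq># M} \<union> add_mset x ` {P. P \<subseteq># M}"
    proof (cases "x \<in># P")
      case True
      then obtain Q where Q: "P = add_mset x Q" by (metis mset_add)
      with P show ?thesis by auto
    next
      case False
      with P show ?thesis
        by (metis (no_types, lifting) UnI1 diff_single_trivial mem_Collect_eq subset_eq_diff_conv add_mset_add_single)
    qed
  qed
  then show ?case using add finite_subset by blast
qed simp

lemma mset_diff_mono: "Q \<subseteq># P \<Longrightarrow> P \<subseteq># M \<Longrightarrow> P - Q \<subseteq># M - (Q::'a multiset)"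
  by (auto simp: subseteq_mset_def intro: diff_le_mono)

lemma mset_add_le_if: "Q \<subseteq># M \<Longrightarrow> R \<subseteq># M - Q \<Longrightarrow> Q + R \<subseteq># (M::'a multiset)"
  by (metis add.commute subset_mset.le_diff_conv2)

lemma mset_diff_diff: "Q \<subseteq># P \<Longrightarrow> M - Q - (P - Q) = M - (P::'a multiset)"
  by (metis diff_diff_add_mset subset_mset.add_diff_inverse)

instantiation mps :: (type, comm_ring_1) comm_ring_1
begin

definition zero_mps :: "('a, 'b) mps" where
  "zero_mps = Mps (\<lambda>_. 0)"

definition one_mps :: "('a, 'b) mps" where
  "one_mps = Mps (\<lambda>M. if M = {#} then 1 else 0)"

definition plus_mps :: "('a, 'b) mps \<Rightarrow> ('a, 'b) mps \<Rightarrow> ('a, 'b) mps" where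
  "plus_mps f g = Mps (\<lambda>M. mcoeff f M + mcoeff g M)"

definition uminus_mps :: "('a, 'b) mps \<Rightarrow> ('a, 'b) mps" where
  "uminus_mps f = Mps (\<lambda>M. - mcoeff f M)"

definition minus_mps :: "('a, 'b) mps \<Rightarrow> ('a, 'b) mps \<Rightarrow> ('a, 'b) mps" where
  "minus_mps f g = Mps (\<lambda>M. mcoeff f M - mcoeff g M)"

definition times_mps :: "('a, 'b) mps \<Rightarrow> ('a, 'b) mps \<Rightarrow> ('a, 'b) mps" where
  "times_mps f g = Mps (\<lambda>M. \<Sum>P | P \<subseteq># M. mcoeff f P * mcoeff g (M - P))"

instance
proof
  fix f g h :: "('a, 'b) mps"
  show "f + g + h = f + (g + h)" "f + g = g + f" "0 + f = f" "- f + f = 0" "f - g = f + - g"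
    by (auto simp: plus_mps_def zero_mps_def uminus_mps_def minus_mps_def algebra_simps
        mcoeff_inverse)
  show "(0 :: ('a, 'b) mps) \<noteq> 1"
  proof
    assume "(0 :: ('a, 'b) mps) = 1"
    then have "mcoeff (0 :: ('a, 'b) mps) {#} = mcoeff 1 {#}" by simp
    then show False by (simp add: zero_mps_def one_mps_def)
  qed
  show "(f + g) * h = f * h + g * h"
    by (rule mps_eqI) (simp add: plus_mps_def times_mps_def algebra_simps sum.distrib)
  show "1 * f = f"
  proof (rule mps_eqI)
    fix M
    have "mcoeff (1 * f) M = (\<Sum>P | P \<subseteq># M. if P = {#} then mcoeff f M else 0)"
      by (auto simp: times_mps_def one_mps_def intro!: sum.cong)
    then show "mcoeff (1 * f) M = mcoeff f M"
      by (simp add: finite_submultisets)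
  qed
  show "f * g = g * f"
  proof (rule mps_eqI)
    fix M
    have "(\<Sum>P | P \<subseteq># M. mcoeff f P * mcoeff g (M - P)) =
          (\<Sum>P | P \<subseteq># M. mcoeff g P * mcoeff f (M - P))"
      by (rule sum.reindex_bij_witness[where i = "\<lambda>P. M - P" and j = "\<lambda>P. M - P"])
         (auto simp: algebra_simps subset_mset.diff_diff_right)
    then show "mcoeff (f * g) M = mcoeff (g * f) M" by (simp add: times_mps_def)
  qed
  show "f * g * h = f * (g * h)"
  proof (rule mps_eqI)
    fix M
    have "mcoeff (f * g * h) M =
        (\<Sum>P | P \<subseteq># M. \<Sum>Q | Q \<subseteq># P. mcoeff f Q * mcoeff g (P - Q) * mcoeff h (M - P))"
      by (simp add: times_mps_def sum_distrib_right)
    also have "\<dots> = (\<Sum>(P, Q)\<in>(SIGMA P:{P. P \<subseteq># M}. {Q. Q \<subseteq># P}).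
        mcoeff f Q * mcoeff g (P - Q) * mcoeff h (M - P))"
      by (rule sum.Sigma) (simp_all add: finite_submultisets)
    also have "\<dots> = (\<Sum>(Q, R)\<in>(SIGMA Q:{Q. Q \<subseteq># M}. {R. R \<subseteq># M - Q}).
        mcoeff f Q * (mcoeff g R * mcoeff h (M - Q - R)))"
    proof (rule sum.reindex_bij_witness[where i = "\<lambda>(Q, R). (Q + R, Q)" and j = "\<lambda>(P, Q). (Q, P - Q)"],
        goal_cases)
      case (1 a)
      then show ?case by (cases a) simp
    next
      case (2 a)
      then show ?case
        by (cases a) (simp, metis mset_diff_mono subset_mset.order_trans)
    next
      case (3 a)
      then show ?case by (cases a) simp
    next
      case (4 a)
      then show ?case by (cases a) (simp add: mset_add_le_if)
    next
      case (5 a)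
      then show ?case by (cases a) (simp add: mset_diff_diff mult.assoc)
    qed
    also have "\<dots> = (\<Sum>Q | Q \<subseteq># M. \<Sum>R | R \<subseteq># M - Q.
        mcoeff f Q * (mcoeff g R * mcoeff h (M - Q - R)))"
      by (rule sum.Sigma[symmetric]) (simp_all add: finite_submultisets)
    also have "\<dots> = mcoeff (f * (g * h)) M"
      by (simp add: times_mps_def sum_distrib_left)
    finally show "mcoeff (f * g * h) M = mcoeff (f * (g * h)) M" .
  qed
qed

end

lemma mps_unique_leading_pair:
  fixes A B :: "'a multiset set"
  assumes "finite V" "A \<noteq> {}" "B \<noteq> {}"
  shows "\<exists>P\<in>A. \<exists>Q\<in>B. \<forall>P'\<in>A. \<forall>Q'\<in>B. P' + Q' = P + Q \<longrightarrow>
           (\<forall>v\<in>V. count P' v = count P v \<and> count Q' v = count Q v)"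
  using assms
proof (induction V arbitrary: A B rule: finite_induct)
  case empty
  then show ?case by auto
next
  case (insert v V)
  define a where "a = Inf ((\<lambda>P. count P v) ` A)"
  define b where "b = Inf ((\<lambda>P. count P v) ` B)"
  have a: "a \<in> (\<lambda>P. count P v) ` A" unfolding a_def using insert.prems by (intro Inf_nat_def1) simp
  have b: "b \<in> (\<lambda>P. count P v) ` B" unfolding b_def using insert.prems by (intro Inf_nat_def1) simp
  have a_le: "a \<le> count P v" if "P \<in> A" for P
    unfolding a_def using that by (intro wellorder_Inf_le1) simp
  have b_le: "b \<le> count P v" if "P \<in> B" for P
    unfolding b_def using that by (intro wellorder_Inf_le1) simp
  define A' where "A' = {P\<in>A. count P v = a}"
  define B' where "B' = {P\<in>B. count P v = b}"
  have "A' \<noteq> {}" "B' \<noteq> {}" using a b by (auto simp: A'_def B'_def)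
  from insert.IH[OF this] obtain P Q where PQ: "P \<in> A'" "Q \<in> B'"
    and PQ': "\<forall>P'\<in>A'. \<forall>Q'\<in>B'. P' + Q' = P + Q \<longrightarrow>
       (\<forall>v\<in>V. count P' v = count P v \<and> count Q' v = count Q v)" by blast
  have *: "\<forall>w\<in>insert v V. count P' w = count P w \<and> count Q' w = count Q w"
    if "P' \<in> A" "Q' \<in> B" "P' + Q' = P + Q" for P' Q'
  proof -
    have PQv: "count P v = a" "count Q v = b" using PQ(1,2) by (simp_all add: A'_def B'_def)
    have "count P' v + count Q' v = a + b"
      using arg_cong[OF that(3), of "\<lambda>M. count M v"] PQv by simp
    with a_le[OF that(1)] b_le[OF that(2)] have v: "count P' v = a" "count Q' v = b" by linarith+
    then have "P' \<in> A'" "Q' \<in> B'" using that(1,2) by (simp_all add: A'_def B'_def)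
    then have "\<forall>v\<in>V. count P' v = count P v \<and> count Q' v = count Q v"
      using PQ'[rule_format, OF _ _ that(3)] by blast
    with v PQv show ?thesis by simp
  qed
  have "P \<in> A" "Q \<in> B" using PQ by (auto simp: A'_def B'_def)
  show ?case
    by (intro bexI[OF _ \<open>P \<in> A\<close>] bexI[OF _ \<open>Q \<in> B\<close>] ballI[of A] ballI[of B] impI) (rule *)
qed

instance mps :: (type, idom) idom
proof
  fix f g :: "('a, 'b::idom) mps"
  assume "f \<noteq> 0" "g \<noteq> 0"
  then obtain M N where MN: "mcoeff f M \<noteq> 0" "mcoeff g N \<noteq> 0"
    by (metis mcoeff_Mps mps_eqI zero_mps_def)
  define V where "V = set_mset M \<union> set_mset N"
  define A where "A = {P. mcoeff f P \<noteq> 0 \<and> set_mset P \<subseteq> V}"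
  define B where "B = {P. mcoeff g P \<noteq> 0 \<and> set_mset P \<subseteq> V}"
  have "M \<in> A" "N \<in> B" "finite V" using MN by (auto simp: A_def B_def V_def)
  then obtain P Q where PQ: "P \<in> A" "Q \<in> B"
    "\<And>P' Q'. P' \<in> A \<Longrightarrow> Q' \<in> B \<Longrightarrow> P' + Q' = P + Q \<Longrightarrow>
       (\<forall>v\<in>V. count P' v = count P v \<and> count Q' v = count Q v)"
    using mps_unique_leading_pair[of V A B] by blast
  have *: "mcoeff f R * mcoeff g (P + Q - R) = 0" if "R \<subseteq># P + Q" "R \<noteq> P" for R
  proof (rule ccontr)
    assume nz: "mcoeff f R * mcoeff g (P + Q - R) \<noteq> 0"
    have "set_mset (P + Q) \<subseteq> V" using PQ by (auto simp: A_def B_def)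
    moreover have "set_mset R \<subseteq> set_mset (P + Q)" "set_mset (P + Q - R) \<subseteq> set_mset (P + Q)"
      using that by (auto simp only: set_mset_mono dest: in_diffD)
    ultimately have RV: "set_mset R \<subseteq> V" "set_mset (P + Q - R) \<subseteq> V" by blast+
    with nz have "R \<in> A" "P + Q - R \<in> B" by (auto simp: A_def B_def)
    moreover have "R + (P + Q - R) = P + Q" using that by simp
    ultimately have "\<forall>v\<in>V. count R v = count P v" using PQ(3) by blast
    moreover have "set_mset P \<subseteq> V" using PQ by (auto simp: A_def)
    ultimately have "R = P" using RV(1)
      by (metis count_inI multiset_eqI subsetD)
    with that show False by simp
  qed
  have "mcoeff (f * g) (P + Q) = (\<Sum>R | R \<subseteq># P + Q. if R = P then mcoeff f P * mcoeff g Q else 0)"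
    unfolding times_mps_def mcoeff_Mps by (intro sum.cong) (auto simp: *)
  also have "\<dots> = mcoeff f P * mcoeff g Q"
    by (simp add: finite_submultisets)
  also have "\<dots> \<noteq> 0" using PQ by (auto simp: A_def B_def)
  finally show "f * g \<noteq> 0" by (auto simp: zero_mps_def)
qed

text \<open>In an integral domain, \<open>f div g\<close> is the exact quotient whenever it exists.\<close>

instantiation mps :: (type, idom) idom_divide
begin

definition divide_mps :: "('a, 'b) mps \<Rightarrow> ('a, 'b) mps \<Rightarrow> ('a, 'b) mps" where
  "divide_mps f g = (if g \<noteq> 0 \<and> g dvd f then THE h. f = g * h else 0)"

instance
proof
  fix f g :: "('a, 'b) mps"
  show "f div 0 = 0" by (simp add: divide_mps_def)
  assume "g \<noteq> 0"
  then show "f * g div g = f"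
    by (auto simp: divide_mps_def mult.commute intro!: the_equality)
qed

end

text \<open>The topology of coefficientwise convergence, each coefficient carrying the discrete topology.\<close>

instantiation mps :: (type, type) topological_space
begin

definition open_mps :: "('a, 'b) mps set \<Rightarrow> bool" where
  "open_mps U \<longleftrightarrow>
     (\<forall>f\<in>U. \<exists>S. finite S \<and> (\<forall>g. (\<forall>M\<in>S. mcoeff g M = mcoeff f M) \<longrightarrow> g \<in> U))"

instance
proof
  show "open (UNIV :: ('a, 'b) mps set)" by (auto simp: open_mps_def)
  fix U V :: "('a, 'b) mps set" assume UV: "open U" "open V"
  show "open (U \<inter> V)" unfolding open_mps_def
  proof
    fix f assume "f \<in> U \<inter> V"
    then obtain S T where "finite S" "\<And>g. (\<forall>M\<in>S. mcoeff g M = mcoeff f M) \<Longrightarrow> g \<in> U"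
      "finite T" "\<And>g. (\<forall>M\<in>T. mcoeff g M = mcoeff f M) \<Longrightarrow> g \<in> V"
      using UV unfolding open_mps_def by (metis IntD1 IntD2)
    then show "\<exists>S. finite S \<and> (\<forall>g. (\<forall>M\<in>S. mcoeff g M = mcoeff f M) \<longrightarrow> g \<in> U \<inter> V)"
      by (intro exI[of _ "S \<union> T"]) auto
  qed
next
  fix K :: "('a, 'b) mps set set" assume K: "\<forall>U\<in>K. open U"
  show "open (\<Union>K)" unfolding open_mps_def
  proof
    fix f assume "f \<in> \<Union>K"
    then obtain U where U: "U \<in> K" "f \<in> U" by blast
    with K obtain S where "finite S" "\<forall>g. (\<forall>M\<in>S. mcoeff g M = mcoeff f M) \<longrightarrow> g \<in> U"
      unfolding open_mps_def by metis
    with U show "\<exists>S. finite S \<and> (\<forall>g. (\<forall>M\<in>S. mcoeff g M = mcoeff f M) \<longrightarrow> g \<in> \<Union>K)"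
      by blast
  qed
qed

end

instance mps :: (type, type) t2_space
proof
  fix f g :: "('a, 'b) mps" assume "f \<noteq> g"
  then obtain M where M: "mcoeff f M \<noteq> mcoeff g M" by (metis mps_eqI)
  have "open {h :: ('a, 'b) mps. mcoeff h M = c}" for c
    unfolding open_mps_def by (auto intro!: exI[of _ "{M}"])
  with M show "\<exists>U V. open U \<and> open V \<and> f \<in> U \<and> g \<in> V \<and> U \<inter> V = {}"
    by (intro exI[of _ "{h. mcoeff h M = mcoeff f M}"] exI[of _ "{h. mcoeff h M = mcoeff g M}"]) auto
qed

definition mvar :: "'a \<Rightarrow> ('a, 'b::comm_ring_1) mps" where
  "mvar v = Mps (\<lambda>M. if M = {#v#} then 1 else 0)"

section \<open>Indeterminates and parameter sequences\<close>

text \<open>Every object lives in one ring: integral formal power series in the indeterminate \<open>\<beta>\<close>,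
  the variables \<open>x\<close>, \<open>y\<close>, and a supply \<open>Par k\<close> of indeterminates for building parameter sequences.
  All sequences are indexed from \<open>0\<close>: the mathematical \<open>x\<^sub>1, y\<^sub>1, b\<^sub>1\<close>
  are \<open>xv 0\<close>, \<open>yv 0\<close>, \<open>b 0\<close>.\<close>

datatype var = Beta | Par nat | X nat | Y nat

type_synonym ps = "(var, int) mps"

abbreviation beta :: ps where "beta \<equiv> mvar Beta"
abbreviation xv :: "nat \<Rightarrow> ps" where "xv i \<equiv> mvar (X i)"
abbreviation yv :: "nat \<Rightarrow> ps" where "yv j \<equiv> mvar (Y j)"

text \<open>Parameters do not involve \<open>x\<close>, \<open>y\<close> and have zero constant term, so that series in them
  converge. Two independent sequences of indeterminates are the case
  \<open>b i = mvar (Par (2 * i))\<close>, \<open>c i = mvar (Par (2 * i + 1))\<close>.\<close>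

definition parameter_seq :: "(nat \<Rightarrow> ps) \<Rightarrow> bool" where
  "parameter_seq b \<longleftrightarrow>
     (\<forall>i. mcoeff (b i) {#} = 0 \<and>
          (\<forall>M. mcoeff (b i) M \<noteq> 0 \<longrightarrow> set_mset M \<subseteq> insert Beta (range Par)))"

text \<open>In a field, \<open>div\<close> is the same constant as \<open>/\<close>; the following operations are used both
  for power series and in the fraction field.\<close>

definition oplus :: "'a::idom_divide \<Rightarrow> 'a \<Rightarrow> 'a \<Rightarrow> 'a" where
  "oplus \<beta> x y = x + y + \<beta> * x * y"

definition ominus :: "'a::idom_divide \<Rightarrow> 'a \<Rightarrow> 'a \<Rightarrow> 'a" where
  "ominus \<beta> x y = (x - y) div (1 + \<beta> * y)"

definition obar :: "'a::idom_divide \<Rightarrow> 'a \<Rightarrow> 'a" where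
  "obar \<beta> x = (- x) div (1 + \<beta> * x)"

section \<open>Strict partitions\<close>

definition strict_partition :: "nat list \<Rightarrow> bool" where
  "strict_partition lam \<longleftrightarrow> sorted_wrt (>) lam \<and> 0 \<notin> set lam"

definition shifted_diagram :: "nat list \<Rightarrow> (nat \<times> nat) set" where
  "shifted_diagram lam = {(i, j). i < length lam \<and> i \<le> j \<and> j < i + lam ! i}"

section \<open>The functions \<open>GP\<close>\<close>

definition GP_fin :: "'a::field \<Rightarrow> (nat \<Rightarrow> 'a) \<Rightarrow> (nat \<Rightarrow> 'a) \<Rightarrow> nat \<Rightarrow> nat list \<Rightarrow> 'a" where
  "GP_fin \<beta> b x n lam =
     1 / of_nat (fact (n - length lam)) *
     (\<Sum>w | w permutes {..<n}.
        (\<Prod>i<length lam. x (w i) * (\<Prod>l<lam ! i - 1. ominus \<beta> (x (w i)) (b l))) *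
        (\<Prod>i<length lam. \<Prod>j=i+1..<n. oplus \<beta> (x (w i)) (x (w j)) / ominus \<beta> (x (w i)) (x (w j))))"

text \<open>The specialization \<open>x\<^sub>i = 0\<close> for all \<open>i > n\<close>.\<close>

definition x_truncate :: "nat \<Rightarrow> ps \<Rightarrow> ps" where
  "x_truncate n f = Mps (\<lambda>M. if \<exists>i\<ge>n. X i \<in># M then 0 else mcoeff f M)"

definition GP :: "(nat \<Rightarrow> ps) \<Rightarrow> nat list \<Rightarrow> ps" where
  "GP b lam = (THE G. \<forall>n\<ge>length lam.
     to_fract (x_truncate n G) = GP_fin (to_fract beta) (\<lambda>l. to_fract (b l)) (\<lambda>i. to_fract (xv i)) n lam)"

section \<open>The dual functions \<open>gq\<close>\<close>

definition cauchy_kernel :: ps where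
  "cauchy_kernel =
     lim (\<lambda>N. \<Prod>i<N. \<Prod>j<N. (1 - obar beta (xv i) * yv j) div (1 - xv i * yv j))"

inductive_set coeff_ring :: "(nat \<Rightarrow> ps) \<Rightarrow> ps set" for b where
  one: "1 \<in> coeff_ring b"
| beta: "beta \<in> coeff_ring b"
| param: "b i \<in> coeff_ring b"
| param_bar: "obar beta (b i) \<in> coeff_ring b"
| diff: "f \<in> coeff_ring b \<Longrightarrow> g \<in> coeff_ring b \<Longrightarrow> f - g \<in> coeff_ring b"
| mult: "f \<in> coeff_ring b \<Longrightarrow> g \<in> coeff_ring b \<Longrightarrow> f * g \<in> coeff_ring b"

text \<open>The coefficient of the \<open>y\<close>-monomial \<open>\<Prod>j\<in>#M. y\<^sub>j\<close>, a series in the remaining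
  indeterminates.\<close>

definition y_coeff :: "ps \<Rightarrow> nat multiset \<Rightarrow> ps" where
  "y_coeff f M =
     Mps (\<lambda>N. if \<exists>j. Y j \<in># N then 0 else mcoeff f (image_mset Y M + N))"

text \<open>Completed symmetric functions in \<open>y\<close>: symmetric formal power series, of possibly unbounded
  degree.\<close>

definition completed_symmetric :: "ps set \<Rightarrow> ps \<Rightarrow> bool" where
  "completed_symmetric R f \<longleftrightarrow>
     (\<forall>M. y_coeff f M \<in> R) \<and>
     (\<forall>n \<sigma> M. \<sigma> permutes {..<n} \<longrightarrow> y_coeff f (image_mset \<sigma> M) = y_coeff f M)"

text \<open>The characterization defining the family \<open>gq\<^sub>\<lambda>(y|b)\<close>. The value of \<open>g\<close> outside strict
  partitions is irrelevant.\<close>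

definition is_gq :: "(nat \<Rightarrow> ps) \<Rightarrow> (nat list \<Rightarrow> ps) \<Rightarrow> bool" where
  "is_gq b g \<longleftrightarrow>
     (\<forall>lam. strict_partition lam \<longrightarrow> completed_symmetric (coeff_ring b) (g lam)) \<and>
     ((\<lambda>lam. GP b lam * g lam) has_sum cauchy_kernel) {lam. strict_partition lam}"

section \<open>The transition coefficients\<close>

definition d_fac :: "(nat \<Rightarrow> ps) \<Rightarrow> nat list \<Rightarrow> ps" where
  "d_fac b lam = (\<Prod>i<length lam. \<Prod>l<lam ! i - 1. 1 + beta * b l)"

text \<open>\<open>super_h p x q y n\<close> is \<open>h\<^sub>n(x\<^sub>1,\<dots>,x\<^sub>p; y\<^sub>1,\<dots>,y\<^sub>q)\<close>. The series by which
  one divides has constant term \<open>1\<close>; \<open>fps_right_inverse _ 1\<close> is its reciprocal.\<close>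

definition super_h :: "nat \<Rightarrow> (nat \<Rightarrow> ps) \<Rightarrow> nat \<Rightarrow> (nat \<Rightarrow> ps) \<Rightarrow> int \<Rightarrow> ps" where
  "super_h p x q y n =
     (if n < 0 then 0
      else fps_nth ((\<Prod>j<q. 1 + fps_const (y j) * fps_X) *
                    fps_right_inverse (\<Prod>i<p. 1 - fps_const (x i) * fps_X) 1) (nat n))"

text \<open>The library's \<open>gchoose\<close> is only usable over fields of characteristic \<open>0\<close>; the
  integer division here is exact.\<close>

definition int_gbinomial :: "int \<Rightarrow> nat \<Rightarrow> int" where
  "int_gbinomial a k = (\<Prod>i<k. a - int i) div fact k"

definition transition_coeff ::
    "(nat \<Rightarrow> ps) \<Rightarrow> (nat \<Rightarrow> ps) \<Rightarrow> nat list \<Rightarrow> nat list \<Rightarrow> ps" where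
  "transition_coeff b c lam mu =
     (let r = length lam in
      (d_fac b lam div d_fac c mu) *
      det (mat r r (\<lambda>(i, j).
        \<Sum>\<^sub>\<infinity>k. beta ^ k * of_int (int_gbinomial (int i - int j) k) *
          super_h (lam ! j) b (mu ! i - 1) (\<lambda>l. - c l) (int (mu ! i) - int (lam ! j) + int k))))"

end

theory Submission
  imports Defs
begin

text \<open>Since \<open>(x\<^sub>i \<oplus> x\<^sub>j) / (x\<^sub>i \<ominus> x\<^sub>j)\<close> is antisymmetric up to the factor \<open>1 + \<beta> x\<^sub>j\<close>,
  \<open>d\<^sub>\<lambda>(b) GP\<^sub>\<lambda>(x|b)\<close> is the value of one alternating multilinear form, independent of \<open>\<lambda>\<close> and \<open>b\<close>,
  at the polynomials \<open>(1 + \<beta> x)\<^sup>i\<^sup>-\<^sup>1 f\<^sub>i\<close> with \<open>f\<^sub>i = x (x - b\<^sub>1) \<cdots> (x - b\<^sub>m)\<close>, \<open>m = \<lambda>\<^sub>i - 1\<close>. An alternating form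
  that vanishes on these families for all strict \<open>\<lambda> \<subseteq> \<mu>\<close> also vanishes on the family of \<open>\<mu>\<close> formed with
  \<open>c\<close>. The determinants in the theorem are themselves alternating forms, dual to the families of the
  strict partitions, so subtracting the claimed expansion from the given form yields a form of this
  kind. The statement for \<open>gq\<close> follows by comparing coefficients in the Cauchy identity: truncation to
  \<open>r\<close> variables turns \<open>GP\<^sub>\<lambda>\<close>, for \<open>\<lambda>\<close> of length \<open>r\<close>, into a multiple of an alternant, so the \<open>GP\<^sub>\<lambda>\<close> are
  independent even under infinite sums.\<close>

section \<open>Coefficients and ring homomorphisms of power series\<close>

text \<open>The powers of 1 + \<beta> x belong to a position and not to the polynomial placed there.
  This is the main obstacle: exchanging two parts of a sequence is not exchanging two arguments of
  the form, so non-strict sequences do not reduce to strict ones by a sign. The same powers produce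
  the binomials of the determinant. The functional of column j divides by (1 + \<beta> x)^j and
  takes the coefficient of 1/x at infinity against x (x - b_1) ... (x - b_k), where k is the part
  \<lambda>_j. On row i, formed with c, it meets the power (1 + \<beta> x)^(i-j), whose expansion in
  \<beta> is the sum over k in the matrix entry; the supersymmetric h come from the two products of
  linear factors. The ring of series has no inverses of differences of variables, so every identity
  is multiplied by a Vandermonde product, and the value of GP exists only after divisibility and
  stability of the antisymmetrized sums are known. Convergence is governed by total degree, in which
  \<beta> and the indeterminates of the parameters count too: GP of \<lambda> starts in degree at
  least |\<lambda>|, and the transition coefficient in degree at least |\<mu>| -
  |\<lambda>|.\<close>

lemma mcoeff_0 [simp]: "mcoeff 0 M = 0"
  by (simp add: zero_mps_def)

lemma mcoeff_1: "mcoeff 1 M = (if M = {#} then 1 else 0)"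
  by (simp add: one_mps_def)

lemma mcoeff_add [simp]: "mcoeff (f + g) M = mcoeff f M + mcoeff g M"
  by (simp add: plus_mps_def)

lemma mcoeff_uminus [simp]: "mcoeff (- f) M = - mcoeff f M"
  by (simp add: uminus_mps_def)

lemma mcoeff_diff [simp]: "mcoeff (f - g) M = mcoeff f M - mcoeff g M"
  by (simp add: minus_mps_def)

lemma mcoeff_mult: "mcoeff (f * g) M = (\<Sum>P | P \<subseteq># M. mcoeff f P * mcoeff g (M - P))"
  by (simp add: times_mps_def)

lemma mcoeff_sum: "mcoeff (sum f A) M = (\<Sum>a\<in>A. mcoeff (f a) M)"
  by (induction A rule: infinite_finite_induct) auto

lemma finite_mset_splits: "finite {(P, Q). P + Q = (M :: 'a multiset)}"
proof -
  have "{(P, Q). P + Q = M} \<subseteq> (\<lambda>P. (P, M - P)) ` {P. P \<subseteq># M}" by auto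
  then show ?thesis using finite_submultisets finite_surj by blast
qed

lemma mcoeff_mult_splits:
  "mcoeff (f * g) M = (\<Sum>(P, Q) | P + Q = M. mcoeff f P * mcoeff g Q)"
  unfolding mcoeff_mult
  by (rule sum.reindex_bij_witness[where i = fst and j = "\<lambda>P. (P, M - P)"]) auto

definition mmono :: "'a multiset \<Rightarrow> ('a, 'b::comm_ring_1) mps" where
  "mmono A = Mps (\<lambda>M. if M = A then 1 else 0)"

lemma mcoeff_mmono: "mcoeff (mmono A) M = (if M = A then 1 else 0)"
  by (simp add: mmono_def)

lemma mmono_empty: "mmono {#} = 1"
  by (rule mps_eqI) (simp add: mcoeff_mmono mcoeff_1)

lemma mvar_eq_mmono: "mvar v = mmono {#v#}"
  by (simp add: mvar_def mmono_def)

lemma mcoeff_mmono_mult: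
  "mcoeff (mmono A * f) M = (if A \<subseteq># M then mcoeff f (M - A) else 0)"
proof -
  have "mcoeff (mmono A * f) M = (\<Sum>P | P \<subseteq># M. if P = A then mcoeff f (M - A) else 0)"
    unfolding mcoeff_mult by (intro sum.cong) (auto simp: mcoeff_mmono)
  then show ?thesis by (simp add: finite_submultisets)
qed

lemma mcoeff_mvar_mult:
  "mcoeff (mvar v * f) M = (if v \<in># M then mcoeff f (M - {#v#}) else 0)"
  by (simp add: mvar_eq_mmono mcoeff_mmono_mult)

lemma mmono_mult: "mmono A * mmono B = (mmono (A + B) :: ('a, 'b::comm_ring_1) mps)"
  by (rule mps_eqI) (auto simp: mcoeff_mmono_mult mcoeff_mmono)

lemma mmono_power: "mmono A ^ n = (mmono (repeat_mset n A) :: ('a, 'b::comm_ring_1) mps)"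
  by (induction n) (simp_all add: mmono_empty mmono_mult)

lemma mmono_prod: "finite I \<Longrightarrow> (\<Prod>i\<in>I. mmono (A i)) = (mmono (\<Sum>i\<in>I. A i) :: ('a, 'b::comm_ring_1) mps)"
  by (induction I rule: finite_induct) (simp_all add: mmono_empty mmono_mult)

text \<open>One predicate for truncation, substitution of indeterminates and the embedding into the
  fraction field, so that all of them share the rules \<open>hom_simps\<close>.\<close>

definition mps_hom :: "('a::comm_ring_1 \<Rightarrow> 'b::comm_ring_1) \<Rightarrow> bool" where
  "mps_hom h \<longleftrightarrow> h 0 = 0 \<and> h 1 = 1 \<and> (\<forall>x y. h (x + y) = h x + h y) \<and> (\<forall>x y. h (x * y) = h x * h y)"

context
  fixes h :: "'a::comm_ring_1 \<Rightarrow> 'b::comm_ring_1"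
  assumes h: "mps_hom h"
begin

lemma hom_0: "h 0 = 0" and hom_1: "h 1 = 1"
  and hom_add: "h (x + y) = h x + h y" and hom_mult: "h (x * y) = h x * h y"
  using h by (auto simp: mps_hom_def)

lemma hom_uminus: "h (- x) = - h x"
  using hom_add[of x "- x"] by (simp add: hom_0 add.inverse_unique)

lemma hom_diff: "h (x - y) = h x - h y"
  using hom_add[of x "- y"] by (simp add: hom_uminus)

lemma hom_sum: "h (sum f A) = (\<Sum>x\<in>A. h (f x))"
  by (induction A rule: infinite_finite_induct) (simp_all add: hom_0 hom_add)

lemma hom_prod: "h (prod f A) = (\<Prod>x\<in>A. h (f x))"
  by (induction A rule: infinite_finite_induct) (simp_all add: hom_1 hom_mult)

lemma hom_power: "h (x ^ n) = h x ^ n"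
  by (induction n) (simp_all add: hom_1 hom_mult)

lemmas hom_simps = hom_0 hom_1 hom_add hom_mult hom_uminus hom_diff hom_sum hom_prod hom_power

end

section \<open>Substitution of indeterminates for indeterminates\<close>

definition finite_fibers :: "('a \<Rightarrow> 'b) \<Rightarrow> bool" where
  "finite_fibers \<phi> \<longleftrightarrow> (\<forall>v. finite (\<phi> -` {v}))"

lemma finite_fibers_mset:
  assumes "finite_fibers \<phi>" shows "finite {P. image_mset \<phi> P = M}"
proof (induction M)
  case (add v M)
  have "{P. image_mset \<phi> P = add_mset v M} \<subseteq>
        (\<Union>p\<in>\<phi> -` {v}. add_mset p ` {P. image_mset \<phi> P = M})"
    by (auto dest!: msed_map_invR)
  moreover have "finite (\<Union>p\<in>\<phi> -` {v}. add_mset p ` {P. image_mset \<phi> P = M})"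
    using add assms by (auto simp: finite_fibers_def)
  ultimately show ?case by (rule finite_subset)
qed simp

text \<open>The substitution of \<open>\<phi> v\<close> for \<open>v\<close>. Non-injective maps
  matter: identifying two variables is the test for divisibility by their difference. Finite fibers
  keep each coefficient a finite sum.\<close>

definition map_vars :: "('a \<Rightarrow> 'b) \<Rightarrow> ('a, 'c::comm_ring_1) mps \<Rightarrow> ('b, 'c) mps" where
  "map_vars \<phi> f = Mps (\<lambda>M. \<Sum>P | image_mset \<phi> P = M. mcoeff f P)"

lemma mcoeff_map_vars: "mcoeff (map_vars \<phi> f) M = (\<Sum>P | image_mset \<phi> P = M. mcoeff f P)"
  by (simp add: map_vars_def)

lemma map_vars_mmono:
  assumes "finite_fibers \<phi>" shows "map_vars \<phi> (mmono A) = mmono (image_mset \<phi> A)"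
  using finite_fibers_mset[OF assms]
  by (intro mps_eqI) (simp add: mcoeff_map_vars mcoeff_mmono eq_commute)

lemma map_vars_mvar: "finite_fibers \<phi> \<Longrightarrow> map_vars \<phi> (mvar v) = mvar (\<phi> v)"
  by (simp add: mvar_eq_mmono map_vars_mmono)

lemma map_vars_map_vars:
  assumes "finite_fibers \<phi>" "finite_fibers \<psi>"
  shows "map_vars \<phi> (map_vars \<psi> f) = map_vars (\<phi> \<circ> \<psi>) f"
proof (rule mps_eqI)
  fix M
  have fin: "finite {P. image_mset (\<phi> \<circ> \<psi>) P = M}"
  proof -
    have "{P. image_mset (\<phi> \<circ> \<psi>) P = M} = (\<Union>Q\<in>{Q. image_mset \<phi> Q = M}. {P. image_mset \<psi> P = Q})"
      by (auto simp: multiset.map_comp)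
    then show ?thesis by (simp add: finite_fibers_mset[OF assms(1)] finite_fibers_mset[OF assms(2)])
  qed
  have "(\<Sum>Q | image_mset \<phi> Q = M. \<Sum>P\<in>{P\<in>{P. image_mset (\<phi> \<circ> \<psi>) P = M}. image_mset \<psi> P = Q}. mcoeff f P) =
        (\<Sum>P | image_mset (\<phi> \<circ> \<psi>) P = M. mcoeff f P)"
    by (rule sum.group[OF fin finite_fibers_mset[OF assms(1)]]) (auto simp: multiset.map_comp)
  moreover have "{P\<in>{P. image_mset (\<phi> \<circ> \<psi>) P = M}. image_mset \<psi> P = Q} = {P. image_mset \<psi> P = Q}"
    if "image_mset \<phi> Q = M" for Q using that by (auto simp: multiset.map_comp)
  ultimately show "mcoeff (map_vars \<phi> (map_vars \<psi> f)) M = mcoeff (map_vars (\<phi> \<circ> \<psi>) f) M"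
    by (simp add: mcoeff_map_vars)
qed

text \<open>Both coefficients are one sum over the pairs of monomials whose images multiply to
  \<open>M\<close>, grouped once by the product of the pair and once by the pair of images.\<close>

lemma map_vars_hom:
  assumes "finite_fibers \<phi>"
  shows "mps_hom (map_vars \<phi> :: ('a, 'c::comm_ring_1) mps \<Rightarrow> ('b, 'c) mps)"
proof -
  note fin = finite_fibers_mset[OF assms]
  have mult: "map_vars \<phi> (f * g) = map_vars \<phi> f * map_vars \<phi> g" for f g :: "('a, 'c) mps"
  proof (rule mps_eqI)
    fix M
    let ?S = "{(P, Q). image_mset \<phi> P + image_mset \<phi> Q = M}"
    let ?h = "\<lambda>(P, Q). mcoeff f P * mcoeff g Q"
    have fin2: "finite {y. fst y + snd y = M}"
      using finite_mset_splits[of M] by (simp add: case_prod_unfold)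
    have finS: "finite ?S"
    proof (rule finite_subset)
      show "?S \<subseteq> (\<Union>(A, B)\<in>{(A, B). A + B = M}. {P. image_mset \<phi> P = A} \<times> {P. image_mset \<phi> P = B})"
        by auto
      show "finite (\<Union>(A, B)\<in>{(A, B). A + B = M}. {P. image_mset \<phi> P = A} \<times> {P. image_mset \<phi> P = B})"
        by (rule finite_UN_I[OF finite_mset_splits]) (auto intro: fin)
    qed
    have "mcoeff (map_vars \<phi> (f * g)) M =
        (\<Sum>R | image_mset \<phi> R = M. \<Sum>x\<in>{x\<in>?S. (\<lambda>(P, Q). P + Q) x = R}. ?h x)"
      unfolding mcoeff_map_vars mcoeff_mult_splits
      by (intro sum.cong refl) (auto intro!: sum.cong)
    also have "\<dots> = sum ?h ?S"
      by (rule sum.group[OF finS fin]) auto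
    also have "\<dots> = (\<Sum>y | fst y + snd y = M. \<Sum>x\<in>{x\<in>?S. (\<lambda>(P, Q). (image_mset \<phi> P, image_mset \<phi> Q)) x = y}. ?h x)"
      by (rule sum.group[symmetric, OF finS fin2]) auto
    also have "\<dots> = (\<Sum>y | fst y + snd y = M. \<Sum>x\<in>{P. image_mset \<phi> P = fst y} \<times> {P. image_mset \<phi> P = snd y}. ?h x)"
    proof (rule sum.cong[OF refl], rule sum.cong)
      fix y assume "y \<in> {y. fst y + snd y = M}"
      then show "{x\<in>?S. (\<lambda>(P, Q). (image_mset \<phi> P, image_mset \<phi> Q)) x = y} =
          {P. image_mset \<phi> P = fst y} \<times> {P. image_mset \<phi> P = snd y}"
        by (cases y) auto
    qed simp
    also have "\<dots> = mcoeff (map_vars \<phi> f * map_vars \<phi> g) M"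
      unfolding mcoeff_mult_splits mcoeff_map_vars sum_product sum.cartesian_product
      by (simp add: case_prod_unfold)
    finally show "mcoeff (map_vars \<phi> (f * g)) M = mcoeff (map_vars \<phi> f * map_vars \<phi> g) M" .
  qed
  have one: "map_vars \<phi> 1 = 1"
    using map_vars_mmono[OF assms, of "{#}"] by (simp add: mmono_empty)
  have add: "map_vars \<phi> (f + g) = map_vars \<phi> f + map_vars \<phi> g" for f g :: "('a, 'c) mps"
    by (rule mps_eqI) (simp add: mcoeff_map_vars sum.distrib)
  have zero: "map_vars \<phi> (0 :: ('a, 'c) mps) = 0"
    by (rule mps_eqI) (simp add: mcoeff_map_vars)
  show ?thesis
    unfolding mps_hom_def using mult one add zero by blast
qed

section \<open>Specialization of indeterminates to zero\<close>

definition restrict_vars :: "'a set \<Rightarrow> ('a, 'b::comm_ring_1) mps \<Rightarrow> ('a, 'b) mps" where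
  "restrict_vars S f = Mps (\<lambda>M. if set_mset M \<subseteq> S then mcoeff f M else 0)"

lemma mcoeff_restrict_vars:
  "mcoeff (restrict_vars S f) M = (if set_mset M \<subseteq> S then mcoeff f M else 0)"
  by (simp add: restrict_vars_def)

lemma restrict_vars_hom: "mps_hom (restrict_vars S)"
proof -
  have "restrict_vars S (f * g) = restrict_vars S f * restrict_vars S g" for f g :: "('a, 'b) mps"
  proof (rule mps_eqI)
    fix M
    show "mcoeff (restrict_vars S (f * g)) M = mcoeff (restrict_vars S f * restrict_vars S g) M"
    proof (cases "set_mset M \<subseteq> S")
      case True
      then have "set_mset P \<subseteq> S \<and> set_mset (M - P) \<subseteq> S" if "P \<subseteq># M" for P
        using that by (meson diff_subset_eq_self order.trans set_mset_mono)
      with True show ?thesis by (auto simp: mcoeff_mult mcoeff_restrict_vars intro!: sum.cong)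
    next
      case False
      have "\<not> set_mset P \<subseteq> S \<or> \<not> set_mset (M - P) \<subseteq> S" if "P \<subseteq># M" for P
        using that False by (metis Un_subset_iff set_mset_union subset_mset.add_diff_inverse)
      then have "mcoeff (restrict_vars S f * restrict_vars S g) M = 0"
        unfolding mcoeff_mult by (intro sum.neutral) (auto simp: mcoeff_restrict_vars)
      with False show ?thesis by (simp add: mcoeff_restrict_vars)
    qed
  qed
  then show ?thesis
    by (auto simp: mps_hom_def mcoeff_restrict_vars mcoeff_1 intro!: mps_eqI)
qed

lemma restrict_vars_mvar: "restrict_vars S (mvar v) = (if v \<in> S then mvar v else 0)"
  by (rule mps_eqI) (auto simp: mcoeff_restrict_vars mvar_def)

lemma x_truncate_restrict: "x_truncate n = restrict_vars (- (X ` {n..}))"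
  by (rule ext, rule mps_eqI) (auto simp: x_truncate_def mcoeff_restrict_vars)

section \<open>Order of vanishing\<close>

text \<open>Every indeterminate has degree 1, including \<open>Beta\<close> and those from which the
  parameters are built. Hence parameters have order at least 1 and a difference
  \<open>xv a - b l\<close> loses nothing against \<open>xv a\<close>.\<close>

definition ord_ge :: "nat \<Rightarrow> ('a, 'b::comm_ring_1) mps \<Rightarrow> bool" where
  "ord_ge n f \<longleftrightarrow> (\<forall>M. size M < n \<longrightarrow> mcoeff f M = 0)"

lemma ord_geD: "ord_ge n f \<Longrightarrow> size M < n \<Longrightarrow> mcoeff f M = 0"
  by (simp add: ord_ge_def)

lemma ord_ge_0 [simp]: "ord_ge n 0" "ord_ge 0 f"
  by (auto simp: ord_ge_def)

lemma ord_ge_add: "ord_ge n f \<Longrightarrow> ord_ge n g \<Longrightarrow> ord_ge n (f + g)"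
  and ord_ge_diff: "ord_ge n f \<Longrightarrow> ord_ge n g \<Longrightarrow> ord_ge n (f - g)"
  and ord_ge_mono: "ord_ge n f \<Longrightarrow> m \<le> n \<Longrightarrow> ord_ge m f"
  by (auto simp: ord_ge_def)

lemma ord_ge_sum: "(\<And>a. a \<in> A \<Longrightarrow> ord_ge n (f a)) \<Longrightarrow> ord_ge n (sum f A)"
  by (auto simp: ord_ge_def mcoeff_sum)

lemma ord_ge_mult: assumes "ord_ge m f" "ord_ge n g" shows "ord_ge (m + n) (f * g)"
proof -
  have "mcoeff f P * mcoeff g (M - P) = 0" if "size M < m + n" "P \<subseteq># M" for M P
  proof -
    have "size P < m \<or> size (M - P) < n"
      using that by (metis add_mono leD not_le size_union subset_mset.add_diff_inverse)
    then show ?thesis using assms by (auto simp: ord_ge_def)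
  qed
  then show ?thesis by (auto simp: ord_ge_def mcoeff_mult)
qed

lemma ord_ge_mult_left: "ord_ge n f \<Longrightarrow> ord_ge n (f * g)"
  and ord_ge_mult_right: "ord_ge n f \<Longrightarrow> ord_ge n (g * f)"
  using ord_ge_mult[of n f 0 g] ord_ge_mult[of 0 g n f] by auto

lemma ord_ge_prod: "(\<And>a. a \<in> A \<Longrightarrow> ord_ge (n a) (f a)) \<Longrightarrow> ord_ge (\<Sum>a\<in>A. n a) (\<Prod>a\<in>A. f a)"
  by (induction A rule: infinite_finite_induct) (auto intro: ord_ge_mult)

lemma ord_ge_mvar: "ord_ge 1 (mvar v)"
  by (auto simp: ord_ge_def mvar_def)

lemma ord_ge_power: "ord_ge 1 f \<Longrightarrow> ord_ge n (f ^ n)"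
  by (induction n) (use ord_ge_mult[of 1 f] in fastforce)+

lemma ord_ge_Suc_0: "ord_ge (Suc 0) f \<longleftrightarrow> mcoeff f {#} = 0"
  by (auto simp: ord_ge_def)

definition ord_eq :: "nat \<Rightarrow> ('a, 'b::comm_ring_1) mps \<Rightarrow> bool" where
  "ord_eq n f \<longleftrightarrow> ord_ge n f \<and> (\<exists>M. size M = n \<and> mcoeff f M \<noteq> 0)"

lemma ord_eq_exists: assumes "f \<noteq> 0" shows "\<exists>n. ord_eq n f"
proof -
  from assms obtain M0 where "mcoeff f M0 \<noteq> 0" by (metis mps_eqI mcoeff_0)
  then have "\<exists>n M. size M = n \<and> mcoeff f M \<noteq> 0" by blast
  then obtain n where "\<exists>M. size M = n \<and> mcoeff f M \<noteq> 0"
    "\<And>m. m < n \<Longrightarrow> \<not> (\<exists>M. size M = m \<and> mcoeff f M \<noteq> 0)"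
    using exists_least_iff[of "\<lambda>n. \<exists>M. size M = n \<and> mcoeff f M \<noteq> 0"] by blast
  then show ?thesis by (auto simp: ord_eq_def ord_ge_def)
qed

text \<open>The lowest homogeneous components are nonzero, and so is their product, because series
  over a domain form a domain.\<close>

lemma ord_eq_mult:
  fixes f g :: "('a, 'b::idom) mps"
  assumes f: "ord_eq m f" and g: "ord_eq n g" shows "ord_eq (m + n) (f * g)"
proof -
  define top :: "nat \<Rightarrow> ('a, 'b) mps \<Rightarrow> ('a, 'b) mps"
    where "top k h = Mps (\<lambda>M. if size M = k then mcoeff h M else 0)" for k h
  have top: "mcoeff (top k h) M = (if size M = k then mcoeff h M else 0)" for k h M
    by (simp add: top_def)
  have "top m f \<noteq> 0" "top n g \<noteq> 0"
    using f g unfolding ord_eq_def by (metis mcoeff_0 top)+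
  then have "top m f * top n g \<noteq> 0" by simp
  then obtain M where M: "mcoeff (top m f * top n g) M \<noteq> 0" by (metis mps_eqI mcoeff_0)
  then obtain P where P: "P \<subseteq># M" "mcoeff (top m f) P * mcoeff (top n g) (M - P) \<noteq> 0"
    unfolding mcoeff_mult by (metis (no_types, lifting) mem_Collect_eq sum.neutral)
  have sz: "size M = m + n"
    using P by (auto simp: top split: if_splits) (metis size_union subset_mset.add_diff_inverse)
  have "mcoeff f Q * mcoeff g (M - Q) = mcoeff (top m f) Q * mcoeff (top n g) (M - Q)"
    if "Q \<subseteq># M" for Q
  proof -
    have "size Q + size (M - Q) = m + n"
      using sz that by (metis size_union subset_mset.add_diff_inverse)
    then have "(size Q = m \<and> size (M - Q) = n) \<or> size Q < m \<or> size (M - Q) < n" by linarith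
    then show ?thesis using f g by (auto simp: top ord_eq_def ord_ge_def)
  qed
  then have "mcoeff (f * g) M = mcoeff (top m f * top n g) M"
    by (auto simp: mcoeff_mult intro!: sum.cong)
  then show ?thesis
    using M sz ord_ge_mult[of m f n g] f g by (auto simp: ord_eq_def)
qed

text \<open>Exact orders add, so a bound survives division by a factor of known exact order, such as
  a Vandermonde product or a series with constant term 1.\<close>

lemma ord_ge_cancel:
  fixes f g :: "('a, 'b::idom) mps"
  assumes "ord_eq m f" "ord_ge (m + n) (f * g)" shows "ord_ge n g"
proof (cases "g = 0")
  case False
  then obtain k where "ord_eq k g" using ord_eq_exists by blast
  with ord_eq_mult[OF assms(1)] obtain M where "size M = m + k" "mcoeff (f * g) M \<noteq> 0"
    by (auto simp: ord_eq_def)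
  with assms(2) have "n \<le> k" by (metis add_le_cancel_left leI ord_ge_def)
  with \<open>ord_eq k g\<close> show ?thesis by (auto simp: ord_eq_def intro: ord_ge_mono)
qed simp

lemma ord_eq_1: "ord_eq 0 (1 :: ('a, 'b::comm_ring_1) mps)"
  by (auto simp: ord_eq_def mcoeff_1)

lemma ord_eq_prod:
  fixes f :: "'i \<Rightarrow> ('a, 'b::idom) mps"
  assumes "\<And>i. i \<in> A \<Longrightarrow> ord_eq (n i) (f i)" "finite A"
  shows "ord_eq (\<Sum>i\<in>A. n i) (\<Prod>i\<in>A. f i)"
  using assms(2,1) by (induction A rule: finite_induct) (auto intro: ord_eq_mult simp: ord_eq_1)

lemma ord_eq_mvar_diff: "v \<noteq> w \<Longrightarrow> ord_eq 1 (mvar v - mvar w :: ('a, 'b::comm_ring_1) mps)"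
  unfolding ord_eq_def
  by (intro conjI ord_ge_diff ord_ge_mvar exI[of _ "{#v#}"]) (auto simp: mvar_def)

lemma mvar_diff_nonzero: "v \<noteq> w \<Longrightarrow> mvar v - mvar w \<noteq> (0 :: ('a, 'b::comm_ring_1) mps)"
  using ord_eq_mvar_diff[of v w] unfolding ord_eq_def by (metis mcoeff_0)

section \<open>Units\<close>

text \<open>The inverse is the geometric series in \<open>1 - f\<close>; at a monomial
  \<open>M\<close> only the powers up to \<open>size M\<close> contribute.\<close>

lemma mps_unit_exists:
  fixes f :: "('a, 'b::comm_ring_1) mps"
  assumes "mcoeff f {#} = 1" shows "\<exists>g. f * g = 1"
proof
  define u where "u = 1 - f"
  have u: "ord_ge 1 u" using assms by (simp add: u_def ord_ge_Suc_0 mcoeff_1)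
  define g where "g = Mps (\<lambda>M. mcoeff (\<Sum>k\<le>size M. u ^ k) M)"
  have g: "mcoeff g M = mcoeff (\<Sum>k\<le>n. u ^ k) M" if "size M \<le> n" for M n
  proof -
    have "(\<Sum>k\<le>n. mcoeff (u ^ k) M) = (\<Sum>k\<le>size M. mcoeff (u ^ k) M)"
      using that ord_ge_power[OF u] by (intro sum.mono_neutral_right) (auto simp: ord_ge_def)
    then show ?thesis by (simp add: g_def mcoeff_sum)
  qed
  have "mcoeff (f * g) M = mcoeff 1 M" for M
  proof -
    have "mcoeff (f * g) M = mcoeff (f * (\<Sum>k\<le>size M. u ^ k)) M"
      unfolding mcoeff_mult by (intro sum.cong refl) (use g size_mset_mono[OF diff_subset_eq_self] in metis)
    also have "f * (\<Sum>k\<le>size M. u ^ k) = 1 - u ^ Suc (size M)"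
      using sum_gp_basic[of u "size M"] by (simp add: u_def)
    also have "mcoeff (1 - u ^ Suc (size M)) M = mcoeff 1 M"
      using ord_ge_power[OF u, of "Suc (size M)"] by (simp add: ord_ge_def del: power_Suc)
    finally show ?thesis .
  qed
  then show "f * g = 1" by (rule mps_eqI)
qed

lemma mps_div_unit:
  fixes f g :: "('a, 'b::idom) mps"
  assumes "mcoeff g {#} = 1" shows "g * (f div g) = f" "g \<noteq> 0"
proof -
  obtain h where h: "g * h = 1" using mps_unit_exists[OF assms] by blast
  then show "g \<noteq> 0" by auto
  moreover have "f = g * (h * f)" using h by (simp add: mult.assoc[symmetric])
  ultimately show "g * (f div g) = f" by (metis nonzero_mult_div_cancel_left)
qed

lemma mcoeff_mult_empty: "mcoeff (f * g) {#} = mcoeff f {#} * mcoeff g {#}"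
  by (simp add: mcoeff_mult)

lemma mcoeff_prod_empty: "mcoeff (prod f A) {#} = (\<Prod>a\<in>A. mcoeff (f a) {#})"
  by (induction A rule: infinite_finite_induct) (auto simp: mcoeff_mult_empty mcoeff_1)

section \<open>Infinite sums\<close>

text \<open>Coefficients are discrete, so a convergent net of partial sums is eventually constant at
  each monomial. Adding one further index to a large finite set then shows that its coefficient
  vanishes.\<close>

lemma has_sum_mps_iff:
  fixes u :: "'i \<Rightarrow> ('a, 'b::comm_ring_1) mps"
  shows "(u has_sum s) A \<longleftrightarrow>
    (\<forall>M. finite {k\<in>A. mcoeff (u k) M \<noteq> 0} \<and>
         mcoeff s M = (\<Sum>k | k \<in> A \<and> mcoeff (u k) M \<noteq> 0. mcoeff (u k) M))"
proof
  assume L: "(u has_sum s) A"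
  show "\<forall>M. finite {k\<in>A. mcoeff (u k) M \<noteq> 0} \<and>
         mcoeff s M = (\<Sum>k | k \<in> A \<and> mcoeff (u k) M \<noteq> 0. mcoeff (u k) M)"
  proof
    fix M
    have "open {h :: ('a, 'b) mps. mcoeff h M = mcoeff s M}"
      unfolding open_mps_def by (auto intro!: exI[of _ "{M}"])
    then have "\<forall>\<^sub>F F in finite_subsets_at_top A. sum u F \<in> {h. mcoeff h M = mcoeff s M}"
      using L unfolding has_sum_def by (intro topological_tendstoD) auto
    then obtain F where F: "finite F" "F \<subseteq> A"
      "\<And>G. finite G \<Longrightarrow> F \<subseteq> G \<Longrightarrow> G \<subseteq> A \<Longrightarrow> (\<Sum>k\<in>G. mcoeff (u k) M) = mcoeff s M"
      unfolding eventually_finite_subsets_at_top by (auto simp: mcoeff_sum)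
    have "mcoeff (u k) M = 0" if "k \<in> A - F" for k
      using F(3)[of "insert k F"] F(3)[of F] F(1,2) that by auto
    then have sub: "{k\<in>A. mcoeff (u k) M \<noteq> 0} \<subseteq> F" by auto
    then have "(\<Sum>k | k \<in> A \<and> mcoeff (u k) M \<noteq> 0. mcoeff (u k) M) = (\<Sum>k\<in>F. mcoeff (u k) M)"
      using F by (intro sum.mono_neutral_left) auto
    then show "finite {k\<in>A. mcoeff (u k) M \<noteq> 0} \<and>
         mcoeff s M = (\<Sum>k | k \<in> A \<and> mcoeff (u k) M \<noteq> 0. mcoeff (u k) M)"
      using F sub finite_subset by auto
  qed
next
  assume R: "\<forall>M. finite {k\<in>A. mcoeff (u k) M \<noteq> 0} \<and>
         mcoeff s M = (\<Sum>k | k \<in> A \<and> mcoeff (u k) M \<noteq> 0. mcoeff (u k) M)"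
  show "(u has_sum s) A"
    unfolding has_sum_def
  proof (rule topological_tendstoI)
    fix U assume U: "open U" "s \<in> U"
    then obtain S where S: "finite S" "\<And>g. (\<forall>M\<in>S. mcoeff g M = mcoeff s M) \<Longrightarrow> g \<in> U"
      by (auto simp: open_mps_def)
    define F where "F = (\<Union>M\<in>S. {k\<in>A. mcoeff (u k) M \<noteq> 0})"
    have "sum u G \<in> U" if "finite G" "F \<subseteq> G" "G \<subseteq> A" for G
    proof (rule S(2), rule ballI)
      fix M assume "M \<in> S"
      then have "(\<Sum>k | k \<in> A \<and> mcoeff (u k) M \<noteq> 0. mcoeff (u k) M) = (\<Sum>k\<in>G. mcoeff (u k) M)"
        using that by (intro sum.mono_neutral_left) (auto simp: F_def)
      then show "mcoeff (sum u G) M = mcoeff s M" using R by (simp add: mcoeff_sum)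
    qed
    moreover have "finite F" "F \<subseteq> A" using R S by (auto simp: F_def)
    ultimately show "\<forall>\<^sub>F G in finite_subsets_at_top A. sum u G \<in> U"
      unfolding eventually_finite_subsets_at_top by blast
  qed
qed

lemma has_sum_mpsI:
  fixes u :: "'i \<Rightarrow> ('a, 'b::comm_ring_1) mps"
  assumes "\<And>M. \<exists>F. finite F \<and> F \<subseteq> A \<and> (\<forall>k\<in>A - F. mcoeff (u k) M = 0) \<and>
             mcoeff s M = (\<Sum>k\<in>F. mcoeff (u k) M)"
  shows "(u has_sum s) A"
  unfolding has_sum_mps_iff
proof
  fix M
  obtain F where F: "finite F" "F \<subseteq> A" "\<forall>k\<in>A - F. mcoeff (u k) M = 0"
    "mcoeff s M = (\<Sum>k\<in>F. mcoeff (u k) M)" using assms by blast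
  then have sub: "{k\<in>A. mcoeff (u k) M \<noteq> 0} \<subseteq> F" by auto
  then have "(\<Sum>k | k \<in> A \<and> mcoeff (u k) M \<noteq> 0. mcoeff (u k) M) = (\<Sum>k\<in>F. mcoeff (u k) M)"
    using F by (intro sum.mono_neutral_left) auto
  then show "finite {k\<in>A. mcoeff (u k) M \<noteq> 0} \<and>
       mcoeff s M = (\<Sum>k | k \<in> A \<and> mcoeff (u k) M \<noteq> 0. mcoeff (u k) M)"
    using F sub finite_subset by auto
qed

lemma has_sum_mpsD:
  fixes u :: "'i \<Rightarrow> ('a, 'b::comm_ring_1) mps"
  assumes "(u has_sum s) A"
  obtains F where "finite F" "F \<subseteq> A" "\<And>k. k \<in> A - F \<Longrightarrow> mcoeff (u k) M = 0"
    "\<And>G. finite G \<Longrightarrow> F \<subseteq> G \<Longrightarrow> G \<subseteq> A \<Longrightarrow> mcoeff s M = (\<Sum>k\<in>G. mcoeff (u k) M)"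
proof (rule that[of "{k\<in>A. mcoeff (u k) M \<noteq> 0}"])
  fix G assume "finite G" "{k\<in>A. mcoeff (u k) M \<noteq> 0} \<subseteq> G" "G \<subseteq> A"
  then show "mcoeff s M = (\<Sum>k\<in>G. mcoeff (u k) M)"
    using assms unfolding has_sum_mps_iff by (auto intro!: sum.mono_neutral_left)
qed (use assms in \<open>auto simp: has_sum_mps_iff\<close>)

lemma has_sum_mps_diff:
  fixes u v :: "'i \<Rightarrow> ('a, 'b::comm_ring_1) mps"
  assumes "(u has_sum s) A" "(v has_sum t) A"
  shows "((\<lambda>k. u k - v k) has_sum (s - t)) A"
proof (rule has_sum_mpsI)
  fix M
  obtain F where F: "finite F" "F \<subseteq> A" "\<And>k. k \<in> A - F \<Longrightarrow> mcoeff (u k) M = 0"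
    "\<And>G. finite G \<Longrightarrow> F \<subseteq> G \<Longrightarrow> G \<subseteq> A \<Longrightarrow> mcoeff s M = (\<Sum>k\<in>G. mcoeff (u k) M)"
    using has_sum_mpsD[OF assms(1)] by blast
  obtain F' where F': "finite F'" "F' \<subseteq> A" "\<And>k. k \<in> A - F' \<Longrightarrow> mcoeff (v k) M = 0"
    "\<And>G. finite G \<Longrightarrow> F' \<subseteq> G \<Longrightarrow> G \<subseteq> A \<Longrightarrow> mcoeff t M = (\<Sum>k\<in>G. mcoeff (v k) M)"
    using has_sum_mpsD[OF assms(2)] by blast
  show "\<exists>F. finite F \<and> F \<subseteq> A \<and> (\<forall>k\<in>A - F. mcoeff (u k - v k) M = 0) \<and>
             mcoeff (s - t) M = (\<Sum>k\<in>F. mcoeff (u k - v k) M)"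
    using F(1-3) F'(1-3) F(4)[of "F \<union> F'"] F'(4)[of "F \<union> F'"]
    by (intro exI[of _ "F \<union> F'"]) (simp add: sum_subtractf)
qed

lemma has_sum_mps_mult:
  fixes u :: "'i \<Rightarrow> ('a, 'b::comm_ring_1) mps"
  assumes "(u has_sum s) A" shows "((\<lambda>k. f * u k) has_sum (f * s)) A"
proof (rule has_sum_mpsI)
  fix M
  define F where "F = (\<Union>P\<in>{P. P \<subseteq># M}. {k\<in>A. mcoeff (u k) P \<noteq> 0})"
  have F: "finite F" "F \<subseteq> A" using assms by (auto simp: F_def finite_submultisets has_sum_mps_iff)
  have z: "mcoeff (u k) P = 0" if "k \<in> A - F" "P \<subseteq># M" for k P using that by (auto simp: F_def)
  have s: "mcoeff s P = (\<Sum>k\<in>F. mcoeff (u k) P)" if P: "P \<subseteq># M" for P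
  proof -
    have "(\<Sum>k | k \<in> A \<and> mcoeff (u k) P \<noteq> 0. mcoeff (u k) P) = (\<Sum>k\<in>F. mcoeff (u k) P)"
      using F P by (intro sum.mono_neutral_left) (auto simp: F_def)
    then show ?thesis using assms by (simp add: has_sum_mps_iff)
  qed
  have "mcoeff (f * s) M = (\<Sum>P | P \<subseteq># M. \<Sum>k\<in>F. mcoeff f P * mcoeff (u k) (M - P))"
    by (simp add: mcoeff_mult s sum_distrib_left)
  also have "\<dots> = (\<Sum>k\<in>F. mcoeff (f * u k) M)"
    unfolding mcoeff_mult by (rule sum.swap)
  finally show "\<exists>F. finite F \<and> F \<subseteq> A \<and> (\<forall>k\<in>A - F. mcoeff (f * u k) M = 0) \<and>
             mcoeff (f * s) M = (\<Sum>k\<in>F. mcoeff (f * u k) M)"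
    using F z by (intro exI[of _ F]) (auto simp: mcoeff_mult)
qed

lemma has_sum_restrict_vars:
  fixes u :: "'i \<Rightarrow> ('a, 'b::comm_ring_1) mps"
  assumes "(u has_sum s) A" shows "((\<lambda>k. restrict_vars S (u k)) has_sum (restrict_vars S s)) A"
  using assms unfolding has_sum_mps_iff by (auto simp: mcoeff_restrict_vars)

text \<open>The convergence criterion for the series in \<beta> and for the sums over partitions:
  only finitely many terms may start in any bounded degree.\<close>

lemma has_sum_mps_ord:
  fixes u :: "'i \<Rightarrow> ('a, 'b::comm_ring_1) mps"
  assumes "\<And>k. k \<in> A \<Longrightarrow> ord_ge (w k) (u k)" "\<And>n. finite {k\<in>A. w k \<le> n}"
  shows "\<exists>s. (u has_sum s) A \<and>
    (\<forall>M n. size M \<le> n \<longrightarrow> mcoeff s M = (\<Sum>k | k \<in> A \<and> w k \<le> n. mcoeff (u k) M))"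
proof (intro exI conjI allI impI)
  let ?s = "Mps (\<lambda>M. \<Sum>k | k \<in> A \<and> w k \<le> size M. mcoeff (u k) M)"
  have z: "mcoeff (u k) M = 0" if "k \<in> A" "size M < w k" for k M
    using assms(1) that by (auto simp: ord_ge_def)
  show *: "mcoeff ?s M = (\<Sum>k | k \<in> A \<and> w k \<le> n. mcoeff (u k) M)" if "size M \<le> n" for M n
    unfolding mcoeff_Mps using assms(2) that
    by (intro sum.mono_neutral_left) (auto intro!: z)
  show "(u has_sum ?s) A"
  proof (rule has_sum_mpsI)
    fix M
    show "\<exists>F. finite F \<and> F \<subseteq> A \<and> (\<forall>k\<in>A - F. mcoeff (u k) M = 0) \<and>
             mcoeff ?s M = (\<Sum>k\<in>F. mcoeff (u k) M)"
      using assms(2) by (intro exI[of _ "{k \<in> A. w k \<le> size M}"]) (auto intro!: z)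
  qed
qed

section \<open>Series in a subset of the indeterminates\<close>

definition vars_in :: "'a set \<Rightarrow> ('a, 'b::comm_ring_1) mps \<Rightarrow> bool" where
  "vars_in S f \<longleftrightarrow> (\<forall>M. mcoeff f M \<noteq> 0 \<longrightarrow> set_mset M \<subseteq> S)"

lemma vars_in_iff: "vars_in S f \<longleftrightarrow> restrict_vars S f = f"
proof
  assume "restrict_vars S f = f"
  then show "vars_in S f" unfolding vars_in_def by (metis mcoeff_restrict_vars)
next
  assume "vars_in S f"
  then show "restrict_vars S f = f"
    unfolding vars_in_def by (intro mps_eqI) (metis mcoeff_restrict_vars)
qed

lemma vars_in_mono: "vars_in S f \<Longrightarrow> S \<subseteq> T \<Longrightarrow> vars_in T f"
  by (auto simp: vars_in_def)

lemma vars_in_mvar: "v \<in> S \<Longrightarrow> vars_in S (mvar v)"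
  by (simp add: vars_in_iff restrict_vars_mvar)

lemma vars_in_0 [simp]: "vars_in S 0"
  and vars_in_1 [simp]: "vars_in S 1"
  and vars_in_add: "vars_in S f \<Longrightarrow> vars_in S g \<Longrightarrow> vars_in S (f + g)"
  and vars_in_diff: "vars_in S f \<Longrightarrow> vars_in S g \<Longrightarrow> vars_in S (f - g)"
  and vars_in_uminus: "vars_in S f \<Longrightarrow> vars_in S (- f)"
  and vars_in_mult: "vars_in S f \<Longrightarrow> vars_in S g \<Longrightarrow> vars_in S (f * g)"
  and vars_in_power: "vars_in S f \<Longrightarrow> vars_in S (f ^ n)"
  by (simp_all add: vars_in_iff hom_simps[OF restrict_vars_hom])

lemma vars_in_sum: "(\<And>a. a \<in> A \<Longrightarrow> vars_in S (f a)) \<Longrightarrow> vars_in S (sum f A)"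
  and vars_in_prod: "(\<And>a. a \<in> A \<Longrightarrow> vars_in S (f a)) \<Longrightarrow> vars_in S (prod f A)"
  by (simp_all add: vars_in_iff hom_simps[OF restrict_vars_hom])

lemma vars_in_of_int: "vars_in S (of_int z)"
proof -
  have "vars_in S (of_nat n)" for n by (induction n) (auto intro: vars_in_add)
  then show ?thesis by (cases z rule: int_cases2) (auto intro: vars_in_uminus)
qed

text \<open>The restriction homomorphism fixes \<open>f\<close> and \<open>g\<close>, hence also
  their quotient.\<close>

lemma vars_in_div:
  fixes f g :: "('a, 'b::idom) mps"
  assumes "vars_in S f" "vars_in S g" "mcoeff g {#} = 1"
  shows "vars_in S (f div g)"
proof -
  have "g * restrict_vars S (f div g) = restrict_vars S (g * (f div g))"
    using assms by (simp add: hom_simps[OF restrict_vars_hom] vars_in_iff)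
  also have "\<dots> = g * (f div g)" using assms by (simp add: mps_div_unit(1) vars_in_iff)
  finally show ?thesis using mps_div_unit(2)[OF assms(3)] by (simp add: vars_in_iff)
qed

lemma vars_in_has_sum:
  assumes "(u has_sum s) A" "\<And>k. k \<in> A \<Longrightarrow> vars_in S (u k)" shows "vars_in S s"
  unfolding vars_in_def
proof (intro allI impI)
  fix M assume nz: "mcoeff s M \<noteq> 0"
  have "mcoeff s M = (\<Sum>k | k \<in> A \<and> mcoeff (u k) M \<noteq> 0. mcoeff (u k) M)"
    using assms(1) by (simp add: has_sum_mps_iff)
  with nz have "\<exists>k\<in>A. mcoeff (u k) M \<noteq> 0"
    by (metis (mono_tags, lifting) mem_Collect_eq sum.neutral)
  with assms(2) show "set_mset M \<subseteq> S" by (auto simp: vars_in_def)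
qed

abbreviation param_vars :: "var set" where "param_vars \<equiv> insert Beta (range Par)"

lemma parameter_seqD:
  assumes "parameter_seq b" shows "mcoeff (b i) {#} = 0" "vars_in param_vars (b i)"
  using assms by (auto simp: parameter_seq_def vars_in_def)

lemma vars_in_beta: "vars_in param_vars beta"
  by (simp add: vars_in_mvar)

section \<open>Supersymmetric complete functions\<close>

text \<open>Passes from an identity of generating functions to their coefficients at integer
  indices, with the value 0 at negative ones. Adding a factor to the numerator and to the
  denominator are both of this shape.\<close>

lemma fps_shift_nth:
  fixes G K :: "ps fps"
  assumes "H = G + fps_const a * (fps_X * K)"
  shows "(if n < 0 then 0 else fps_nth H (nat n)) =
         (if n < 0 then 0 else fps_nth G (nat n)) + a * (if n - 1 < 0 then 0 else fps_nth K (nat (n - 1)))"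
proof -
  have "fps_nth (fps_X * K) (nat n) = (if n - 1 < 0 then 0 else fps_nth K (nat (n - 1)))" if "n \<ge> 0"
    using that by (auto simp: nat_diff_distrib)
  then show ?thesis unfolding assms by auto
qed

lemma fps_denominator_inverse:
  fixes x :: "nat \<Rightarrow> ps"
  shows "(\<Prod>i<p. 1 - fps_const (x i) * fps_X) * fps_right_inverse (\<Prod>i<p. 1 - fps_const (x i) * fps_X) 1 = 1"
proof (rule fps_right_inverse)
  have "fps_nth (\<Prod>i<p. 1 - fps_const (x i) * fps_X) 0 = 1"
    by (induction p) auto
  then show "fps_nth (\<Prod>i<p. 1 - fps_const (x i) * fps_X) 0 * 1 = 1" by simp
qed

lemma super_h_neg: "n < 0 \<Longrightarrow> super_h p x q y n = 0"
  by (simp add: super_h_def)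

lemma super_h_cong_0: "super_h p x 0 y n = super_h p x 0 z n"
  by (simp add: super_h_def)

lemma super_h_Suc_num:
  "super_h p x (Suc q) y n = super_h p x q y n + y q * super_h p x q y (n - 1)"
  unfolding super_h_def by (rule fps_shift_nth) (simp add: algebra_simps)

lemma super_h_Suc_den:
  "super_h (Suc p) x q y n = super_h p x q y n + x p * super_h (Suc p) x q y (n - 1)"
proof -
  let ?D = "\<lambda>p. \<Prod>i<p. 1 - fps_const (x i) * fps_X"
  let ?I = "\<lambda>p. fps_right_inverse (?D p) 1"
  define Z where "Z = ?I (Suc p)"
  have "?I p = ?I p * (?D (Suc p) * Z)"
    by (simp add: Z_def fps_denominator_inverse del: prod.lessThan_Suc)
  also have "\<dots> = (?D p * ?I p) * ((1 - fps_const (x p) * fps_X) * Z)"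
    by (simp only: prod.lessThan_Suc mult_ac)
  also have "\<dots> = (1 - fps_const (x p) * fps_X) * Z"
    by (simp only: fps_denominator_inverse mult_1)
  finally have I: "?I p = (1 - fps_const (x p) * fps_X) * Z" .
  have "Z = ?I p + fps_const (x p) * (fps_X * Z)"
    unfolding I by (simp add: algebra_simps)
  then have "?I (Suc p) = ?I p + fps_const (x p) * (fps_X * ?I (Suc p))"
    unfolding Z_def .
  then have "P * ?I (Suc p) = P * ?I p + fps_const (x p) * (fps_X * (P * ?I (Suc p)))" for P
    by (metis (no_types, lifting) distrib_left mult.left_commute)
  then show ?thesis unfolding super_h_def by (rule fps_shift_nth)
qed

lemma super_h_cancel: "super_h p x p (\<lambda>l. - x l) n = (if n = 0 then 1 else 0)"
proof -
  have "(\<Prod>j<p. 1 + fps_const (- x j) * fps_X) = (\<Prod>j<p. 1 - fps_const (x j) * fps_X)"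
    by (simp flip: fps_const_neg)
  then show ?thesis by (simp add: super_h_def fps_denominator_inverse)
qed

text \<open>After cancellation the generating function is a product of \<open>d\<close> linear
  factors, hence a polynomial of degree at most \<open>d\<close>.\<close>

lemma super_h_cancel_poly:
  assumes "n > int d" shows "super_h p x (p + d) (\<lambda>l. - x l) n = 0"
  using assms
proof (induction d arbitrary: n)
  case (Suc d)
  then show ?case using Suc.IH[of n] Suc.IH[of "n - 1"] by (simp add: super_h_Suc_num)
qed (simp add: super_h_cancel)

lemma super_h_cancel_0: "p > 0 \<Longrightarrow> super_h p x (p - 1) (\<lambda>l. - x l) 0 = 1"
  using super_h_Suc_num[of p x "p - 1" "\<lambda>l. - x l" 0]
  by (simp add: super_h_cancel super_h_neg)

lemma super_h_graded:
  assumes "\<And>i. ord_ge 1 (x i)" "\<And>i. ord_ge 1 (y i)" "\<And>i. vars_in S (x i)" "\<And>i. vars_in S (y i)"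
  shows "ord_ge (nat n) (super_h p x q y n) \<and> vars_in S (super_h p x q y n)"
proof -
  have step: "ord_ge (nat n) (a * f) \<and> vars_in S (a * f)"
    if "ord_ge 1 a" "vars_in S a" "ord_ge (nat (n - 1)) f \<and> vars_in S f" for a f n
  proof -
    have "ord_ge (1 + nat (n - 1)) (a * f)" using that ord_ge_mult by blast
    then have "ord_ge (nat n) (a * f)" by (rule ord_ge_mono) auto
    with that show ?thesis by (simp add: vars_in_mult)
  qed
  show ?thesis
  proof (induction q arbitrary: n)
    case 0
    show ?case
    proof (induction p arbitrary: n)
      case 0
      have "super_h 0 x 0 y n = super_h 0 x 0 (\<lambda>l. - x l) n" by (rule super_h_cong_0)
      then show ?case by (simp add: super_h_cancel)
    next
      case (Suc p)
      note IHp = Suc.IH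
      \<comment> \<open>The recurrence for a new denominator factor refers to the same
        \<open>Suc p\<close> at \<open>n - 1\<close>, so a second induction runs over a bound for
        \<open>n\<close> and starts at the negative indices.\<close>
      have "ord_ge (nat n) (super_h (Suc p) x 0 y n) \<and> vars_in S (super_h (Suc p) x 0 y n)"
        if "n < int k" for k n using that
      proof (induction k arbitrary: n)
        case (Suc k)
        then have "ord_ge (nat (n - 1)) (super_h (Suc p) x 0 y (n - 1)) \<and>
            vars_in S (super_h (Suc p) x 0 y (n - 1))" by simp
        from step[OF assms(1,3) this] IHp[of n] show ?case
          by (subst (1 2) super_h_Suc_den) (auto intro: ord_ge_add vars_in_add)
      qed (simp add: super_h_neg)
      from this[of n "nat n + 1"] show ?case by simp
    qed
  next
    case (Suc q)
    then show ?case using step[OF assms(2,4) Suc]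
      unfolding super_h_Suc_num by (auto intro: ord_ge_add vars_in_add)
  qed
qed

section \<open>Binomial series in \<open>\<beta>\<close>\<close>

lemma int_gbinomial_0 [simp]: "int_gbinomial a 0 = 1"
  by (simp add: int_gbinomial_def)

text \<open>The integer division in the definition is exact because \<open>fact k\<close> divides
  every Pochhammer product.\<close>

lemma int_gbinomial_fact: "int_gbinomial a k * fact k = (\<Prod>i<k. a - int i)"
proof -
  have "(\<Prod>i<k. a - int i) = (- 1) ^ k * pochhammer (- a) k"
    using falling_fact_pochhammer[of a k] by (simp add: atLeast0LessThan)
  then have "fact k dvd (\<Prod>i<k. a - int i)" using fact_dvd_pochhammer[of k "- a"] by simp
  then show ?thesis by (simp add: int_gbinomial_def)
qed

lemma int_gbinomial_Suc_Suc:
  "int_gbinomial (a + 1) (Suc k) = int_gbinomial a (Suc k) + int_gbinomial a k"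
proof -
  have "int_gbinomial (a + 1) (Suc k) * fact (Suc k) = (a + 1) * (\<Prod>i<k. a - int i)"
    unfolding int_gbinomial_fact by (simp add: prod.lessThan_Suc_shift del: prod.lessThan_Suc)
  also have "\<dots> = (\<Prod>i<Suc k. a - int i) + (1 + int k) * (\<Prod>i<k. a - int i)"
    by (simp add: algebra_simps)
  also have "\<dots> = (int_gbinomial a (Suc k) + int_gbinomial a k) * fact (Suc k)"
    unfolding int_gbinomial_fact[symmetric] by (simp add: algebra_simps)
  finally show ?thesis by simp
qed

lemma int_gbinomial_eq_0: assumes "k > n" shows "int_gbinomial (int n) k = 0"
proof -
  have "(\<Prod>i<k. int n - int i) = 0" using assms by (intro prod_zero) auto
  then show ?thesis by (simp only: int_gbinomial_def div_0)
qed

text \<open>The coefficients \<open>a\<close> may be arbitrary series: the power of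
  \<open>beta\<close> alone makes the terms tend to 0.\<close>

definition beta_sum :: "(nat \<Rightarrow> ps) \<Rightarrow> ps" where
  "beta_sum a = (\<Sum>\<^sub>\<infinity>s. beta ^ s * a s)"

lemma beta_sum: "((\<lambda>s. beta ^ s * a s) has_sum beta_sum a) UNIV"
  and mcoeff_beta_sum: "size M < N \<Longrightarrow> mcoeff (beta_sum a) M = mcoeff (\<Sum>s<N. beta ^ s * a s) M"
proof -
  have "\<exists>t. ((\<lambda>s. beta ^ s * a s) has_sum t) UNIV \<and> (\<forall>M n. size M \<le> n \<longrightarrow>
      mcoeff t M = (\<Sum>k | k \<in> UNIV \<and> k \<le> n. mcoeff (beta ^ k * a k) M))"
  proof (rule has_sum_mps_ord[where w = "\<lambda>k. k" and u = "\<lambda>s. beta ^ s * a s"])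
    show "ord_ge k (beta ^ k * a k)" for k
      by (intro ord_ge_mult_left ord_ge_power ord_ge_mvar)
  qed simp
  then obtain t where t: "((\<lambda>s. beta ^ s * a s) has_sum t) UNIV"
    "\<And>M n. size M \<le> n \<Longrightarrow> mcoeff t M = (\<Sum>k | k \<in> UNIV \<and> k \<le> n. mcoeff (beta ^ k * a k) M)"
    by blast
  have eq: "beta_sum a = t" unfolding beta_sum_def using t(1) by (rule infsumI)
  then show "((\<lambda>s. beta ^ s * a s) has_sum beta_sum a) UNIV" using t(1) by simp
  assume "size M < N"
  then obtain n where n: "N = Suc n" "size M \<le> n" by (metis less_Suc_eq_le less_imp_Suc_add)
  have "{k. k \<in> UNIV \<and> k \<le> n} = {..<N}" using n(1) by auto
  then show "mcoeff (beta_sum a) M = mcoeff (\<Sum>s<N. beta ^ s * a s) M"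
    by (simp only: eq t(2)[OF n(2)] mcoeff_sum)
qed

lemma beta_sum_eqI:
  assumes "\<And>N. ord_ge N ((\<Sum>s<N. beta ^ s * a s) - f)" shows "beta_sum a = f"
proof (rule mps_eqI)
  fix M
  have "mcoeff ((\<Sum>s<Suc (size M). beta ^ s * a s) - f) M = 0"
    by (rule ord_geD[OF assms lessI])
  then show "mcoeff (beta_sum a) M = mcoeff f M"
    by (simp only: mcoeff_beta_sum[OF lessI] mcoeff_diff eq_iff_diff_eq_0[symmetric])
qed

lemma beta_sum_ord: "ord_ge N ((\<Sum>s<N. beta ^ s * a s) - beta_sum a)"
  by (simp add: ord_ge_def mcoeff_beta_sum)

lemma beta_sum_add: "beta_sum (\<lambda>s. a s + a' s) = beta_sum a + beta_sum a'"
proof (rule beta_sum_eqI)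
  fix N
  have "(\<Sum>s<N. beta ^ s * (a s + a' s)) - (beta_sum a + beta_sum a') =
      ((\<Sum>s<N. beta ^ s * a s) - beta_sum a) + ((\<Sum>s<N. beta ^ s * a' s) - beta_sum a')"
    by (simp add: distrib_left sum.distrib)
  then show "ord_ge N ((\<Sum>s<N. beta ^ s * (a s + a' s)) - (beta_sum a + beta_sum a'))"
    by (simp only: ord_ge_add beta_sum_ord)
qed

lemma beta_sum_mult: "beta_sum (\<lambda>s. c * a s) = c * beta_sum a"
proof (rule beta_sum_eqI)
  fix N
  have "(\<Sum>s<N. beta ^ s * (c * a s)) - c * beta_sum a = c * ((\<Sum>s<N. beta ^ s * a s) - beta_sum a)"
    by (simp add: right_diff_distrib sum_distrib_left mult.left_commute)
  then show "ord_ge N ((\<Sum>s<N. beta ^ s * (c * a s)) - c * beta_sum a)"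
    by (simp only: ord_ge_mult_right beta_sum_ord)
qed

lemma beta_sum_0: "beta_sum (\<lambda>s. 0) = 0"
  by (rule beta_sum_eqI) simp

text \<open>Read \<open>a s\<close> as the value of a functional at x^s g. The left side then
  evaluates (1 + \<beta> x)^p at (1 + \<beta> x) g, and Pascal's rule raises the exponent to
  \<open>p + 1\<close>. The boundary term of the partial sums has order at least \<open>N\<close>
  and disappears in the limit.\<close>

lemma beta_sum_shift:
  "beta_sum (\<lambda>s. of_int (int_gbinomial p s) * (a s + beta * a (Suc s))) =
   beta_sum (\<lambda>s. of_int (int_gbinomial (p + 1) s) * a s)" (is "_ = beta_sum ?R")
proof (rule beta_sum_eqI)
  fix N
  have fin: "(\<Sum>s<N. beta ^ s * (of_int (int_gbinomial p s) * (a s + beta * a (Suc s)))) =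
      (\<Sum>s<Suc N. beta ^ s * ?R s) - beta ^ N * (of_int (int_gbinomial p N) * a N)"
  proof (induction N)
    case (Suc N)
    have "int_gbinomial (1 + p) (Suc N) = int_gbinomial p (Suc N) + int_gbinomial p N"
      using int_gbinomial_Suc_Suc[of p N] by (simp add: add.commute)
    then show ?case unfolding sum.lessThan_Suc[of _ N] Suc.IH sum.lessThan_Suc[of _ "Suc N"]
      by (simp add: algebra_simps)
  qed simp
  have h1: "ord_ge N ((\<Sum>s<Suc N. beta ^ s * ?R s) - beta_sum ?R)"
    using beta_sum_ord by (rule ord_ge_mono) simp
  have h2: "ord_ge N (beta ^ N * (of_int (int_gbinomial p N) * a N))"
    by (intro ord_ge_mult_left ord_ge_power ord_ge_mvar)
  show "ord_ge N ((\<Sum>s<N. beta ^ s * (of_int (int_gbinomial p s) * (a s + beta * a (Suc s)))) - beta_sum ?R)"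
    using ord_ge_diff[OF h1 h2] unfolding fin by (simp only: diff_diff_eq add.commute)
qed

lemma beta_sum_graded:
  assumes "\<And>s. ord_ge n (a s)" "\<And>s. vars_in param_vars (a s)"
  shows "ord_ge n (beta_sum a)" "vars_in param_vars (beta_sum a)"
proof -
  have "ord_ge n (\<Sum>s<N. beta ^ s * a s)" for N
    by (intro ord_ge_sum ord_ge_mult_right assms(1))
  then show "ord_ge n (beta_sum a)"
    unfolding ord_ge_def[of n "beta_sum a"] mcoeff_beta_sum[OF lessI] by (blast intro: ord_geD)
  show "vars_in param_vars (beta_sum a)"
    by (rule vars_in_has_sum[OF beta_sum]) (intro vars_in_mult vars_in_power vars_in_beta assms)
qed

section \<open>Dual functionals\<close>

text \<open>For \<open>m > 0\<close> the monic polynomial x (x - c_1) ... (x - c_(m-1)) of degree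
  \<open>m\<close>. Truncated subtraction makes \<open>fac c 0\<close> equal to
  \<open>fac c 1\<close>, hence the positivity hypotheses below.\<close>

definition fac :: "(nat \<Rightarrow> ps) \<Rightarrow> nat \<Rightarrow> ps poly" where
  "fac c m = [:0, 1:] * (\<Prod>l<m - 1. [:- c l, 1:])"

text \<open>\<open>dual_fun b k g\<close> is the coefficient of \<open>1/x\<close> in the expansion at infinity of
  \<open>g(x) / (x (x - b\<^sub>1) \<cdots> (x - b\<^sub>k))\<close>.\<close>

definition dual_fun :: "(nat \<Rightarrow> ps) \<Rightarrow> nat \<Rightarrow> ps poly \<Rightarrow> ps" where
  "dual_fun b k g = (\<Sum>i\<le>degree g. coeff g i * super_h k b 0 (\<lambda>_. 0) (int i - int k))"

lemma dual_fun_bound: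
  assumes "degree g \<le> n"
  shows "dual_fun b k g = (\<Sum>i\<le>n. coeff g i * super_h k b 0 (\<lambda>_. 0) (int i - int k))"
  unfolding dual_fun_def using assms
  by (intro sum.mono_neutral_left) (auto simp: coeff_eq_0)

lemma dual_fun_add: "dual_fun b k (g + h) = dual_fun b k g + dual_fun b k h"
proof -
  let ?n = "max (degree g) (degree h)"
  show ?thesis
    using dual_fun_bound[of "g + h" ?n b k] dual_fun_bound[of g ?n b k] dual_fun_bound[of h ?n b k]
    by (simp add: degree_add_le_max algebra_simps sum.distrib)
qed

lemma dual_fun_smult: "dual_fun b k (smult a g) = a * dual_fun b k g"
  using dual_fun_bound[of "smult a g" "degree g" b k]
  by (simp add: dual_fun_def degree_smult_le sum_distrib_left mult.assoc)

lemma dual_fun_monom: "dual_fun b k ([:0, 1:] ^ n) = super_h k b 0 (\<lambda>_. 0) (int n - int k)"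
proof -
  have "[:0, 1:] ^ n = (monom 1 n :: ps poly)" by (simp add: monom_altdef)
  then have "dual_fun b k ([:0, 1:] ^ n) =
      (\<Sum>i\<le>n. (if i = n then super_h k b 0 (\<lambda>_. 0) (int n - int k) else 0))"
    by (simp only: dual_fun_bound[OF degree_monom_le]) (intro sum.cong refl, simp)
  then show ?thesis by simp
qed

lemma fac_Suc: "fac c (Suc (Suc m)) = [:0, 1:] * fac c (Suc m) + smult (- c m) (fac c (Suc m))"
proof -
  have "fac c (Suc (Suc m)) = [:- c m, 1:] * fac c (Suc m)"
    by (simp add: fac_def algebra_simps)
  also have "[:- c m, 1:] = [:0, 1:] + [:- c m:]" by simp
  finally show ?thesis by (simp only: distrib_right) simp
qed

text \<open>Each linear factor x - c_l of the polynomial becomes a numerator factor 1 - c_l t of the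
  generating function, so both sides obey the same recurrence. The free exponent \<open>s\<close>
  absorbs the factor x.\<close>

lemma dual_fun_fac:
  assumes "m > 0"
  shows "dual_fun b k ([:0, 1:] ^ s * fac c m) = super_h k b (m - 1) (\<lambda>l. - c l) (int m - int k + int s)"
proof -
  obtain m' where m': "m = Suc m'" using assms gr0_implies_Suc by blast
  have "dual_fun b k ([:0, 1:] ^ s * fac c (Suc m')) =
      super_h k b m' (\<lambda>l. - c l) (int (Suc m') - int k + int s)"
  proof (induction m' arbitrary: s)
    case 0
    have "[:0, 1:] ^ s * fac c (Suc 0) = [:0, 1:] ^ Suc s" by (simp add: fac_def)
    then show ?case using super_h_cong_0[of k b "\<lambda>_. 0" _ "\<lambda>l. - c l"]
      by (simp add: dual_fun_monom del: power_Suc) (simp add: algebra_simps)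
  next
    case (Suc m')
    have "[:0, 1:] ^ s * fac c (Suc (Suc m')) =
        [:0, 1:] ^ Suc s * fac c (Suc m') + smult (- c m') ([:0, 1:] ^ s * fac c (Suc m'))"
      unfolding fac_Suc by (simp only: distrib_left mult_smult_right power_Suc mult.assoc mult.left_commute)
    then have "dual_fun b k ([:0, 1:] ^ s * fac c (Suc (Suc m'))) =
        super_h k b m' (\<lambda>l. - c l) (int (Suc m') - int k + int (Suc s)) +
        (- c m') * super_h k b m' (\<lambda>l. - c l) (int (Suc m') - int k + int s)"
      by (simp only: dual_fun_add dual_fun_smult Suc.IH)
    also have "\<dots> = super_h k b (Suc m') (\<lambda>l. - c l) (int (Suc (Suc m')) - int k + int s)"
      unfolding super_h_Suc_num by (simp add: algebra_simps)
    finally show ?case .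
  qed
  then show ?thesis by (simp add: m')
qed

text \<open>\<open>dual_beta b p k g\<close> is \<open>dual_fun b k\<close> applied to \<open>(1 + \<beta> x)\<^sup>p g(x)\<close>, for an integer \<open>p\<close>.\<close>

definition dual_beta :: "(nat \<Rightarrow> ps) \<Rightarrow> int \<Rightarrow> nat \<Rightarrow> ps poly \<Rightarrow> ps" where
  "dual_beta b p k g = beta_sum (\<lambda>s. of_int (int_gbinomial p s) * dual_fun b k ([:0, 1:] ^ s * g))"

lemma dual_beta_add: "dual_beta b p k (g + h) = dual_beta b p k g + dual_beta b p k h"
  unfolding dual_beta_def by (simp only: distrib_left dual_fun_add beta_sum_add)

lemma dual_beta_smult: "dual_beta b p k (smult a g) = a * dual_beta b p k g"
  unfolding dual_beta_def
  by (simp only: mult_smult_right dual_fun_smult mult.left_commute[of _ a] beta_sum_mult)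

lemma dual_beta_shift: "dual_beta b p k ([:1, beta:] * g) = dual_beta b (p + 1) k g"
proof -
  have *: "dual_fun b k ([:0, 1:] ^ s * ([:1, beta:] * g)) =
      dual_fun b k ([:0, 1:] ^ s * g) + beta * dual_fun b k ([:0, 1:] ^ Suc s * g)" for s
  proof -
    have "[:1, beta:] = 1 + smult beta [:0, 1:]" by (simp add: one_pCons)
    then have "[:0, 1:] ^ s * ([:1, beta:] * g) =
        [:0, 1:] ^ s * g + smult beta ([:0, 1:] ^ Suc s * g)"
      by (simp only: distrib_left distrib_right mult_smult_left mult_smult_right mult_1 power_Suc mult.assoc mult.left_commute)
    then show ?thesis by (simp only: dual_fun_add dual_fun_smult)
  qed
  show ?thesis unfolding dual_beta_def *
    by (rule beta_sum_shift[of p "\<lambda>s. dual_fun b k ([:0, 1:] ^ s * g)"])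
qed

text \<open>Merges the power \<open>i\<close> carried by a row with the exponent -j of a column into
  the upper entry i - j of the binomial.\<close>

lemma dual_beta_shift_power: "dual_beta b p k ([:1, beta:] ^ i * g) = dual_beta b (p + int i) k g"
proof (induction i arbitrary: p)
  case (Suc i)
  have "dual_beta b p k ([:1, beta:] ^ Suc i * g) = dual_beta b p k ([:1, beta:] * ([:1, beta:] ^ i * g))"
    by (simp only: power_Suc mult.assoc)
  then show ?case by (simp only: dual_beta_shift Suc.IH) (simp add: algebra_simps)
qed simp

lemma dual_beta_fac:
  assumes "m > 0"
  shows "dual_beta b p k (fac c m) = (\<Sum>\<^sub>\<infinity>s. beta ^ s * of_int (int_gbinomial p s) *
           super_h k b (m - 1) (\<lambda>l. - c l) (int m - int k + int s))"
  unfolding dual_beta_def beta_sum_def dual_fun_fac[OF assms] mult.assoc ..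

text \<open>With equal parameters the generating function cancels to a polynomial of degree at most
  \<open>m - 1 - k\<close>, while all indices are at least \<open>m - k\<close>. This holds for
  every integer exponent \<open>p\<close>.\<close>

lemma dual_beta_fac_gt:
  assumes "m > k" shows "dual_beta b p k (fac b m) = 0"
proof -
  define d where "d = m - 1 - k"
  have "super_h k b (m - 1) (\<lambda>l. - b l) (int m - int k + int s) = 0" for s
    using assms super_h_cancel_poly[of d "int m - int k + int s" k b] by (simp add: d_def)
  moreover have "m > 0" using assms by simp
  ultimately show ?thesis unfolding dual_beta_def by (simp add: dual_fun_fac beta_sum_0)
qed

text \<open>For an exponent \<open>d\<close> that is not negative, (1 + \<beta> x)^d
  \<open>fac b m\<close> is a polynomial of degree at most \<open>m + d\<close>, too small for a
  term 1/x at infinity.\<close>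

lemma dual_beta_fac_lt:
  assumes "k > m + d" "m > 0" shows "dual_beta b (int d) k (fac b m) = 0"
proof -
  have *: "of_int (int_gbinomial (int d) s) * super_h k b (m - 1) (\<lambda>l. - b l) (int m - int k + int s) = (0::ps)" for s
  proof (cases "s > d")
    case False
    then have "int m - int k + int s < 0" using assms by linarith
    then show ?thesis by (simp add: super_h_neg)
  qed (simp add: int_gbinomial_eq_0)
  show ?thesis unfolding dual_beta_def dual_fun_fac[OF assms(2)] * by (rule beta_sum_0)
qed

lemma dual_beta_fac_eq: assumes "k > 0" shows "dual_beta b 0 k (fac b k) = 1"
proof -
  have *: "of_int (int_gbinomial 0 s) * super_h k b (k - 1) (\<lambda>l. - b l) (int k - int k + int s) =
      (if s = 0 then 1 else 0 :: ps)" for s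
    using int_gbinomial_eq_0[of 0 s] super_h_cancel_0[OF assms, of b] by (cases "s = 0") auto
  have "beta_sum (\<lambda>s. if s = 0 then 1 else 0) = 1"
  proof (rule beta_sum_eqI)
    fix N
    have "(\<Sum>s<N. beta ^ s * (if s = 0 then 1 else 0)) = (\<Sum>s<N. if s = 0 then 1 else 0)"
      by (intro sum.cong) auto
    then show "ord_ge N ((\<Sum>s<N. beta ^ s * (if s = 0 then 1 else 0)) - 1)"
      by (cases N) auto
  qed
  then show ?thesis unfolding dual_beta_def dual_fun_fac[OF assms] * .
qed

lemma dual_beta_graded:
  assumes "parameter_seq b" "parameter_seq c" "m > 0"
  shows "ord_ge (m - k) (dual_beta b p k (fac c m))" "vars_in param_vars (dual_beta b p k (fac c m))"
proof -
  note b = parameter_seqD[OF assms(1)] and c = parameter_seqD[OF assms(2)]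
  have g: "ord_ge (nat n) (super_h k b (m - 1) (\<lambda>l. - c l) n) \<and>
      vars_in param_vars (super_h k b (m - 1) (\<lambda>l. - c l) n)" for n
    by (rule super_h_graded) (auto simp: ord_ge_Suc_0 b c intro: vars_in_uminus)
  have "ord_ge (m - k) (super_h k b (m - 1) (\<lambda>l. - c l) (int m - int k + int s))" for s
    using g[of "int m - int k + int s"] by (auto elim!: ord_ge_mono)
  then show "ord_ge (m - k) (dual_beta b p k (fac c m))" "vars_in param_vars (dual_beta b p k (fac c m))"
    unfolding dual_beta_def dual_fun_fac[OF assms(3)]
    by (intro beta_sum_graded ord_ge_mult_right vars_in_mult vars_in_of_int conjunct2[OF g]; simp)+
qed

section \<open>Alternating forms\<close>

text \<open>Forms act on infinite sequences but see only the first \<open>r\<close> entries.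
  Alternation is required for adjacent exchanges, the only ones used in the straightening.\<close>

definition alt_form :: "nat \<Rightarrow> ((nat \<Rightarrow> ps poly) \<Rightarrow> ps) \<Rightarrow> bool" where
  "alt_form r F \<longleftrightarrow>
     (\<forall>g g'. (\<forall>i<r. g i = g' i) \<longrightarrow> F g = F g') \<and>
     (\<forall>g i p q. i < r \<longrightarrow> F (g(i := p + q)) = F (g(i := p)) + F (g(i := q))) \<and>
     (\<forall>g i a p. i < r \<longrightarrow> F (g(i := smult a p)) = a * F (g(i := p))) \<and>
     (\<forall>g i. Suc i < r \<longrightarrow> F (g(i := g (Suc i), Suc i := g i)) = - F g)"

lemma alt_formI:
  assumes "\<And>g g'. (\<And>i. i < r \<Longrightarrow> g i = g' i) \<Longrightarrow> F g = F g'"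
    "\<And>g i p q. i < r \<Longrightarrow> F (g(i := p + q)) = F (g(i := p)) + F (g(i := q))"
    "\<And>g i a p. i < r \<Longrightarrow> F (g(i := smult a p)) = a * F (g(i := p))"
    "\<And>g i. Suc i < r \<Longrightarrow> F (g(i := g (Suc i), Suc i := g i)) = - F g"
  shows "alt_form r F"
  unfolding alt_form_def using assms by blast

lemma alt_form_cong: "alt_form r F \<Longrightarrow> (\<And>i. i < r \<Longrightarrow> g i = g' i) \<Longrightarrow> F g = F g'"
  by (simp add: alt_form_def)

lemma alt_form_diff:
  assumes "alt_form r F" "alt_form r G" shows "alt_form r (\<lambda>g. F g - G g)"
proof (rule alt_formI)
  fix g g' :: "nat \<Rightarrow> ps poly" assume "\<And>i. i < r \<Longrightarrow> g i = g' i"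
  then have "F g = F g'" "G g = G g'" using alt_form_cong assms by blast+
  then show "F g - G g = F g' - G g'" by simp
qed (use assms in \<open>simp_all add: alt_form_def algebra_simps\<close>)

lemma alt_form_mult:
  assumes "alt_form r F" shows "alt_form r (\<lambda>g. F g * a)"
proof (rule alt_formI)
  fix g g' :: "nat \<Rightarrow> ps poly" assume "\<And>i. i < r \<Longrightarrow> g i = g' i"
  then have "F g = F g'" using alt_form_cong assms by blast
  then show "F g * a = F g' * a" by simp
qed (use assms in \<open>simp_all add: alt_form_def algebra_simps\<close>)

lemma alt_form_0: "alt_form r (\<lambda>g. 0)"
  by (simp add: alt_form_def)

lemma alt_form_sum:
  assumes "\<And>l. l \<in> L \<Longrightarrow> alt_form r (F l)" shows "alt_form r (\<lambda>g. \<Sum>l\<in>L. F l g)"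
  using assms
proof (induction L rule: infinite_finite_induct)
  case (insert l L)
  have "alt_form r (\<lambda>g. F l g - (\<Sum>l\<in>L. F l g) * (- 1))"
    using insert by (intro alt_form_diff alt_form_mult) auto
  then show ?case using insert by simp
qed (simp_all add: alt_form_0)

context
  fixes r F
  assumes F: "alt_form r F"
begin

lemma alt_form_add: "i < r \<Longrightarrow> F (g(i := p + q)) = F (g(i := p)) + F (g(i := q))"
  using F by (simp add: alt_form_def)

lemma alt_form_smult: "i < r \<Longrightarrow> F (g(i := smult a p)) = a * F (g(i := p))"
  using F by (simp add: alt_form_def)

lemma alt_form_swap: "Suc i < r \<Longrightarrow> F (g(i := q, Suc i := p)) = - F (g(i := p, Suc i := q))"
proof -
  assume i: "Suc i < r"
  let ?g = "g(i := p, Suc i := q)"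
  have "F (?g(i := ?g (Suc i), Suc i := ?g i)) = - F ?g"
    using F i unfolding alt_form_def by blast
  then show ?thesis by (simp add: fun_upd_twist)
qed

text \<open>The value equals its own negative, and integer coefficients have no 2-torsion.\<close>

lemma alt_form_eq_0: "Suc i < r \<Longrightarrow> F (g(i := p, Suc i := p)) = 0"
proof -
  assume "Suc i < r"
  then have "F (g(i := p, Suc i := p)) = - F (g(i := p, Suc i := p))" by (rule alt_form_swap)
  then have "mcoeff (F (g(i := p, Suc i := p))) M = 0" for M
    by (metis equal_neg_zero mcoeff_uminus)
  then show ?thesis by (intro mps_eqI) simp
qed

end

text \<open>The sequence \<open>k\<close> need not be decreasing: changing the basis one slot at a
  time leads through arbitrary sequences.\<close>

definition wedge :: "(nat \<Rightarrow> ps) \<Rightarrow> (nat \<Rightarrow> nat) \<Rightarrow> nat \<Rightarrow> ps poly" where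
  "wedge b k i = [:1, beta:] ^ i * fac b (k i)"

text \<open>1 + \<beta> x is split as (1 + \<beta> b_m) + \<beta> (x - b_m), and the second bracket
  extends \<open>fac b m\<close> to \<open>fac b (Suc m)\<close>; b_m is \<open>b (m - 1)\<close> in
  the numbering from 0.\<close>

lemma beta_shift_fac:
  assumes "m > 0"
  shows "[:1, beta:] * fac b m = smult (1 + beta * b (m - 1)) (fac b m) + smult beta (fac b (Suc m))"
proof -
  obtain m' where m: "m = Suc m'" using assms gr0_implies_Suc by blast
  have "[:1, beta:] = 1 + smult beta [:0, 1:]" by (simp add: one_pCons)
  then have "[:1, beta:] * fac b m = fac b m + smult beta ([:0, 1:] * fac b m)"
    by (simp only: distrib_right mult_1 mult_smult_left)
  also have "[:0, 1:] * fac b m = fac b (Suc m) + smult (b m') (fac b m)"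
    unfolding m fac_Suc by simp
  finally show ?thesis by (simp add: m smult_add_left smult_add_right add.commute add.left_commute)
qed

lemma one_plus_beta_nonzero: "1 + beta * f \<noteq> (0 :: ps)"
proof
  assume "1 + beta * f = 0"
  then have "mcoeff (1 + beta * f) {#} = 0" by simp
  then show False by (simp add: mcoeff_1 mcoeff_mvar_mult)
qed

text \<open>Straightening: a pair \<open>k\<^sub>i \<le> k\<^sub>i\<^sub>+\<^sub>1\<close> is rewritten in terms of families whose weighted sum
  \<open>\<Sum>(r - i) k\<^sub>i\<close> is larger.\<close>

lemma alt_form_straighten:
  assumes F: "alt_form r F"
    and mu: "\<And>i. Suc i < r \<Longrightarrow> mu (Suc i) < mu i"
    and vanish: "\<And>kap. (\<And>i. i < r \<Longrightarrow> 1 \<le> kap i \<and> kap i \<le> mu i) \<Longrightarrow>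
        (\<And>i. Suc i < r \<Longrightarrow> kap (Suc i) < kap i) \<Longrightarrow> F (wedge b kap) = 0"
    and k: "\<And>i. i < r \<Longrightarrow> 1 \<le> k i \<and> k i \<le> mu i"
  shows "F (wedge b k) = 0"
  using k
\<comment> \<open>The measure is the distance of the weighted sum from its upper bound, which is
  reached at \<open>k = mu\<close>.\<close>
proof (induction "(\<Sum>i<r. (r - i) * mu i) - (\<Sum>i<r. (r - i) * k i)" arbitrary: k rule: less_induct)
  case less
  note bd = less.prems
  show ?case
  proof (cases "\<exists>i. Suc i < r \<and> k i \<le> k (Suc i)")
    case False
    then show ?thesis using vanish[of k] bd by (meson not_le)
  next
    case True
    then obtain i where i: "Suc i < r" "k i \<le> k (Suc i)" by blast
    define a where "a = k i"
    define l where "l = k (Suc i)"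
    \<comment> \<open>Both slots carry the same exponent \<open>i\<close>, so \<open>B\<close> is
      antisymmetric. The surplus factor 1 + \<beta> x of slot \<open>Suc i\<close> stays inside the
      second argument.\<close>
    define B where "B p q = F ((wedge b k)(i := [:1, beta:] ^ i * p, Suc i := [:1, beta:] ^ i * q))" for p q
    have al: "a \<le> l" "1 \<le> a" "l < mu i" "l \<le> mu (Suc i)"
      using i bd[of i] bd[of "Suc i"] mu[of i] by (auto simp: a_def l_def)
    have B_wedge: "F (wedge b (k(i := p, Suc i := m))) = B (fac b p) ([:1, beta:] * fac b m)" for p m
      unfolding B_def
    proof (rule alt_form_cong[OF F])
      fix j
      show "wedge b (k(i := p, Suc i := m)) j = ((wedge b k)
          (i := [:1, beta:] ^ i * fac b p, Suc i := [:1, beta:] ^ i * ([:1, beta:] * fac b m))) j"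
        by (simp add: wedge_def mult.assoc mult.left_commute del: mult_pCons_left mult_pCons_right)
    qed
    have B_add: "B p (q + q') = B p q + B p q'" for p q q'
      unfolding B_def distrib_left using i by (intro alt_form_add[OF F])
    have B_smult: "B p (smult c q) = c * B p q" for p q c
      unfolding B_def mult_smult_right using i by (intro alt_form_smult[OF F])
    have B_swap: "B q p = - B p q" for p q
      unfolding B_def using i by (intro alt_form_swap[OF F])
    have B_0: "B p p = 0" for p
      unfolding B_def using i by (intro alt_form_eq_0[OF F])
    have B_shift: "B p ([:1, beta:] * fac b m) = (1 + beta * b (m - 1)) * B p (fac b m) + beta * B p (fac b (Suc m))"
      if "m > 0" for p m
      unfolding beta_shift_fac[OF that] B_add B_smult ..
    \<comment> \<open>The conditions \<open>l \<le> p\<close> and \<open>a \<le> m\<close> keep the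
      sum of the two parts from dropping, and \<open>a < p\<close> raises the slot of larger weight,
      so the weighted sum grows.\<close>
    have IH: "B (fac b p) ([:1, beta:] * fac b m) = 0"
      if pm: "l \<le> p" "a < p" "p \<le> mu i" "a \<le> m" "m \<le> mu (Suc i)" for p m
    proof -
      let ?k = "k(i := p, Suc i := m)"
      let ?R = "{..<r} - {i} - {Suc i}"
      have bd': "1 \<le> ?k j \<and> ?k j \<le> mu j" if "j < r" for j
        using that bd[of j] pm al by auto
      have split: "(\<Sum>j<r. (r - j) * f j) = (r - i) * f i + ((r - Suc i) * f (Suc i) + (\<Sum>j\<in>?R. (r - j) * f j))"
        for f :: "nat \<Rightarrow> nat"
        using i by (subst sum.remove[of _ i], simp, simp, subst sum.remove[of _ "Suc i"]) auto
      have R: "(\<Sum>j\<in>?R. (r - j) * ?k j) = (\<Sum>j\<in>?R. (r - j) * k j)" by (intro sum.cong) auto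
      define t where "t = r - Suc i"
      have t: "r - i = Suc t" "r - Suc i = t" using i by (auto simp: t_def)
      have "t * (a + l) \<le> t * (m + p)" using pm by (intro mult_le_mono2) auto
      then have "Suc t * a + t * l < Suc t * p + t * m" using pm(2) by (simp add: algebra_simps)
      then have lt: "(\<Sum>j<r. (r - j) * k j) < (\<Sum>j<r. (r - j) * ?k j)"
        unfolding split R t by (simp add: a_def l_def)
      have "(\<Sum>j<r. (r - j) * ?k j) \<le> (\<Sum>j<r. (r - j) * mu j)"
        using bd' by (intro sum_mono mult_le_mono2) auto
      with lt have "(\<Sum>j<r. (r - j) * mu j) - (\<Sum>j<r. (r - j) * ?k j) <
          (\<Sum>j<r. (r - j) * mu j) - (\<Sum>j<r. (r - j) * k j)" by linarith
      from less.hyps[OF this bd'] show ?thesis by (simp only: B_wedge)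
    qed
    \<comment> \<open>Descending induction from \<open>m = p\<close>, where antisymmetry gives 0.
      The vanishing in \<open>IH\<close> expresses the value at \<open>m\<close> through the value
      at \<open>Suc m\<close>, up to the nonzero factor 1 + \<beta> b_m. Only \<open>p = l\<close>
      and \<open>p = Suc l\<close> are used; the latter is admissible because strictness of
      \<open>mu\<close> gives \<open>l < mu i\<close>.\<close>
    have claim: "B (fac b p) (fac b m) = 0"
      if p: "l \<le> p" "p \<le> Suc l" "a < p" and m: "m \<le> p" "a \<le> m" for p m
      using m
    proof (induction rule: inc_induct)
      case base
      show ?case by (rule B_0)
    next
      case (step m)
      then have "B (fac b p) (fac b (Suc m)) = 0" by simp
      moreover have "B (fac b p) ([:1, beta:] * fac b m) = 0"
        using step p al by (intro IH) auto
      ultimately show ?case using B_shift[of m "fac b p"] step al one_plus_beta_nonzero by simp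
    qed
    \<comment> \<open>The two terms into which \<open>B_shift\<close> splits the given pair;
      antisymmetry moves each of them into the range of \<open>claim\<close>.\<close>
    have "B (fac b a) (fac b l) = 0"
      using claim[of l a] B_swap[of "fac b a" "fac b l"] B_0 al by (cases "a = l") auto
    moreover have "B (fac b a) (fac b (Suc l)) = 0"
      using claim[of "Suc l" a] B_swap[of "fac b a" "fac b (Suc l)"] al by auto
    ultimately have "B (fac b a) ([:1, beta:] * fac b l) = 0"
      using B_shift[of l] al by simp
    then show ?thesis
      using B_wedge[of a l] by (simp add: a_def l_def)
  qed
qed

text \<open>For either parameter sequence these polynomials span the multiples of x of bounded
  degree. The statement is about a linear functional because a single slot of a form is one.\<close>

lemma fac_change_basis:
  fixes f :: "ps poly \<Rightarrow> ps"
  assumes "\<And>p q. f (p + q) = f p + f q" "\<And>a p. f (smult a p) = a * f p"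
    and "\<And>k. 1 \<le> k \<Longrightarrow> k \<le> Suc m \<Longrightarrow> f (fac b k) = 0"
  shows "f (fac c (Suc m)) = 0"
  using assms
proof (induction m arbitrary: f)
  case 0
  then show ?case using "0.prems"(3)[of 1] by (simp add: fac_def)
next
  case (Suc m)
  \<comment> \<open>The induction hypothesis is applied to the functional that first multiplies by
    x, which loses one degree.\<close>
  have "f ([:0, 1:] * fac c (Suc m)) = 0"
  proof (rule Suc.IH[of "\<lambda>p. f ([:0, 1:] * p)"])
    fix k assume k: "1 \<le> k" "k \<le> Suc m"
    then obtain k' where k': "k = Suc k'" by (cases k) auto
    have "[:0, 1:] * fac b k = fac b (Suc k) + smult (b k') (fac b k)"
      unfolding k' fac_Suc by simp
    then have "f ([:0, 1:] * fac b k) = f (fac b (Suc k)) + b k' * f (fac b k)"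
      by (simp only: Suc.prems)
    then show "f ([:0, 1:] * fac b k) = 0" using k Suc.prems(3) by simp
  qed (simp_all only: distrib_left mult_smult_right Suc.prems)
  moreover have "f (fac c (Suc m)) = 0" by (rule Suc.IH) (use Suc.prems in auto)
  ultimately show ?case unfolding fac_Suc Suc.prems(1,2) by simp
qed

text \<open>The slots are replaced one after another: \<open>V s k\<close> has its final entries,
  formed with \<open>c\<close>, in the first \<open>s\<close> slots and arbitrary entries below
  \<open>mu\<close>, formed with \<open>b\<close>, in the others. Hence vanishing is needed for all
  sequences in the box below \<open>mu\<close>.\<close>

lemma alt_form_change_basis:
  assumes F: "alt_form r F"
    and vanish: "\<And>k. (\<And>i. i < r \<Longrightarrow> 1 \<le> k i \<and> k i \<le> mu i) \<Longrightarrow> F (wedge b k) = 0"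
    and mu: "\<And>i. i < r \<Longrightarrow> 1 \<le> mu i"
  shows "F (wedge c mu) = 0"
proof -
  define V where "V s k i = [:1, beta:] ^ i * (if i < s then fac c (mu i) else fac b (k i))" for s k i
  have "F (V s k) = 0" if "s \<le> r" "\<And>i. i < r \<Longrightarrow> 1 \<le> k i \<and> k i \<le> mu i" for s k
    using that
  proof (induction s arbitrary: k)
    case 0
    have "F (V 0 k) = F (wedge b k)" by (rule alt_form_cong[OF F]) (simp add: V_def wedge_def)
    then show ?case using vanish 0 by simp
  next
    case (Suc s)
    define f where "f p = F ((V s k)(s := [:1, beta:] ^ s * p))" for p
    obtain m where m: "mu s = Suc m" using mu[of s] Suc.prems by (cases "mu s") auto
    have "f (fac c (Suc m)) = 0"
    proof (rule fac_change_basis)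
      fix k' assume k': "1 \<le> k'" "k' \<le> Suc m"
      have "F (V s (k(s := k'))) = 0" using Suc.prems k' m by (intro Suc.IH) auto
      moreover have "V s (k(s := k')) = (V s k)(s := [:1, beta:] ^ s * fac b k')"
        by (auto simp: V_def)
      ultimately show "f (fac b k') = 0" by (simp only: f_def)
    next
      show "f (p + q) = f p + f q" for p q
        unfolding f_def distrib_left using Suc.prems by (intro alt_form_add[OF F]) auto
      show "f (smult a p) = a * f p" for a p
        unfolding f_def mult_smult_right using Suc.prems by (intro alt_form_smult[OF F]) auto
    qed
    moreover have "(V s k)(s := [:1, beta:] ^ s * fac c (Suc m)) = V (Suc s) k"
      by (auto simp: V_def m)
    ultimately show ?case by (simp add: f_def)
  qed
  from this[of r mu] have "F (V r mu) = 0" using mu by auto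
  moreover have "F (V r mu) = F (wedge c mu)"
    by (rule alt_form_cong[OF F]) (simp add: V_def wedge_def)
  ultimately show ?thesis by simp
qed

section \<open>Dual determinants\<close>

text \<open>The exponent -j in column \<open>j\<close> undoes the power of 1 + \<beta> x in slot
  \<open>j\<close> of a \<open>wedge\<close>, which makes the determinant dual to these
  families.\<close>

definition dual_det :: "(nat \<Rightarrow> ps) \<Rightarrow> nat \<Rightarrow> (nat \<Rightarrow> nat) \<Rightarrow> (nat \<Rightarrow> ps poly) \<Rightarrow> ps" where
  "dual_det b r lam g = det (mat r r (\<lambda>(i, j). dual_beta b (- int j) (lam j) (g i)))"

lemma dual_det_leibniz:
  "dual_det b r lam g = (\<Sum>p | p permutes {0..<r}.
     signof p * (\<Prod>i = 0..<r. dual_beta b (- int (p i)) (lam (p i)) (g i)))"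
proof -
  have *: "p i < r" if "p permutes {0..<r}" "i < r" for p i
    using that permutes_in_image[of p "{0..<r}" i] by simp
  show ?thesis
    unfolding dual_det_def by (subst det_def'[of _ r]) (auto intro!: sum.cong prod.cong simp: *)
qed

lemma alt_form_dual_det: "alt_form r (dual_det b r lam)"
proof (rule alt_formI)
  fix g g' :: "nat \<Rightarrow> ps poly" assume "\<And>i. i < r \<Longrightarrow> g i = g' i"
  then show "dual_det b r lam g = dual_det b r lam g'"
    unfolding dual_det_leibniz by (intro sum.cong prod.cong refl arg_cong2[of _ _ _ _ "(*)"]) auto
next
  fix g :: "nat \<Rightarrow> ps poly" and i p q assume i: "i < r"
  have split: "(\<Prod>j = 0..<r. dual_beta b (- int (s j)) (lam (s j)) ((g(i := x)) j)) =
      dual_beta b (- int (s i)) (lam (s i)) x *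
      (\<Prod>j\<in>{0..<r} - {i}. dual_beta b (- int (s j)) (lam (s j)) (g j))" for s x
    using i by (subst prod.remove[of _ i]) (auto intro!: prod.cong)
  show "dual_det b r lam (g(i := p + q)) = dual_det b r lam (g(i := p)) + dual_det b r lam (g(i := q))"
    unfolding dual_det_leibniz split dual_beta_add by (simp add: algebra_simps sum.distrib)
next
  fix g :: "nat \<Rightarrow> ps poly" and i a p assume i: "i < r"
  have split: "(\<Prod>j = 0..<r. dual_beta b (- int (s j)) (lam (s j)) ((g(i := x)) j)) =
      dual_beta b (- int (s i)) (lam (s i)) x *
      (\<Prod>j\<in>{0..<r} - {i}. dual_beta b (- int (s j)) (lam (s j)) (g j))" for s x
    using i by (subst prod.remove[of _ i]) (auto intro!: prod.cong)
  show "dual_det b r lam (g(i := smult a p)) = a * dual_det b r lam (g(i := p))"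
    unfolding dual_det_leibniz split dual_beta_smult by (simp add: algebra_simps sum_distrib_left)
next
  fix g :: "nat \<Rightarrow> ps poly" and i assume i: "Suc i < r"
  let ?M = "\<lambda>g. mat r r (\<lambda>(i, j). dual_beta b (- int j) (lam j) (g i))"
  have "?M (g(i := g (Suc i), Suc i := g i)) = swaprows i (Suc i) (?M g)"
    using i by (intro eq_matI) auto
  then show "dual_det b r lam (g(i := g (Suc i), Suc i := g i)) = - dual_det b r lam g"
    unfolding dual_det_def using i det_swaprows[of i r "Suc i" "?M g"] by simp
qed

lemma dual_det_wedge:
  "dual_det b r lam (wedge c mu) =
     det (mat r r (\<lambda>(i, j). dual_beta b (int i - int j) (lam j) (fac c (mu i))))"
  unfolding dual_det_def wedge_def dual_beta_shift_power by simp

lemma decreasing_antimono: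
  fixes f :: "nat \<Rightarrow> nat"
  assumes "\<And>i. Suc i < r \<Longrightarrow> f (Suc i) < f i"
  shows "i + d < r \<Longrightarrow> f (i + d) + d \<le> f i"
proof (induction d)
  case (Suc d)
  then show ?case using assms[of "i + d"] by simp
qed simp

text \<open>Equal sequences give a triangular matrix with ones on the diagonal. Otherwise let
  \<open>m\<close> be the first index of disagreement. If \<open>kap m < lam m\<close>, column
  \<open>m\<close> vanishes: rows from \<open>m\<close> on by \<open>e_lt\<close>, earlier rows,
  where both sequences agree, by \<open>e_gt\<close>. If \<open>kap m > lam m\<close>, the entries
  in rows up to \<open>m\<close> and columns from \<open>m\<close> on vanish.\<close>

lemma dual_det_orthogonal:
  assumes lam: "\<And>i. Suc i < r \<Longrightarrow> lam (Suc i) < lam i" "\<And>i. i < r \<Longrightarrow> 1 \<le> lam i"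
    and kap: "\<And>i. Suc i < r \<Longrightarrow> kap (Suc i) < kap i" "\<And>i. i < r \<Longrightarrow> 1 \<le> kap i"
  shows "dual_det b r lam (wedge b kap) = (if \<forall>i<r. lam i = kap i then 1 else 0)"
proof -
  define e where "e i j = dual_beta b (int i - int j) (lam j) (fac b (kap i))" for i j
  have D: "dual_det b r lam (wedge b kap) = det (mat r r (\<lambda>(i, j). e i j))"
    by (simp add: dual_det_wedge e_def)
  have e_gt: "e i j = 0" if "lam j < kap i" for i j
    unfolding e_def using that by (rule dual_beta_fac_gt)
  have e_lt: "e i j = 0" if "j \<le> i" "kap i + (i - j) < lam j" "i < r" for i j
    unfolding e_def using dual_beta_fac_lt[of "kap i" "i - j" "lam j" b] kap(2)[of i] that
    by (simp add: of_nat_diff)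
  have kap': "kap j + (j - i) \<le> kap i" "lam j + (j - i) \<le> lam i" if "i \<le> j" "j < r" for i j
    using decreasing_antimono[of r kap i "j - i"] decreasing_antimono[of r lam i "j - i"] kap lam that by auto
  show ?thesis
  proof (cases "\<forall>i<r. lam i = kap i")
    case True
    let ?A = "mat r r (\<lambda>(i, j). e i j)"
    have "?A $$ (i, j) = 0" if "i < j" "j < r" for i j
      using kap'(1)[of i j] that True by (auto intro!: e_gt)
    then have "det ?A = prod_list (diag_mat ?A)" by (intro det_lower_triangular[of r]) auto
    also have "diag_mat ?A = map (\<lambda>i. 1) [0..<r]"
    proof -
      have "e i i = 1" if "i < r" for i
        using True kap(2)[of i] that dual_beta_fac_eq[of "kap i" b] by (simp add: e_def)
      then show ?thesis by (simp add: diag_mat_def)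
    qed
    also have "prod_list \<dots> = (1 :: ps)" by (simp add: prod_list_replicate map_replicate_const)
    finally show ?thesis using True D by simp
  next
    case False
    then obtain m where m: "m < r" "lam m \<noteq> kap m" "\<And>j. j < m \<Longrightarrow> lam j = kap j"
      using exists_least_iff[of "\<lambda>i. i < r \<and> lam i \<noteq> kap i"] by (metis less_trans)
    have "(\<Prod>i = 0..<r. e i (p i)) = 0" if p: "p permutes {0..<r}" for p
    proof (cases "kap m < lam m")
      case True
      obtain i where i: "i < r" "p i = m"
        using permutes_surj[OF p] p m(1) by (metis atLeastLessThan_iff le0 permutes_in_image surjD)
      have "e i m = 0"
      proof (cases "m \<le> i")
        case True
        then show ?thesis using kap'(1)[of m i] i \<open>kap m < lam m\<close> by (intro e_lt) auto
      next
        case False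
        then show ?thesis using kap'(2)[of i m] m by (intro e_gt) auto
      qed
      then show ?thesis using i by (intro prod_zero) auto
    next
      case False
      \<comment> \<open>Pigeonhole: the \<open>m + 1\<close> rows up to \<open>m\<close> cannot be
        sent injectively into the \<open>m\<close> columns before \<open>m\<close>, so every
        permutation meets the zero block.\<close>
      have "\<exists>i\<le>m. m \<le> p i"
      proof (rule ccontr)
        assume "\<not> ?thesis"
        then have "p ` {..m} \<subseteq> {..<m}" by auto
        then have "card (p ` {..m}) \<le> m" using card_mono[of "{..<m}"] by simp
        moreover have "card (p ` {..m}) = Suc m"
          using permutes_inj_on[OF p] by (simp add: card_image)
        ultimately show False by simp
      qed
      then obtain i where i: "i \<le> m" "m \<le> p i" by blast
      then have "p i < r" using m(1) permutes_in_image[OF p, of i] by simp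
      then have "e i (p i) = 0"
        using kap'(2)[of m "p i"] kap'(1)[of i m] i m False by (intro e_gt) auto
      then show ?thesis using i m(1) by (intro prod_zero) auto
    qed
    then have "det (mat r r (\<lambda>(i, j). e i j)) = 0"
      by (subst det_def'[of _ r]) (auto intro!: sum.neutral simp: permutes_in_image[of _ "{0..<r}"] cong: prod.cong_simp)
    then show ?thesis using False D by simp
  qed
qed

section \<open>Strict partitions inside a given one and the expansion of alternating forms\<close>

definition sub_partitions :: "nat list \<Rightarrow> nat list set" where
  "sub_partitions mu = {lam. strict_partition lam \<and>
     shifted_diagram lam \<subseteq> shifted_diagram mu \<and> length lam = length mu}"

lemma strict_partition_nth:
  assumes "strict_partition lam"
  shows "Suc i < length lam \<Longrightarrow> lam ! Suc i < lam ! i" "i < length lam \<Longrightarrow> 1 \<le> lam ! i"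
  using assms unfolding strict_partition_def
  by (auto simp: sorted_wrt_iff_nth_less Suc_le_eq intro: gr0I) (metis gr0I nth_mem)

lemma strict_partition_map:
  assumes "\<And>i. Suc i < r \<Longrightarrow> kap (Suc i) < kap i" "\<And>i. i < r \<Longrightarrow> 1 \<le> kap i"
  shows "strict_partition (map kap [0..<r])"
proof -
  have "kap j < kap i" if "i < j" "j < r" for i j
    using decreasing_antimono[of r kap i "j - i"] assms that by simp
  moreover have "0 \<notin> set (map kap [0..<r])" using assms(2) by force
  ultimately show ?thesis by (simp add: strict_partition_def sorted_wrt_iff_nth_less)
qed

lemma shifted_diagram_subset:
  assumes "strict_partition lam" "length lam = length mu"
  shows "shifted_diagram lam \<subseteq> shifted_diagram mu \<longleftrightarrow> (\<forall>i<length mu. lam ! i \<le> mu ! i)"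
proof
  assume L: "shifted_diagram lam \<subseteq> shifted_diagram mu"
  show "\<forall>i<length mu. lam ! i \<le> mu ! i"
  proof (intro allI impI)
    fix i assume i: "i < length mu"
    then have "1 \<le> lam ! i" using strict_partition_nth assms by simp
    then have "(i, i + lam ! i - 1) \<in> shifted_diagram lam"
      using i assms by (auto simp: shifted_diagram_def)
    then have "(i, i + lam ! i - 1) \<in> shifted_diagram mu" using L by blast
    then show "lam ! i \<le> mu ! i" by (auto simp: shifted_diagram_def)
  qed
qed (use assms in \<open>force simp: shifted_diagram_def\<close>)

lemma finite_sub_partitions: "finite (sub_partitions mu)"
proof (rule finite_subset)
  show "sub_partitions mu \<subseteq> {lam. set lam \<subseteq> {..sum_list mu} \<and> length lam = length mu}"
  proof
    fix lam assume lam: "lam \<in> sub_partitions mu"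
    then have "lam ! i \<le> sum_list mu" if "i < length mu" for i
      using that shifted_diagram_subset[of lam mu] elem_le_sum_list[of i mu]
      by (fastforce simp: sub_partitions_def)
    then have "set lam \<subseteq> {..sum_list mu}"
      using lam by (auto simp: sub_partitions_def in_set_conv_nth)
    then show "lam \<in> {lam. set lam \<subseteq> {..sum_list mu} \<and> length lam = length mu}"
      using lam by (simp add: sub_partitions_def)
  qed
qed (rule finite_lists_length_eq, simp)

theorem alt_form_transition:
  assumes F: "alt_form (length mu) F" and mu: "strict_partition mu"
  shows "F (wedge c ((!) mu)) =
    (\<Sum>lam\<in>sub_partitions mu. dual_det b (length mu) ((!) lam) (wedge c ((!) mu)) * F (wedge b ((!) lam)))"
proof -
  let ?r = "length mu"
  define Z where "Z g = F g - (\<Sum>lam\<in>sub_partitions mu. dual_det b ?r ((!) lam) g * F (wedge b ((!) lam)))" for g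
  have Z: "alt_form ?r Z"
    unfolding Z_def by (intro alt_form_diff F alt_form_sum alt_form_mult alt_form_dual_det)
  have van: "Z (wedge b kap) = 0"
    if kap: "\<And>i. i < ?r \<Longrightarrow> 1 \<le> kap i \<and> kap i \<le> mu ! i" "\<And>i. Suc i < ?r \<Longrightarrow> kap (Suc i) < kap i" for kap
  proof -
    define k where "k = map kap [0..<?r]"
    have len: "length k = ?r" and nth: "\<And>i. i < ?r \<Longrightarrow> k ! i = kap i" by (simp_all add: k_def)
    have "strict_partition k" unfolding k_def using kap by (intro strict_partition_map) auto
    then have k: "k \<in> sub_partitions mu"
      using kap nth len by (auto simp: sub_partitions_def shifted_diagram_subset)
    have "dual_det b ?r ((!) lam) (wedge b kap) = (if lam = k then 1 else 0)"
      if "lam \<in> sub_partitions mu" for lam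
    proof -
      have lam: "strict_partition lam" "length lam = ?r" using that by (auto simp: sub_partitions_def)
      have "(\<forall>i<?r. lam ! i = kap i) \<longleftrightarrow> lam = k"
        using lam(2) len nth by (auto intro: nth_equalityI)
      moreover have "dual_det b ?r ((!) lam) (wedge b kap) = (if \<forall>i<?r. lam ! i = kap i then 1 else 0)"
        using strict_partition_nth[OF lam(1)] lam(2) kap by (intro dual_det_orthogonal) auto
      ultimately show ?thesis by simp
    qed
    then have "(\<Sum>lam\<in>sub_partitions mu. dual_det b ?r ((!) lam) (wedge b kap) * F (wedge b ((!) lam))) =
        (\<Sum>lam\<in>sub_partitions mu. if lam = k then F (wedge b ((!) k)) else 0)"
      by (intro sum.cong) auto
    also have "\<dots> = F (wedge b ((!) k))" using k finite_sub_partitions by simp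
    also have "\<dots> = F (wedge b kap)"
      by (rule alt_form_cong[OF F]) (simp add: wedge_def nth)
    finally show ?thesis by (simp add: Z_def)
  qed
  note mu' = strict_partition_nth[OF mu]
  have "Z (wedge c ((!) mu)) = 0"
  proof (rule alt_form_change_basis[OF Z])
    fix k assume k: "\<And>i. i < ?r \<Longrightarrow> 1 \<le> k i \<and> k i \<le> mu ! i"
    show "Z (wedge b k) = 0"
      by (rule alt_form_straighten[OF Z, where mu = "(!) mu"]) (use mu' van k in auto)
  qed (use mu' in auto)
  then show ?thesis by (simp add: Z_def)
qed

section \<open>Divisibility by differences of indeterminates\<close>

lemma image_mset_fun_upd:
  "image_mset (id(v := w)) P = filter_mset (\<lambda>x. x \<noteq> v) P + replicate_mset (count P v) w"
  by (induction P) auto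

lemma finite_fibers_fun_upd: "finite_fibers (id(v := w))"
proof -
  have "(id(v := w)) -` {x} \<subseteq> {v, x}" for x by auto
  then show ?thesis unfolding finite_fibers_def using finite_subset by blast
qed

text \<open>The quotient is explicit. \<open>T M t\<close> exchanges \<open>t\<close> copies of
  \<open>w\<close> in \<open>M\<close> for \<open>v\<close>, and the coefficient of \<open>g\<close>
  sums those of \<open>f\<close> along this line, so multiplication by v - w telescopes. If
  \<open>v\<close> does not occur in \<open>M\<close>, what remains is the full sum over the line,
  which is a coefficient of the image of \<open>f\<close> under v = w and hence 0.\<close>

lemma mvar_diff_dvd:
  fixes f :: "('a, 'b::comm_ring_1) mps"
  assumes vw: "v \<noteq> w" and f: "map_vars (id(v := w)) f = 0"
  shows "mvar v - mvar w dvd f"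
proof
  define T where "T M t = M + replicate_mset t v - replicate_mset t w" for M :: "'a multiset" and t
  define g where "g = Mps (\<lambda>M. \<Sum>t\<le>count M w. mcoeff f (add_mset v (T M t)))"
  show "f = (mvar v - mvar w) * g"
  proof (rule mps_eqI)
    fix M
    define q where "q = count M w"
    have wq: "mcoeff (mvar w * g) M = (\<Sum>t<q. mcoeff f (T M (Suc t)))"
    proof (cases "w \<in># M")
      case True
      have "add_mset v (T (M - {#w#}) t) = T M (Suc t)" if "t \<le> count (M - {#w#}) w" for t
        using that vw True unfolding T_def by (intro multiset_eqI) auto
      moreover have "q = Suc (count (M - {#w#}) w)" using True by (simp add: q_def)
      ultimately show ?thesis using True
        by (simp only: mcoeff_mvar_mult if_True g_def mcoeff_Mps lessThan_Suc_atMost) simp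
    next
      case False
      then have "q = 0" by (simp add: q_def not_in_iff)
      with False show ?thesis by (simp add: mcoeff_mvar_mult)
    qed
    have split: "(\<Sum>t\<le>q. mcoeff f (T M t)) = mcoeff f M + (\<Sum>t<q. mcoeff f (T M (Suc t)))"
      unfolding lessThan_Suc_atMost[symmetric] sum.lessThan_Suc_shift by (simp add: T_def)
    show "mcoeff f M = mcoeff ((mvar v - mvar w) * g) M"
    proof (cases "v \<in># M")
      case True
      have "add_mset v (T (M - {#v#}) t) = T M t" if "t \<le> q" for t
        using that vw True unfolding T_def q_def by (intro multiset_eqI) auto
      then have "mcoeff (mvar v * g) M = (\<Sum>t\<le>q. mcoeff f (T M t))"
        using True vw by (simp add: mcoeff_mvar_mult g_def q_def)
      then show ?thesis by (simp add: left_diff_distrib wq split)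
    next
      case False
      have "(\<Sum>t\<le>q. mcoeff f (T M t)) = (\<Sum>P | image_mset (id(v := w)) P = M. mcoeff f P)"
      proof (rule sum.reindex_bij_witness[where i = "\<lambda>P. count P v" and j = "T M"])
        fix t assume t: "t \<in> {..q}"
        show "count (T M t) v = t" using False vw by (simp add: T_def not_in_iff)
        show "T M t \<in> {P. image_mset (id(v := w)) P = M}"
          using t False vw unfolding image_mset_fun_upd
          by (auto intro!: multiset_eqI simp: T_def not_in_iff q_def)
      next
        fix P assume "P \<in> {P. image_mset (id(v := w)) P = M}"
        then have M: "M = filter_mset (\<lambda>x. x \<noteq> v) P + replicate_mset (count P v) w"
          by (simp add: image_mset_fun_upd)
        show "count P v \<in> {..q}" using vw by (simp add: q_def M)
        show "T M (count P v) = P" using vw unfolding M T_def by (intro multiset_eqI) auto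
      qed auto
      also have "\<dots> = 0" using f by (metis mcoeff_map_vars mcoeff_0)
      finally show ?thesis using False
        by (simp add: left_diff_distrib wq split mcoeff_mvar_mult[of v] eq_neg_iff_add_eq_0)
    qed
  qed
qed

section \<open>Permuting and identifying the variables x\<close>

definition x_map :: "(nat \<Rightarrow> nat) \<Rightarrow> var \<Rightarrow> var" where
  "x_map \<sigma> v = (case v of X i \<Rightarrow> X (\<sigma> i) | _ \<Rightarrow> v)"

definition x_subst :: "(nat \<Rightarrow> nat) \<Rightarrow> ps \<Rightarrow> ps" where
  "x_subst \<sigma> = map_vars (x_map \<sigma>)"

lemma finite_fibers_x_map: assumes "finite_fibers \<sigma>" shows "finite_fibers (x_map \<sigma>)"
  unfolding finite_fibers_def
proof
  fix v
  have "x_map \<sigma> -` {v} \<subseteq> insert v (case v of X i \<Rightarrow> X ` (\<sigma> -` {i}) | _ \<Rightarrow> {})"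
    by (auto simp: x_map_def split: var.splits)
  moreover have "finite (insert v (case v of X i \<Rightarrow> X ` (\<sigma> -` {i}) | _ \<Rightarrow> {}))"
    using assms by (auto simp: finite_fibers_def split: var.splits)
  ultimately show "finite (x_map \<sigma> -` {v})" by (rule finite_subset)
qed

lemma finite_fibers_inj: "inj \<sigma> \<Longrightarrow> finite_fibers \<sigma>"
  by (simp add: finite_fibers_def finite_vimageI)

lemma x_map_fun_upd: "x_map (id(a := b)) = id(X a := X b)"
  by (rule ext) (auto simp: x_map_def split: var.splits)

lemma x_map_comp: "x_map \<sigma> \<circ> x_map \<tau> = x_map (\<sigma> \<circ> \<tau>)"
  by (rule ext) (auto simp: x_map_def split: var.splits)

context
  fixes \<sigma> :: "nat \<Rightarrow> nat"
  assumes fin: "finite_fibers \<sigma>"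
begin

lemma x_subst_hom: "mps_hom (x_subst \<sigma>)"
  unfolding x_subst_def by (intro map_vars_hom finite_fibers_x_map fin)

lemma x_subst_xv: "x_subst \<sigma> (xv i) = xv (\<sigma> i)"
  and x_subst_beta: "x_subst \<sigma> beta = beta"
  by (simp_all add: x_subst_def map_vars_mvar finite_fibers_x_map fin x_map_def)

lemma x_subst_comp: "finite_fibers \<tau> \<Longrightarrow> x_subst \<sigma> (x_subst \<tau> f) = x_subst (\<sigma> \<circ> \<tau>) f"
  unfolding x_subst_def by (simp add: map_vars_map_vars finite_fibers_x_map fin x_map_comp)

lemma x_subst_param: assumes "vars_in param_vars f" shows "x_subst \<sigma> f = f"
proof (rule mps_eqI)
  fix M
  have fin': "finite {P. image_mset (x_map \<sigma>) P = M}"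
    by (intro finite_fibers_mset finite_fibers_x_map fin)
  have *: "image_mset (x_map \<sigma>) P = P" if "mcoeff f P \<noteq> 0" for P
  proof -
    have "set_mset P \<subseteq> param_vars" using assms that by (simp add: vars_in_def)
    then have "image_mset (x_map \<sigma>) P = image_mset id P"
      by (intro image_mset_cong) (auto simp: x_map_def)
    then show ?thesis by simp
  qed
  have "mcoeff (x_subst \<sigma> f) M = (\<Sum>P | image_mset (x_map \<sigma>) P = M. if P = M then mcoeff f M else 0)"
    unfolding x_subst_def mcoeff_map_vars
  proof (rule sum.cong[OF refl])
    fix P assume "P \<in> {P. image_mset (x_map \<sigma>) P = M}"
    then show "mcoeff f P = (if P = M then mcoeff f M else 0)"
      using *[of P] by (cases "mcoeff f P = 0") auto
  qed
  also have "\<dots> = mcoeff f M" using *[of M] fin' by (cases "mcoeff f M = 0") auto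
  finally show "mcoeff (x_subst \<sigma> f) M = mcoeff f M" .
qed

end

definition index_pairs :: "nat \<Rightarrow> (nat \<times> nat) set" where
  "index_pairs n = {(i, j). i < j \<and> j < n}"

lemma finite_index_pairs [simp]: "finite (index_pairs n)"
  by (rule finite_subset[of _ "{..<n} \<times> {..<n}"]) (auto simp: index_pairs_def)

definition x_diff :: "nat \<times> nat \<Rightarrow> ps" where "x_diff = (\<lambda>(a, b). xv a - xv b)"

definition vandermonde :: "nat \<Rightarrow> ps" where
  "vandermonde n = (\<Prod>p\<in>index_pairs n. x_diff p)"

lemma ord_eq_x_diff: "fst p \<noteq> snd p \<Longrightarrow> ord_eq 1 (x_diff p)"
  using ord_eq_mvar_diff[of "X (fst p)" "X (snd p)"] by (simp add: x_diff_def case_prod_unfold)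

lemma x_diff_nonzero: "fst p \<noteq> snd p \<Longrightarrow> x_diff p \<noteq> 0"
  using mvar_diff_nonzero[of "X (fst p)" "X (snd p)"] by (simp add: x_diff_def case_prod_unfold)

lemma vandermonde_nonzero: "vandermonde n \<noteq> 0"
proof
  assume "vandermonde n = 0"
  then obtain p where "p \<in> index_pairs n" "x_diff p = 0"
    unfolding vandermonde_def by (auto simp: prod_zero_iff)
  then show False using x_diff_nonzero[of p] by (auto simp: index_pairs_def)
qed

lemma x_subst_x_diff: "finite_fibers \<sigma> \<Longrightarrow> x_subst \<sigma> (x_diff p) = x_diff (map_prod \<sigma> \<sigma> p)"
  by (cases p) (simp add: x_diff_def hom_simps[OF x_subst_hom] x_subst_xv)

lemma x_diff_merge_nonzero:
  assumes "p \<in> index_pairs n" "p \<noteq> (a, b)" "a < b"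
  shows "x_subst (id(a := b)) (x_diff p) \<noteq> 0"
  using assms by (subst x_subst_x_diff[OF finite_fibers_fun_upd], intro x_diff_nonzero)
    (auto simp: index_pairs_def)

lemma x_diff_dvd: "a \<noteq> b \<Longrightarrow> x_subst (id(a := b)) f = 0 \<Longrightarrow> x_diff (a, b) dvd f"
  unfolding x_subst_def x_map_fun_upd x_diff_def using mvar_diff_dvd[of "X a" "X b" f] by simp

text \<open>Identifying the two variables of a new factor kills \<open>f\<close> but none of the
  factors already split off. It therefore kills the cofactor, as the ring is a domain, so no
  coprimality theory enters.\<close>

lemma prod_x_diff_dvd:
  assumes "P \<subseteq> index_pairs n" "\<And>a b. (a, b) \<in> P \<Longrightarrow> x_subst (id(a := b)) f = 0"
  shows "(\<Prod>p\<in>P. x_diff p) dvd f"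
proof -
  have "finite P" using finite_subset[OF assms(1)] by simp
  then show ?thesis using assms
  proof (induction P rule: finite_induct)
    case (insert p P)
    obtain a b where p: "p = (a, b)" "a < b" using insert.prems(1) by (auto simp: index_pairs_def)
    note hom = hom_simps[OF x_subst_hom[OF finite_fibers_fun_upd]]
    obtain g where g: "f = (\<Prod>p\<in>P. x_diff p) * g" using insert by (meson dvdE insert_subset subsetD insertI2)
    have "x_subst (id(a := b)) f = 0" using insert.prems(2) p by blast
    then have "(\<Prod>q\<in>P. x_subst (id(a := b)) (x_diff q)) * x_subst (id(a := b)) g = 0"
      unfolding g by (simp add: hom)
    moreover have "(\<Prod>q\<in>P. x_subst (id(a := b)) (x_diff q)) \<noteq> 0"
    proof -
      have "x_subst (id(a := b)) (x_diff q) \<noteq> 0" if "q \<in> P" for q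
        using that insert p by (intro x_diff_merge_nonzero[of _ n]) auto
      then show ?thesis using insert(1) by simp
    qed
    ultimately have "x_subst (id(a := b)) g = 0" by simp
    then have "x_diff p dvd g" using p x_diff_dvd by simp
    then show ?case using insert(1,2) g by (simp add: mult.commute mult_dvd_mono)
  qed simp
qed

text \<open>Signs are recorded only as "plus or minus"; where the value matters it is determined
  separately.\<close>

lemma prod_pm_cong:
  fixes f g :: "'i \<Rightarrow> 'a::comm_ring_1"
  assumes "\<And>p. p \<in> A \<Longrightarrow> f p = g p \<or> f p = - g p"
  shows "prod f A = prod g A \<or> prod f A = - prod g A"
  using assms
proof (induction A rule: infinite_finite_induct)
  case (insert x A)
  have "f x = g x \<or> f x = - g x" "prod f A = prod g A \<or> prod f A = - prod g A"
    using insert by auto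
  then show ?case using insert(1,2) by (elim disjE) simp_all
qed auto

definition sort_pair :: "nat \<times> nat \<Rightarrow> nat \<times> nat" where
  "sort_pair = (\<lambda>(a, b). (min a b, max a b))"

lemma x_diff_sort_pair: "x_diff p = x_diff (sort_pair p) \<or> x_diff p = - x_diff (sort_pair p)"
  by (cases p) (auto simp: x_diff_def sort_pair_def min_def max_def)

lemma prod_x_diff_sort:
  assumes "inj_on sort_pair P"
  shows "prod x_diff P = prod x_diff (sort_pair ` P) \<or> prod x_diff P = - prod x_diff (sort_pair ` P)"
  unfolding prod.reindex[OF assms] comp_def by (intro prod_pm_cong x_diff_sort_pair)

lemma inj_on_sort_pairI:
  assumes "\<And>a b. (a, b) \<in> P \<Longrightarrow> (b, a) \<notin> P" shows "inj_on sort_pair P"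
proof (rule inj_onI)
  fix p q assume pq: "p \<in> P" "q \<in> P" "sort_pair p = sort_pair q"
  then have "q = p \<or> q = (snd p, fst p)"
    by (cases p; cases q) (auto simp: sort_pair_def min_def max_def split: if_splits)
  then show "p = q" using pq assms[of "fst p" "snd p"] by auto
qed

lemma sort_pair_index_pairs: "a \<noteq> b \<Longrightarrow> a < n \<Longrightarrow> b < n \<Longrightarrow> sort_pair (a, b) \<in> index_pairs n"
  by (auto simp: sort_pair_def index_pairs_def min_def max_def)

text \<open>The exchange permutes the factors up to sign, so the result is plus or minus the
  product. A plus sign would force the cofactor \<open>V\<close> of \<open>x_diff (a, b)\<close> to
  change sign. Identifying the two variables afterwards gives twice the image of \<open>V\<close> as
  0, although no factor of \<open>V\<close> becomes 0.\<close>

lemma x_subst_swap_vandermonde: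
  assumes ab: "a < b" "b < n"
  shows "x_subst (transpose a b) (vandermonde n) = - vandermonde n"
proof -
  define \<tau> where "\<tau> = transpose a b"
  define s where "s = id(a := b)"
  have fin: "finite_fibers \<tau>" "finite_fibers s"
    unfolding \<tau>_def s_def by (simp_all add: finite_fibers_inj finite_fibers_fun_upd)
  have lt: "\<tau> i < n \<longleftrightarrow> i < n" for i using ab by (auto simp: \<tau>_def transpose_def)
  have inj: "inj \<tau>" by (simp add: \<tau>_def)
  let ?A = "index_pairs n"
  let ?T = "map_prod \<tau> \<tau>"
  have injT: "inj_on ?T ?A" using inj by (auto simp: inj_on_def inj_def)
  have asym: "(b, a) \<notin> ?T ` ?A" if "(a, b) \<in> ?T ` ?A" for a b
    using that by (auto simp: index_pairs_def inj_eq[OF inj])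
  have "sort_pair ` ?T ` ?A = ?A"
  proof (rule card_subset_eq)
    show "sort_pair ` ?T ` ?A \<subseteq> ?A"
    proof (unfold image_image, rule image_subsetI)
      fix p assume p: "p \<in> ?A"
      then have "\<tau> (fst p) \<noteq> \<tau> (snd p)" "\<tau> (fst p) < n" "\<tau> (snd p) < n"
        by (auto simp: index_pairs_def inj_eq[OF inj] lt)
      then show "sort_pair (?T p) \<in> ?A"
        by (cases p) (simp add: sort_pair_index_pairs)
    qed
    show "card (sort_pair ` ?T ` ?A) = card ?A"
      using inj_on_sort_pairI[OF asym] injT by (simp add: card_image)
  qed simp
  then have pm: "prod x_diff (?T ` ?A) = vandermonde n \<or> prod x_diff (?T ` ?A) = - vandermonde n"
    using prod_x_diff_sort[OF inj_on_sort_pairI[OF asym]] by (simp add: vandermonde_def)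
  have img: "x_subst \<tau> (vandermonde n) = prod x_diff (?T ` ?A)"
    unfolding prod.reindex[OF injT]
    by (simp add: vandermonde_def hom_simps[OF x_subst_hom[OF fin(1)]] x_subst_x_diff fin)
  have "x_subst \<tau> (vandermonde n) \<noteq> vandermonde n"
  proof
    assume eq: "x_subst \<tau> (vandermonde n) = vandermonde n"
    define V where "V = prod x_diff (?A - {(a, b)})"
    have V: "vandermonde n = x_diff (a, b) * V"
      unfolding vandermonde_def V_def using ab by (intro prod.remove) (simp, simp add: index_pairs_def)
    have "x_subst \<tau> (vandermonde n) = - (x_diff (a, b) * x_subst \<tau> V)"
      unfolding V hom_mult[OF x_subst_hom[OF fin(1)]] x_subst_x_diff[OF fin(1)]
      by (simp add: \<tau>_def x_diff_def algebra_simps)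
    then have "x_diff (a, b) * (x_subst \<tau> V + V) = 0"
      using eq V by (metis add.right_inverse distrib_left)
    then have "x_subst \<tau> V + V = 0" using x_diff_nonzero[of "(a, b)"] ab by simp
    then have "x_subst s (x_subst \<tau> V + V) = 0" using hom_0[OF x_subst_hom[OF fin(2)]] by simp
    moreover have "s \<circ> \<tau> = s" by (auto simp: s_def \<tau>_def transpose_def)
    ultimately have "x_subst s V + x_subst s V = 0"
      by (simp add: hom_add[OF x_subst_hom[OF fin(2)]] x_subst_comp[OF fin(2,1)])
    then have "mcoeff (x_subst s V) M + mcoeff (x_subst s V) M = 0" for M
      by (metis mcoeff_0 mcoeff_add)
    then have "x_subst s V = 0" by (intro mps_eqI) simp
    moreover have "x_subst s V \<noteq> 0"
      unfolding V_def hom_prod[OF x_subst_hom[OF fin(2)]] using x_diff_merge_nonzero[of _ n a b] ab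
      by (auto simp: s_def)
    ultimately show False by simp
  qed
  then show ?thesis using pm img by (simp add: \<tau>_def)
qed

section \<open>The antisymmetrized sums behind \<open>GP\<close>\<close>

text \<open>The summand of GP depends on a permutation only through its first \<open>r\<close>
  values, so the sum runs over injections instead. Extensionality gives each restriction a unique
  representative.\<close>

definition injections :: "nat \<Rightarrow> nat \<Rightarrow> (nat \<Rightarrow> nat) set" where
  "injections r n = {u \<in> {..<r} \<rightarrow>\<^sub>E {..<n}. inj_on u {..<r}}"

lemma finite_injections [simp]: "finite (injections r n)"
  unfolding injections_def by (intro finite_subset[OF _ finite_PiE[of "{..<r}" "\<lambda>_. {..<n}"]]) auto

lemma injectionsD:
  assumes "u \<in> injections r n"
  shows "i < r \<Longrightarrow> u i < n" "inj_on u {..<r}" "u \<in> extensional {..<r}"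
  using assms by (auto simp: injections_def PiE_def)

lemma injectionsI:
  "(\<And>i. i < r \<Longrightarrow> u i < n) \<Longrightarrow> inj_on u {..<r} \<Longrightarrow> u \<in> extensional {..<r} \<Longrightarrow> u \<in> injections r n"
  by (auto simp: injections_def PiE_def)

definition rest :: "nat \<Rightarrow> nat \<Rightarrow> (nat \<Rightarrow> nat) \<Rightarrow> nat set" where
  "rest r n u = {..<n} - u ` {..<r}"

lemma finite_rest [simp]: "finite (rest r n u)"
  by (simp add: rest_def)

text \<open>The index pairs of the double product in the definition of GP, the same for every
  permutation that extends \<open>u\<close>.\<close>

definition inj_pairs :: "nat \<Rightarrow> nat \<Rightarrow> (nat \<Rightarrow> nat) \<Rightarrow> (nat \<times> nat) set" where
  "inj_pairs r n u = map_prod u u ` index_pairs r \<union> (u ` {..<r}) \<times> rest r n u"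

lemma finite_inj_pairs [simp]: "finite (inj_pairs r n u)"
  by (simp add: inj_pairs_def)

lemma inj_pairs_prod:
  assumes "inj_on u {..<r}"
  shows "(\<Prod>p\<in>inj_pairs r n u. f p) =
    (\<Prod>(i, j)\<in>index_pairs r. f (u i, u j)) * (\<Prod>i<r. \<Prod>b\<in>rest r n u. f (u i, b))"
proof -
  have inj: "inj_on (map_prod u u) (index_pairs r)"
    using assms by (auto simp: inj_on_def index_pairs_def)
  have "(\<Prod>p\<in>inj_pairs r n u. f p) =
      (\<Prod>p\<in>map_prod u u ` index_pairs r. f p) * (\<Prod>p\<in>(u ` {..<r}) \<times> rest r n u. f p)"
    unfolding inj_pairs_def by (rule prod.union_disjoint, simp, simp, auto simp: rest_def index_pairs_def)
  also have "(\<Prod>p\<in>map_prod u u ` index_pairs r. f p) = (\<Prod>(i, j)\<in>index_pairs r. f (u i, u j))"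
    unfolding prod.reindex[OF inj] by (auto intro: prod.cong)
  also have "(\<Prod>p\<in>(u ` {..<r}) \<times> rest r n u. f p) = (\<Prod>a\<in>u ` {..<r}. \<Prod>b\<in>rest r n u. f (a, b))"
    by (simp add: prod.cartesian_product)
  also have "\<dots> = (\<Prod>i<r. \<Prod>b\<in>rest r n u. f (u i, b))"
    unfolding prod.reindex[OF assms] by simp
  finally show ?thesis .
qed

lemma inj_pairs_asym:
  assumes "inj_on u {..<r}" "(a, b) \<in> inj_pairs r n u" shows "(b, a) \<notin> inj_pairs r n u" "a \<noteq> b"
  using assms by (auto simp: inj_pairs_def rest_def index_pairs_def dest: inj_onD)
    (metis inj_onD lessThan_iff less_trans order_less_asym)+

lemma inj_pairs_less:
  assumes "u \<in> injections r n" "(a, b) \<in> inj_pairs r n u" shows "a < n" "b < n"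
  using assms injectionsD(1)[OF assms(1)] by (auto simp: inj_pairs_def rest_def index_pairs_def)

lemma inj_on_sort_inj_pairs: "inj_on u {..<r} \<Longrightarrow> inj_on sort_pair (inj_pairs r n u)"
  using inj_pairs_asym by (intro inj_on_sort_pairI) blast

lemma sort_inj_pairs_subset:
  assumes "u \<in> injections r n" shows "sort_pair ` inj_pairs r n u \<subseteq> index_pairs n"
proof (rule image_subsetI)
  fix p assume p: "p \<in> inj_pairs r n u"
  obtain a b where ab: "p = (a, b)" by (cases p)
  show "sort_pair p \<in> index_pairs n"
    using inj_pairs_less[OF assms] inj_pairs_asym(2)[OF injectionsD(2)[OF assms]] p
    unfolding ab by (intro sort_pair_index_pairs) blast+
qed

definition den :: "nat \<Rightarrow> nat \<Rightarrow> (nat \<Rightarrow> nat) \<Rightarrow> ps" where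
  "den r n u = prod x_diff (inj_pairs r n u)"

text \<open>Up to sign the product of the differences missing in \<open>den r n u\<close>: what
  remains of a summand's denominator after passing to the common denominator
  \<open>vandermonde n\<close>.\<close>

definition cofac :: "nat \<Rightarrow> nat \<Rightarrow> (nat \<Rightarrow> nat) \<Rightarrow> ps" where
  "cofac r n u = vandermonde n div den r n u"

definition x_oplus :: "nat \<times> nat \<Rightarrow> ps" where
  "x_oplus = (\<lambda>(a, b). oplus beta (xv a) (xv b))"

text \<open>The last product comes from the denominators 1 + \<beta> x_j inside
  \<open>\<ominus>\<close>: each variable outside the image of \<open>u\<close> occurs as the second
  argument for all \<open>r\<close> first arguments. The corresponding powers for the variables in
  the image are part of \<open>g\<close>.\<close>

definition num :: "nat \<Rightarrow> nat \<Rightarrow> (nat \<Rightarrow> nat \<Rightarrow> ps) \<Rightarrow> (nat \<Rightarrow> nat) \<Rightarrow> ps" where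
  "num r n g u = (\<Prod>i<r. g i (u i)) * (prod x_oplus (inj_pairs r n u) *
     (\<Prod>b\<in>rest r n u. (1 + beta * xv b) ^ r))"

definition antisum :: "nat \<Rightarrow> nat \<Rightarrow> (nat \<Rightarrow> nat \<Rightarrow> ps) \<Rightarrow> ps" where
  "antisum r n g = (\<Sum>u\<in>injections r n. cofac r n u * num r n g u)"

lemma den_nonzero: "u \<in> injections r n \<Longrightarrow> den r n u \<noteq> 0"
  unfolding den_def using inj_pairs_asym(2)[OF injectionsD(2)]
  by (auto intro!: x_diff_nonzero simp: split_paired_all)

lemma den_cofac:
  assumes "u \<in> injections r n" shows "den r n u * cofac r n u = vandermonde n"
proof -
  have "prod x_diff (sort_pair ` inj_pairs r n u) dvd vandermonde n"
    unfolding vandermonde_def by (intro prod_dvd_prod_subset sort_inj_pairs_subset assms) simp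
  then have "den r n u dvd vandermonde n"
    unfolding den_def using prod_x_diff_sort[OF inj_on_sort_inj_pairs[OF injectionsD(2)[OF assms]], of n] by auto
  then obtain h where "vandermonde n = den r n u * h" by blast
  then show ?thesis using den_nonzero[OF assms] by (simp add: cofac_def)
qed

definition symmetric_family :: "(nat \<Rightarrow> nat \<Rightarrow> ps) \<Rightarrow> bool" where
  "symmetric_family g \<longleftrightarrow> (\<forall>\<sigma> i a. finite_fibers \<sigma> \<longrightarrow> x_subst \<sigma> (g i a) = g i (\<sigma> a))"

text \<open>The exchange permutes the summands by composition with \<open>u\<close>; the numerators
  follow along, and the sign comes from the Vandermonde product through the cofactors.\<close>

lemma x_subst_antisum:
  assumes g: "symmetric_family g" and ab: "a < b" "b < n"
  shows "x_subst (transpose a b) (antisum r n g) = - antisum r n g"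
proof -
  define \<tau> where "\<tau> = transpose a b"
  have fin: "finite_fibers \<tau>" by (simp add: \<tau>_def finite_fibers_inj)
  note hom = hom_simps[OF x_subst_hom[OF fin]]
  have lt: "\<tau> i < n \<longleftrightarrow> i < n" for i using ab by (auto simp: \<tau>_def transpose_def)
  have inv: "\<tau> (\<tau> i) = i" for i by (simp add: \<tau>_def)
  have inj: "inj \<tau>" by (simp add: \<tau>_def)
  define act where "act u = restrict (\<tau> \<circ> u) {..<r}" for u
  have act_in: "act u \<in> injections r n" if "u \<in> injections r n" for u
    using that lt inj unfolding act_def
    by (intro injectionsI) (auto simp: injectionsD inj_on_def inj_def dest: inj_onD[OF injectionsD(2)])
  have act_act: "act (act u) = u" if "u \<in> injections r n" for u
    using injectionsD(3)[OF that] by (auto simp: act_def inv extensional_def)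
  have rest: "rest r n (act u) = \<tau> ` rest r n u" if "u \<in> injections r n" for u
  proof -
    have "\<tau> ` {..<n} = {..<n}"
      unfolding \<tau>_def using ab by (intro permutes_image permutes_swap_id) auto
    moreover have "act u ` {..<r} = \<tau> ` (u ` {..<r})" by (auto simp: act_def)
    ultimately show ?thesis unfolding rest_def by (simp add: image_set_diff[OF inj])
  qed
  have pairs: "inj_pairs r n (act u) = map_prod \<tau> \<tau> ` inj_pairs r n u" if "u \<in> injections r n" for u
  proof -
    have "map_prod (act u) (act u) ` index_pairs r = map_prod \<tau> \<tau> ` map_prod u u ` index_pairs r"
      unfolding image_image by (intro image_cong) (auto simp: act_def index_pairs_def)
    moreover have "(act u ` {..<r}) \<times> rest r n (act u) = map_prod \<tau> \<tau> ` ((u ` {..<r}) \<times> rest r n u)"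
      unfolding rest[OF that] by (auto simp: act_def map_prod_def image_iff)
    ultimately show ?thesis unfolding inj_pairs_def by (simp only: image_Un)
  qed
  have injT: "inj_on (map_prod \<tau> \<tau>) A" for A using inj by (auto simp: inj_on_def inj_def)
  have "x_subst \<tau> (cofac r n u * num r n g u) = - (cofac r n (act u) * num r n g (act u))"
    if u: "u \<in> injections r n" for u
  proof -
    have den: "x_subst \<tau> (den r n u) = den r n (act u)"
      unfolding den_def pairs[OF u] prod.reindex[OF injT] by (simp add: hom x_subst_x_diff fin)
    have "den r n (act u) * x_subst \<tau> (cofac r n u) = - vandermonde n"
      using x_subst_swap_vandermonde[OF ab] den_cofac[OF u] den by (metis \<tau>_def hom(4))
    also have "\<dots> = den r n (act u) * - cofac r n (act u)"
      using den_cofac[OF act_in[OF u]] by simp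
    finally have cof: "x_subst \<tau> (cofac r n u) = - cofac r n (act u)"
      using den_nonzero[OF act_in[OF u]] by (metis mult_cancel_left)
    have opl: "x_subst \<tau> (x_oplus p) = x_oplus (map_prod \<tau> \<tau> p)" for p
      by (cases p) (simp add: x_oplus_def oplus_def hom x_subst_xv[OF fin] x_subst_beta[OF fin])
    have "x_subst \<tau> (num r n g u) = num r n g (act u)"
      unfolding num_def pairs[OF u] rest[OF u] prod.reindex[OF injT] prod.reindex[OF inj_on_subset[OF inj subset_UNIV]]
      using g fin
      by (simp add: hom opl x_subst_xv[OF fin] x_subst_beta[OF fin] symmetric_family_def) (simp add: act_def)
    then show ?thesis using cof by (simp add: hom)
  qed
  then have "x_subst \<tau> (antisum r n g) = - (\<Sum>u\<in>injections r n. cofac r n (act u) * num r n g (act u))"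
    unfolding antisum_def by (simp add: hom sum_negf)
  also have "(\<Sum>u\<in>injections r n. cofac r n (act u) * num r n g (act u)) = antisum r n g"
    unfolding antisum_def
    by (rule sum.reindex_bij_witness[where i = act and j = act]) (auto simp: act_in act_act)
  finally show ?thesis by (simp add: \<tau>_def)
qed

text \<open>Identifying two variables is the same after exchanging them, so the image of an
  alternating series is its own negative.\<close>

lemma vandermonde_dvd_antisum:
  assumes "symmetric_family g" shows "vandermonde n dvd antisum r n g"
  unfolding vandermonde_def
proof (rule prod_x_diff_dvd[where n = n])
  fix a b assume "(a, b) \<in> index_pairs n"
  then have ab: "a < b" "b < n" by (auto simp: index_pairs_def)
  let ?s = "x_subst (id(a := b))"
  have fin: "finite_fibers (transpose a b)" by (simp add: finite_fibers_inj)
  have "id(a := b) \<circ> transpose a b = id(a := b)" by (auto simp: transpose_def)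
  then have "?s (antisum r n g) = ?s (x_subst (transpose a b) (antisum r n g))"
    by (simp only: x_subst_comp[OF finite_fibers_fun_upd fin])
  also have "\<dots> = - ?s (antisum r n g)"
    unfolding x_subst_antisum[OF assms ab] by (rule hom_uminus[OF x_subst_hom[OF finite_fibers_fun_upd]])
  finally have "mcoeff (?s (antisum r n g)) M = - mcoeff (?s (antisum r n g)) M" for M
    by (metis mcoeff_uminus)
  then show "?s (antisum r n g) = 0" by (intro mps_eqI) (metis equal_neg_zero mcoeff_0)
qed simp

section \<open>Stability in the number of variables and the limit\<close>

lemma x_truncate_hom: "mps_hom (x_truncate n)"
  unfolding x_truncate_restrict by (rule restrict_vars_hom)

lemma x_truncate_xv: "x_truncate n (xv i) = (if i < n then xv i else 0)"
  by (auto simp: x_truncate_restrict restrict_vars_mvar)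

lemma x_truncate_param: "vars_in param_vars f \<Longrightarrow> x_truncate n f = f"
  unfolding x_truncate_restrict vars_in_iff[symmetric] by (erule vars_in_mono) auto

definition truncating_family :: "(nat \<Rightarrow> nat \<Rightarrow> ps) \<Rightarrow> bool" where
  "truncating_family g \<longleftrightarrow> (\<forall>n i a. x_truncate n (g i a) = (if a < n then g i a else 0))"

lemma index_pairs_Suc: "index_pairs (Suc n) = index_pairs n \<union> (\<lambda>i. (i, n)) ` {..<n}"
  by (auto simp: index_pairs_def)

lemma vandermonde_Suc: "vandermonde (Suc n) = vandermonde n * (\<Prod>i<n. xv i - xv n)"
proof -
  have "vandermonde (Suc n) = vandermonde n * prod x_diff ((\<lambda>i. (i, n)) ` {..<n})"
    unfolding vandermonde_def index_pairs_Suc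
    by (rule prod.union_disjoint, simp, simp, auto simp: index_pairs_def)
  also have "prod x_diff ((\<lambda>i. (i, n)) ` {..<n}) = (\<Prod>i<n. xv i - xv n)"
    by (subst prod.reindex) (auto simp: inj_on_def x_diff_def)
  finally show ?thesis .
qed

lemma x_truncate_vandermonde: "x_truncate n (vandermonde n) = vandermonde n"
  unfolding vandermonde_def hom_prod[OF x_truncate_hom]
  by (intro prod.cong refl) (auto simp: x_diff_def index_pairs_def hom_simps[OF x_truncate_hom] x_truncate_xv)

lemma injections_mono: "injections r n \<subseteq> injections r (Suc n)"
  by (auto simp: injections_def PiE_def Pi_def less_SucI)

text \<open>At \<open>xv n = 0\<close> every summand whose injection takes the value
  \<open>n\<close> vanishes. In the others a pair (a, n) contributes \<open>xv a\<close> to the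
  denominator and to the \<open>\<oplus>\<close> product alike, while the larger Vandermonde product
  leaves behind the product of all \<open>xv i\<close>.\<close>

lemma x_truncate_antisum:
  assumes g: "truncating_family g"
  shows "x_truncate n (antisum r (Suc n) g) = (\<Prod>i<n. xv i) * antisum r n g"
proof -
  note hom = hom_simps[OF x_truncate_hom]
  let ?t = "x_truncate n"
  let ?Q = "\<Prod>i<n. xv i"
  have gt: "?t (g i a) = (if a < n then g i a else 0)" for i a
    using g by (simp add: truncating_family_def)
  have zero: "?t (cofac r (Suc n) u * num r (Suc n) g u) = 0"
    if u: "u \<in> injections r (Suc n) - injections r n" for u
  proof -
    have "\<exists>i<r. \<not> u i < n"
      using u by (auto simp: injections_def PiE_def Pi_def)
    then have "?t (\<Prod>i<r. g i (u i)) = 0"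
      unfolding hom by (auto simp: gt intro!: prod_zero)
    then show ?thesis by (simp add: num_def hom)
  qed
  have step: "?t (cofac r (Suc n) u * num r (Suc n) g u) = ?Q * (cofac r n u * num r n g u)"
    if u: "u \<in> injections r n" for u
  proof -
    have u': "u \<in> injections r (Suc n)" using u injections_mono by blast
    note inj = injectionsD(2)[OF u]
    let ?I = "u ` {..<r}"
    have less: "a < n" if "a \<in> ?I" for a using that injectionsD(1)[OF u] by auto
    have rest: "rest r (Suc n) u = insert n (rest r n u)" "n \<notin> rest r n u"
      using less by (auto simp: rest_def lessThan_Suc)
    have pairs: "inj_pairs r (Suc n) u = inj_pairs r n u \<union> (\<lambda>a. (a, n)) ` ?I"
      unfolding inj_pairs_def rest by auto
    have disj: "inj_pairs r n u \<inter> (\<lambda>a. (a, n)) ` ?I = {}"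
      using inj_pairs_less(2)[OF u] by auto
    have split: "(\<Prod>p\<in>inj_pairs r (Suc n) u. f p) = (\<Prod>p\<in>inj_pairs r n u. f p) * (\<Prod>a\<in>?I. f (a, n))"
      for f :: "nat \<times> nat \<Rightarrow> ps"
      unfolding pairs
      by (subst prod.union_disjoint) (use disj in \<open>simp_all add: prod.reindex inj_on_def\<close>)
    have old: "?t (x_diff p) = x_diff p \<and> ?t (x_oplus p) = x_oplus p" if "p \<in> inj_pairs r n u" for p
    proof -
      obtain a b where p: "p = (a, b)" by (cases p)
      have "a < n" "b < n" using that inj_pairs_less[OF u, of a b] unfolding p by auto
      then show ?thesis
        by (simp add: p x_diff_def x_oplus_def oplus_def hom x_truncate_xv x_truncate_param vars_in_beta)
    qed
    have new: "?t (x_diff (a, n)) = xv a \<and> ?t (x_oplus (a, n)) = xv a" if "a \<in> ?I" for a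
      using less[OF that] by (simp add: x_diff_def x_oplus_def oplus_def hom x_truncate_xv)
    let ?P = "\<Prod>a\<in>?I. xv a"
    have den: "?t (den r (Suc n) u) = den r n u * ?P"
      unfolding den_def split hom using old new by simp
    have opl: "?t (prod x_oplus (inj_pairs r (Suc n) u)) = prod x_oplus (inj_pairs r n u) * ?P"
      unfolding split hom using old new by simp
    have vd: "?t (vandermonde (Suc n)) = vandermonde n * ?Q"
      unfolding vandermonde_Suc hom x_truncate_vandermonde
      by (intro arg_cong2[of _ _ _ _ "(*)"] prod.cong refl) (simp add: x_truncate_xv)
    have "(den r n u * ?P) * ?t (cofac r (Suc n) u) = vandermonde n * ?Q"
      using den_cofac[OF u'] vd den by (metis hom(4))
    also have "\<dots> = den r n u * (cofac r n u * ?Q)"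
      using den_cofac[OF u] by (simp add: mult.assoc)
    finally have cof: "?P * ?t (cofac r (Suc n) u) = cofac r n u * ?Q"
      by (simp only: mult.assoc mult_left_cancel[OF den_nonzero[OF u]])
    have "?t (\<Prod>i<r. g i (u i)) = (\<Prod>i<r. g i (u i))"
      unfolding hom by (intro prod.cong refl) (auto simp: gt less)
    moreover have "?t (\<Prod>b\<in>rest r (Suc n) u. (1 + beta * xv b) ^ r) = (\<Prod>b\<in>rest r n u. (1 + beta * xv b) ^ r)"
    proof -
      have "?t (\<Prod>b\<in>rest r n u. (1 + beta * xv b) ^ r) = (\<Prod>b\<in>rest r n u. (1 + beta * xv b) ^ r)"
        unfolding hom by (intro prod.cong refl)
          (auto simp: rest_def hom x_truncate_xv x_truncate_param vars_in_beta)
      then show ?thesis unfolding rest(1) using rest(2) by (simp add: hom x_truncate_xv)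
    qed
    ultimately have "?t (num r (Suc n) g u) = num r n g u * ?P"
      unfolding num_def by (simp only: hom(4) opl) (simp add: mult_ac)
    then have "?t (cofac r (Suc n) u * num r (Suc n) g u) = (?P * ?t (cofac r (Suc n) u)) * num r n g u"
      by (simp add: hom)
    then show ?thesis by (simp add: cof)
  qed
  have "?t (antisum r (Suc n) g) = (\<Sum>u\<in>injections r (Suc n). ?t (cofac r (Suc n) u * num r (Suc n) g u))"
    by (simp only: antisum_def hom(7))
  also have "\<dots> = (\<Sum>u\<in>injections r n. ?t (cofac r (Suc n) u * num r (Suc n) g u))"
    by (rule sum.mono_neutral_right) (use injections_mono zero in auto)
  also have "\<dots> = ?Q * antisum r n g"
    unfolding antisum_def sum_distrib_left by (intro sum.cong refl step)
  finally show ?thesis .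
qed

lemma finite_x_indices: "finite {i. X i \<in># M}"
  using finite_vimageI[of "set_mset M" X] by (simp add: vimage_def inj_def)

lemma mvar_nonzero: "mvar v \<noteq> (0 :: ('a, 'b::comm_ring_1) mps)"
proof
  assume "mvar v = (0 :: ('a, 'b) mps)"
  then have "mcoeff (mvar v :: ('a, 'b) mps) {#v#} = 0" by simp
  then show False by (simp add: mvar_def)
qed

lemma mcoeff_x_truncate: "\<not> (\<exists>i\<ge>n. X i \<in># M) \<Longrightarrow> mcoeff (x_truncate n f) M = mcoeff f M"
  by (simp only: x_truncate_def mcoeff_Mps if_False)

lemma x_truncate_eqI:
  assumes "\<And>n. n \<ge> r \<Longrightarrow> x_truncate n f = x_truncate n g" shows "f = g"
proof (rule mps_eqI)
  fix M
  obtain m where "\<forall>i\<in>{i. X i \<in># M}. i < m"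
    using finite_x_indices finite_nat_set_iff_bounded by blast
  then have m: "\<not> (\<exists>i\<ge>max m r. X i \<in># M)" by auto
  show "mcoeff f M = mcoeff g M"
    using arg_cong[OF assms[of "max m r"], of "\<lambda>h. mcoeff h M"] unfolding mcoeff_x_truncate[OF m] by simp
qed

text \<open>A monomial contains finitely many x, so its coefficient is read off at a stage beyond
  all of them; compatibility makes the choice of stage irrelevant.\<close>

lemma x_truncate_limit:
  assumes "\<And>n. n \<ge> r \<Longrightarrow> x_truncate n (\<Phi> (Suc n)) = \<Phi> n"
  shows "\<exists>G. \<forall>n\<ge>r. x_truncate n G = \<Phi> n"
proof -
  have "\<exists>m. \<forall>i. X i \<in># M \<longrightarrow> i < m" for M
    using finite_x_indices[of M] finite_nat_set_iff_bounded by auto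
  then obtain bnd where bnd: "\<And>M i. X i \<in># M \<Longrightarrow> i < bnd M" by metis
  define G where "G = Mps (\<lambda>M. mcoeff (\<Phi> (max r (bnd M))) M)"
  have mono: "mcoeff (\<Phi> l) M = mcoeff (\<Phi> k) M"
    if "k \<le> l" "r \<le> k" "\<And>i. X i \<in># M \<Longrightarrow> i < k" for k l M
    using that(1)
  proof (induction l rule: dec_induct)
    case (step l)
    have "\<not> (\<exists>i\<ge>l. X i \<in># M)" using that(3) step by (meson le_trans not_le)
    then have "mcoeff (\<Phi> (Suc l)) M = mcoeff (x_truncate l (\<Phi> (Suc l))) M"
      by (rule mcoeff_x_truncate[symmetric])
    also have "x_truncate l (\<Phi> (Suc l)) = \<Phi> l" using assms step that(2) by simp
    finally show ?case using step by simp
  qed simp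
  have "x_truncate n G = \<Phi> n" if n: "n \<ge> r" for n
  proof (rule mps_eqI)
    fix M
    show "mcoeff (x_truncate n G) M = mcoeff (\<Phi> n) M"
    proof (cases "\<exists>i\<ge>n. X i \<in># M")
      case True
      have "mcoeff (\<Phi> n) M = mcoeff (x_truncate n (\<Phi> (Suc n))) M" using assms[OF n] by simp
      then show ?thesis using True by (simp add: x_truncate_def)
    next
      case False
      let ?m = "max r (bnd M)"
      have lt: "i < n" "i < ?m" if "X i \<in># M" for i
        using that False bnd[OF that] by (auto simp: not_le)
      have "mcoeff (\<Phi> ?m) M = mcoeff (\<Phi> n) M"
      proof (cases "n \<le> ?m")
        case True then show ?thesis using lt n by (intro mono) auto
      next
        case False then show ?thesis using lt by (intro mono[symmetric]) auto
      qed
      then show ?thesis unfolding mcoeff_x_truncate[OF False] by (simp only: G_def mcoeff_Mps)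
    qed
  qed
  then show ?thesis by blast
qed

text \<open>The existence half for GP: the quotients by the Vandermonde products form a compatible
  system, since the extra factor in \<open>x_truncate_antisum\<close> appears on both sides.\<close>

lemma antisum_limit:
  assumes "symmetric_family g" "truncating_family g"
  shows "\<exists>G. \<forall>n\<ge>r. vandermonde n * x_truncate n G = antisum r n g"
proof -
  define \<Phi> where "\<Phi> n = antisum r n g div vandermonde n" for n
  have \<Phi>: "vandermonde n * \<Phi> n = antisum r n g" for n
    using vandermonde_dvd_antisum[OF assms(1), of n r] vandermonde_nonzero[of n] by (auto simp: \<Phi>_def)
  have "x_truncate n (\<Phi> (Suc n)) = \<Phi> n" for n
  proof -
    let ?Q = "\<Prod>i<n. xv i"
    have Q: "?Q \<noteq> 0"
      by (simp add: mvar_nonzero)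
    have "vandermonde n * ?Q * x_truncate n (\<Phi> (Suc n)) = x_truncate n (vandermonde (Suc n) * \<Phi> (Suc n))"
      unfolding hom_mult[OF x_truncate_hom] vandermonde_Suc x_truncate_vandermonde hom_prod[OF x_truncate_hom]
      by (simp add: hom_diff[OF x_truncate_hom] x_truncate_xv)
    also have "\<dots> = vandermonde n * ?Q * \<Phi> n"
      unfolding \<Phi> x_truncate_antisum[OF assms(2)] by (simp add: \<Phi>[symmetric])
    finally show ?thesis using Q vandermonde_nonzero[of n] by simp
  qed
  then obtain G where "\<forall>n\<ge>r. x_truncate n G = \<Phi> n" using x_truncate_limit[of r \<Phi>] by blast
  then show ?thesis using \<Phi> by metis
qed

lemma ord_eq_vandermonde: "ord_eq (card (index_pairs n)) (vandermonde n)"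
proof -
  have "ord_eq (\<Sum>p\<in>index_pairs n. 1) (prod x_diff (index_pairs n))"
    by (intro ord_eq_prod ord_eq_x_diff finite_index_pairs) (auto simp: index_pairs_def)
  then show ?thesis by (simp add: vandermonde_def)
qed

text \<open>The order missing in the cofactor is the number of differences in \<open>den\<close>,
  and the equally many \<open>\<oplus>\<close> factors of order at least 1 restore it.\<close>

lemma ord_ge_antisum:
  assumes "\<And>i a. i < r \<Longrightarrow> ord_ge (k i) (g i a)"
  shows "ord_ge (card (index_pairs n) + (\<Sum>i<r. k i)) (antisum r n g)"
  unfolding antisum_def
proof (rule ord_ge_sum)
  fix u assume u: "u \<in> injections r n"
  let ?P = "inj_pairs r n u"
  have deneq: "ord_eq (card ?P) (den r n u)"
  proof -
    have "ord_eq (\<Sum>p\<in>?P. 1) (prod x_diff ?P)"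
    proof (intro ord_eq_prod ord_eq_x_diff finite_inj_pairs)
      fix p assume "p \<in> ?P"
      then show "fst p \<noteq> snd p" using inj_pairs_asym(2)[OF injectionsD(2)[OF u]] by (cases p) auto
    qed
    then show ?thesis by (simp add: den_def)
  qed
  have le: "card ?P \<le> card (index_pairs n)"
    using card_mono[OF finite_index_pairs sort_inj_pairs_subset[OF u]]
      card_image[OF inj_on_sort_inj_pairs[OF injectionsD(2)[OF u]], of n] by simp
  have "ord_ge (card ?P + (card (index_pairs n) - card ?P)) (den r n u * cofac r n u)"
    unfolding den_cofac[OF u] using ord_eq_vandermonde[of n] le by (simp add: ord_eq_def)
  with deneq have cof: "ord_ge (card (index_pairs n) - card ?P) (cofac r n u)"
    by (rule ord_ge_cancel)
  have "ord_ge 1 (x_oplus p)" for p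
    unfolding x_oplus_def oplus_def case_prod_unfold
    by (intro ord_ge_add ord_ge_mult_right ord_ge_mvar)
  then have "ord_ge (card ?P) (prod x_oplus ?P)"
    using ord_ge_prod[of ?P "\<lambda>_. 1" x_oplus] by simp
  moreover have "ord_ge (\<Sum>i<r. k i) (\<Prod>i<r. g i (u i))"
    using assms by (intro ord_ge_prod) auto
  ultimately have "ord_ge ((\<Sum>i<r. k i) + card ?P) (num r n g u)"
    unfolding num_def by (intro ord_ge_mult ord_ge_mult_left)
  from ord_ge_mult[OF cof this]
  show "ord_ge (card (index_pairs n) + (\<Sum>i<r. k i)) (cofac r n u * num r n g u)"
    by (rule ord_ge_mono) (use le in simp)
qed

section \<open>The antisymmetrized sum as an alternating form in its polynomial entries\<close>

definition poly_family :: "(nat \<Rightarrow> ps poly) \<Rightarrow> nat \<Rightarrow> nat \<Rightarrow> ps" where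
  "poly_family g i a = poly (g i) (xv a)"

text \<open>Since the two slots are adjacent, the exchange only permutes the pairs, apart from
  reversing the pair formed by these slots themselves.\<close>

lemma den_swap:
  assumes u: "u \<in> injections r n" and i: "Suc i < r"
  shows "den r n (u(i := u (Suc i), Suc i := u i)) = - den r n u" (is "den r n ?u = _")
    and "prod x_oplus (inj_pairs r n (u(i := u (Suc i), Suc i := u i))) = prod x_oplus (inj_pairs r n u)"
    and "rest r n (u(i := u (Suc i), Suc i := u i)) = rest r n u"
    and "u(i := u (Suc i), Suc i := u i) \<in> injections r n"
proof -
  define \<tau> where "\<tau> = transpose i (Suc i)"
  have up: "?u = u \<circ> \<tau>" by (auto simp: \<tau>_def transpose_def)
  have lt: "\<tau> j < r \<longleftrightarrow> j < r" for j using i by (auto simp: \<tau>_def transpose_def)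
  have inv: "\<tau> (\<tau> j) = j" for j by (simp add: \<tau>_def)
  have \<tau>_img: "\<tau> ` {..<r} = {..<r}"
    using i unfolding \<tau>_def by (intro permutes_image permutes_swap_id) auto
  then have img: "?u ` {..<r} = u ` {..<r}" unfolding up image_comp[symmetric] by simp
  have inj: "inj_on ?u {..<r}"
    unfolding up by (intro comp_inj_on) (simp_all add: \<tau>_img injectionsD(2)[OF u], simp add: \<tau>_def)
  show rest: "rest r n ?u = rest r n u" by (simp only: rest_def img)
  show "?u \<in> injections r n"
  proof (rule injectionsI[OF _ inj])
    show "?u j < n" if "j < r" for j using that i injectionsD(1)[OF u] by simp
    show "?u \<in> extensional {..<r}" using i injectionsD(3)[OF u] by (simp add: extensional_def)
  qed
  define W where "W = index_pairs r - {(i, Suc i)}"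
  have W: "index_pairs r = insert (i, Suc i) W" "(i, Suc i) \<notin> W" "finite W"
    using i by (auto simp: W_def) (auto simp: index_pairs_def)
  have T: "map_prod \<tau> \<tau> p \<in> W" if "p \<in> W" for p
  proof -
    obtain x y where p: "p = (x, y)" by (cases p)
    have xy: "x < y" "y < r" "x \<noteq> i \<or> y \<noteq> Suc i" using that by (auto simp: p W_def index_pairs_def)
    have "\<tau> j = (if j = i then Suc i else if j = Suc i then i else j)" for j
      by (auto simp: \<tau>_def transpose_def)
    then show ?thesis using xy i by (auto simp: p W_def index_pairs_def)
  qed
  \<comment> \<open>The factor \<open>c\<close> records the effect of reversing this single pair: -1
    for differences and 1 for the symmetric \<open>\<oplus>\<close>.\<close>
  have main: "(\<Prod>p\<in>inj_pairs r n ?u. f p) = c * (\<Prod>p\<in>inj_pairs r n u. f p)"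
    if f: "f (u (Suc i), u i) = c * f (u i, u (Suc i))" for f :: "nat \<times> nat \<Rightarrow> ps" and c
  proof -
    have "(\<Prod>(a, b)\<in>W. f (?u a, ?u b)) = (\<Prod>(a, b)\<in>W. f (u a, u b))"
      unfolding up
      by (rule prod.reindex_bij_witness[where i = "map_prod \<tau> \<tau>" and j = "map_prod \<tau> \<tau>"])
        (use T in \<open>simp_all add: inv case_prod_unfold map_prod_def\<close>)
    then have "(\<Prod>(a, b)\<in>index_pairs r. f (?u a, ?u b)) = c * (\<Prod>(a, b)\<in>index_pairs r. f (u a, u b))"
      unfolding W(1) using W(2,3) f by (simp add: mult.assoc)
    moreover have "(\<Prod>a<r. \<Prod>b\<in>rest r n u. f (?u a, b)) = (\<Prod>a<r. \<Prod>b\<in>rest r n u. f (u a, b))"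
      unfolding up
      by (rule prod.reindex_bij_witness[where i = \<tau> and j = \<tau>]) (auto simp: lt inv)
    ultimately show ?thesis
      unfolding inj_pairs_prod[OF inj] inj_pairs_prod[OF injectionsD(2)[OF u]] rest
      by (simp add: mult.assoc)
  qed
  show "den r n ?u = - den r n u"
    unfolding den_def by (subst main[of _ "- 1"]) (simp_all add: x_diff_def)
  show "prod x_oplus (inj_pairs r n ?u) = prod x_oplus (inj_pairs r n u)"
    by (subst main[of _ 1]) (simp_all add: x_oplus_def oplus_def algebra_simps)
qed

text \<open>Exchanging two polynomials amounts to exchanging two values of \<open>u\<close>, where
  only the sign of the cofactor changes. This uses that the powers for the variables in the image of
  \<open>u\<close> were moved into the entries.\<close>

lemma alt_form_antisum: "alt_form r (\<lambda>g. antisum r n (poly_family g))"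
proof (rule alt_formI)
  fix g g' :: "nat \<Rightarrow> ps poly" assume "\<And>i. i < r \<Longrightarrow> g i = g' i"
  then show "antisum r n (poly_family g) = antisum r n (poly_family g')"
    by (simp add: antisum_def num_def poly_family_def)
next
  fix g :: "nat \<Rightarrow> ps poly" and i assume i: "i < r"
  have split: "num r n (poly_family (g(i := p))) u = poly p (xv (u i)) *
      ((\<Prod>j\<in>{..<r} - {i}. poly (g j) (xv (u j))) * (prod x_oplus (inj_pairs r n u) *
        (\<Prod>b\<in>rest r n u. (1 + beta * xv b) ^ r)))" for p u
    unfolding num_def using i
    by (subst prod.remove[of _ i]) (auto simp: poly_family_def mult.assoc intro!: prod.cong)
  show "antisum r n (poly_family (g(i := p + q))) =
      antisum r n (poly_family (g(i := p))) + antisum r n (poly_family (g(i := q)))" for p q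
    unfolding antisum_def split by (simp add: algebra_simps sum.distrib)
  show "antisum r n (poly_family (g(i := smult a p))) = a * antisum r n (poly_family (g(i := p)))" for a p
    unfolding antisum_def split by (simp add: algebra_simps sum_distrib_left)
next
  fix g :: "nat \<Rightarrow> ps poly" and i assume i: "Suc i < r"
  let ?g = "g(i := g (Suc i), Suc i := g i)"
  define sw where "sw u = u(i := u (Suc i), Suc i := u i)" for u :: "nat \<Rightarrow> nat"
  have sw_sw: "sw (sw u) = u" for u by (auto simp: sw_def)
  have flip: "cofac r n (sw u) * num r n (poly_family ?g) (sw u) = - (cofac r n u * num r n (poly_family g) u)"
    if u: "u \<in> injections r n" for u
  proof -
    note d = den_swap[OF u i, folded sw_def]
    have "den r n u * - cofac r n (sw u) = den r n u * cofac r n u"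
      using den_cofac[OF u] den_cofac[OF d(4)] unfolding d(1) by simp
    then have "- cofac r n (sw u) = cofac r n u" using den_nonzero[OF u] by (metis mult_cancel_left)
    then have c: "cofac r n (sw u) = - cofac r n u" by (metis minus_minus)
    have "(\<Prod>j<r. poly (?g j) (xv (sw u j))) = (\<Prod>j<r. poly (g j) (xv (u j)))"
      by (rule prod.reindex_bij_witness[where i = "transpose i (Suc i)" and j = "transpose i (Suc i)"])
        (use i in \<open>auto simp: sw_def transpose_def\<close>)
    then show ?thesis
      unfolding num_def poly_family_def d(2,3) c by (simp only: mult_minus_left)
  qed
  have "antisum r n (poly_family ?g) = (\<Sum>u\<in>injections r n. cofac r n (sw u) * num r n (poly_family ?g) (sw u))"
    unfolding antisum_def
    by (rule sum.reindex_bij_witness[where i = sw and j = sw])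
      (auto simp: sw_sw intro: den_swap(4)[OF _ i, folded sw_def])
  also have "\<dots> = - antisum r n (poly_family g)"
    unfolding antisum_def sum_negf[symmetric] by (intro sum.cong refl flip)
  finally show "antisum r n (poly_family ?g) = - antisum r n (poly_family g)" .
qed

definition wedge_family :: "(nat \<Rightarrow> ps) \<Rightarrow> (nat \<Rightarrow> nat) \<Rightarrow> nat \<Rightarrow> nat \<Rightarrow> ps" where
  "wedge_family b k i a = (1 + beta * xv a) ^ i * (xv a * (\<Prod>l<k i - 1. xv a - b l))"

lemma poly_family_wedge: "poly_family (wedge b k) = wedge_family b k"
  by (intro ext) (simp add: wedge_family_def poly_family_def wedge_def fac_def poly_prod poly_power algebra_simps)

context
  fixes b :: "nat \<Rightarrow> ps"
  assumes b: "parameter_seq b"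
begin

lemma symmetric_wedge: "symmetric_family (wedge_family b k)"
  unfolding symmetric_family_def
proof (intro allI impI)
  fix \<sigma> :: "nat \<Rightarrow> nat" and i a assume fin: "finite_fibers \<sigma>"
  show "x_subst \<sigma> (wedge_family b k i a) = wedge_family b k i (\<sigma> a)"
    by (simp add: wedge_family_def hom_simps[OF x_subst_hom[OF fin]] x_subst_xv[OF fin]
        x_subst_beta[OF fin] x_subst_param[OF fin] parameter_seqD[OF b])
qed

lemma truncating_wedge: "truncating_family (wedge_family b k)"
  unfolding truncating_family_def
  by (simp add: wedge_family_def hom_simps[OF x_truncate_hom] x_truncate_xv x_truncate_param
      vars_in_beta parameter_seqD[OF b])

lemma ord_ge_wedge: assumes "k i > 0" shows "ord_ge (k i) (wedge_family b k i a)"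
proof -
  have "ord_ge 1 (xv a - b l)" for l
    using b by (intro ord_ge_diff ord_ge_mvar) (simp add: ord_ge_Suc_0 parameter_seqD)
  then have "ord_ge (k i - 1) (\<Prod>l<k i - 1. xv a - b l)"
    using ord_ge_prod[of "{..<k i - 1}" "\<lambda>_. 1" "\<lambda>l. xv a - b l"] by simp
  from ord_ge_mult[OF ord_ge_mvar this, of "X a"]
  have "ord_ge (k i) (xv a * (\<Prod>l<k i - 1. xv a - b l))" using assms by simp
  then show ?thesis unfolding wedge_family_def by (rule ord_ge_mult_right)
qed

lemma d_fac_unit: "mcoeff (d_fac b lam) {#} = 1"
  by (simp add: d_fac_def mcoeff_prod_empty mcoeff_1 mcoeff_mvar_mult)

lemma d_fac_param: "vars_in param_vars (d_fac b lam)"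
  unfolding d_fac_def by (intro vars_in_prod vars_in_add vars_in_1 vars_in_mult vars_in_beta parameter_seqD[OF b])

end

text \<open>Every injection extends to (n - r)! permutations, which cancels the prefactor in the
  definition of GP.\<close>

lemma sum_restrict_permutes:
  fixes h :: "(nat \<Rightarrow> nat) \<Rightarrow> 'a::comm_ring_1"
  assumes "r \<le> n"
  shows "(\<Sum>w | w permutes {..<n}. h (restrict w {..<r})) = of_nat (fact (n - r)) * (\<Sum>u\<in>injections r n. h u)"
proof -
  let ?W = "{w. w permutes {..<n}}"
  let ?res = "\<lambda>w :: nat \<Rightarrow> nat. restrict w {..<r}"
  have finW: "finite ?W" by (rule finite_permutations) simp
  have res: "?res w \<in> injections r n" if "w permutes {..<n}" for w
    using assms permutes_inj_on[OF that] permutes_in_image[OF that]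
    by (intro injectionsI) (auto simp: inj_on_def)
  have card: "card {w \<in> ?W. ?res w = u} = fact (n - r)" if u: "u \<in> injections r n" for u
  proof -
    have "card (rest r n u) = n - r"
      unfolding rest_def using injectionsD[OF u] by (subst card_Diff_subset) (auto simp: card_image)
    then have "card {r..<n} = card (rest r n u)" by simp
    then obtain f where f: "bij_betw f {r..<n} (rest r n u)"
      using finite_same_card_bij[of "{r..<n}" "rest r n u"] by auto
    \<comment> \<open>One reference extension of \<open>u\<close>; all others arise from it by first
      permuting the positions from \<open>r\<close> on.\<close>
    define w0 where "w0 x = (if x < r then u x else if x < n then f x else x)" for x
    have "bij_betw w0 {..<r} (u ` {..<r})"
      using injectionsD(2)[OF u] by (auto simp: bij_betw_def w0_def inj_on_def)
    moreover have "bij_betw w0 {r..<n} (rest r n u)"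
      using f by (subst bij_betw_cong[of _ _ f]) (auto simp: w0_def)
    ultimately have "bij_betw w0 ({..<r} \<union> {r..<n}) (u ` {..<r} \<union> rest r n u)"
      by (rule bij_betw_combine) (auto simp: rest_def)
    moreover have "{..<r} \<union> {r..<n} = {..<n}" using assms by auto
    moreover have "u ` {..<r} \<union> rest r n u = {..<n}" using injectionsD(1)[OF u] by (auto simp: rest_def)
    ultimately have w0: "w0 permutes {..<n}"
      using assms by (intro bij_imp_permutes) (auto simp: w0_def)
    have "bij_betw (\<lambda>s. w0 \<circ> s) {s. s permutes {r..<n}} {w \<in> ?W. ?res w = u}"
    proof (rule bij_betw_byWitness[where f' = "\<lambda>w. inv_into UNIV w0 \<circ> w"])
      show "\<forall>s\<in>{s. s permutes {r..<n}}. inv_into UNIV w0 \<circ> (w0 \<circ> s) = s"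
        using permutes_inv_o(2)[OF w0] by (auto simp: comp_assoc[symmetric])
      show "\<forall>w\<in>{w \<in> ?W. ?res w = u}. w0 \<circ> (inv_into UNIV w0 \<circ> w) = w"
        using permutes_inv_o(1)[OF w0] by (auto simp: comp_assoc[symmetric])
      show "(\<lambda>s. w0 \<circ> s) ` {s. s permutes {r..<n}} \<subseteq> {w \<in> ?W. ?res w = u}"
      proof (rule image_subsetI)
        fix s assume "s \<in> {s. s permutes {r..<n}}"
        then have s: "s permutes {r..<n}" by simp
        have "s permutes {..<n}" by (rule permutes_subset[OF s]) auto
        then have "w0 \<circ> s permutes {..<n}" using w0 by (rule permutes_compose)
        moreover have "?res (w0 \<circ> s) = u"
          using permutes_not_in[OF s] injectionsD(3)[OF u]
          by (auto simp: w0_def extensional_def)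
        ultimately show "w0 \<circ> s \<in> {w \<in> ?W. ?res w = u}" by simp
      qed
      show "(\<lambda>w. inv_into UNIV w0 \<circ> w) ` {w \<in> ?W. ?res w = u} \<subseteq> {s. s permutes {r..<n}}"
      proof (rule image_subsetI)
        fix w assume "w \<in> {w \<in> ?W. ?res w = u}"
        then have w: "w permutes {..<n}" "?res w = u" by auto
        have "inv_into UNIV w0 \<circ> w permutes {..<n}" using w(1) permutes_inv[OF w0] by (rule permutes_compose)
        moreover have "(inv_into UNIV w0 \<circ> w) x = x" if "x \<in> {..<n} - {r..<n}" for x
        proof -
          have "x < r" using that by auto
          then have "w x = w0 x" using fun_cong[OF w(2), of x] by (simp add: w0_def)
          then show ?thesis using permutes_inverses(2)[OF w0] by simp
        qed
        ultimately show "inv_into UNIV w0 \<circ> w \<in> {s. s permutes {r..<n}}"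
          by (auto intro: permutes_superset)
      qed
    qed
    then have "card {w \<in> ?W. ?res w = u} = card {s. s permutes {r..<n}}" by (rule bij_betw_same_card[symmetric])
    also have "\<dots> = fact (n - r)" by (rule card_permutations) auto
    finally show ?thesis .
  qed
  have "(\<Sum>w\<in>?W. h (?res w)) = (\<Sum>u\<in>injections r n. \<Sum>w\<in>{w\<in>?W. ?res w = u}. h (?res w))"
    by (rule sum.group[symmetric]) (use finW res in auto)
  also have "\<dots> = (\<Sum>u\<in>injections r n. of_nat (fact (n - r)) * h u)"
  proof (rule sum.cong[OF refl])
    fix u assume u: "u \<in> injections r n"
    have "(\<Sum>w\<in>{w\<in>?W. ?res w = u}. h (?res w)) = (\<Sum>w\<in>{w\<in>?W. ?res w = u}. h u)"
      by (rule sum.cong) auto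
    then show "(\<Sum>w\<in>{w\<in>?W. ?res w = u}. h (?res w)) = of_nat (fact (n - r)) * h u"
      by (simp only: sum_constant card[OF u])
  qed
  finally show ?thesis by (simp add: sum_distrib_left)
qed

section \<open>The functions \<open>GP\<close> in terms of antisymmetrized sums\<close>

lemma to_fract_hom: "mps_hom (to_fract :: 'a::idom \<Rightarrow> 'a fract)"
  by (simp add: mps_hom_def)

lemma prod_positions:
  assumes w: "w permutes {..<n}" and r: "r \<le> n"
  defines "u \<equiv> restrict w {..<r}"
  shows "(\<Prod>i<r. \<Prod>j=i+1..<n. F (w i) (w j)) =
    (\<Prod>(i, j)\<in>index_pairs r. F (u i) (u j)) * (\<Prod>i<r. \<Prod>b\<in>rest r n u. F (u i) b)"
proof -
  have img: "w ` {r..<n} = rest r n u"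
  proof -
    have "u ` {..<r} = w ` {..<r}" by (auto simp: u_def)
    moreover have "{r..<n} = {..<n} - {..<r}" by auto
    ultimately show ?thesis
      by (simp only: rest_def image_set_diff[OF permutes_inj[OF w]] permutes_image[OF w])
  qed
  have split: "(\<Prod>j=i+1..<n. F (w i) (w j)) = (\<Prod>j=i+1..<r. F (u i) (u j)) * (\<Prod>b\<in>rest r n u. F (u i) b)"
    if "i < r" for i
  proof -
    have "{i+1..<n} = {i+1..<r} \<union> {r..<n}" using that r by auto
    moreover have "w i = u i" using that by (simp add: u_def)
    ultimately have "(\<Prod>j=i+1..<n. F (w i) (w j)) = (\<Prod>j=i+1..<r. F (u i) (w j)) * (\<Prod>j=r..<n. F (u i) (w j))"
      by (simp add: prod.union_disjoint)
    also have "(\<Prod>j=r..<n. F (u i) (w j)) = (\<Prod>b\<in>rest r n u. F (u i) b)"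
      unfolding img[symmetric] by (subst prod.reindex) (auto intro: permutes_inj_on[OF w])
    also have "(\<Prod>j=i+1..<r. F (u i) (w j)) = (\<Prod>j=i+1..<r. F (u i) (u j))"
      by (intro prod.cong) (auto simp: u_def)
    finally show ?thesis .
  qed
  have "(\<Prod>i<r. \<Prod>j=i+1..<r. F (u i) (u j)) = (\<Prod>(i, j)\<in>index_pairs r. F (u i) (u j))"
  proof -
    have "index_pairs r = (SIGMA i:{..<r}. {i+1..<r})" by (auto simp: index_pairs_def)
    then show ?thesis by (simp add: prod.Sigma)
  qed
  moreover have "(\<Prod>i<r. \<Prod>j=i+1..<n. F (w i) (w j)) =
      (\<Prod>i<r. (\<Prod>j=i+1..<r. F (u i) (u j)) * (\<Prod>b\<in>rest r n u. F (u i) b))"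
    by (intro prod.cong refl split) simp
  ultimately show ?thesis by (simp only: prod.distrib)
qed

text \<open>Position \<open>j\<close> is the second member of \<open>j\<close> pairs. This is the
  origin of the exponent in \<open>wedge\<close>.\<close>

lemma prod_index_pairs_snd:
  fixes c :: "nat \<Rightarrow> 'a::comm_monoid_mult"
  shows "(\<Prod>(i, j)\<in>index_pairs r. c j) = (\<Prod>j<r. c j ^ j)"
proof -
  have "(\<Prod>(i, j)\<in>index_pairs r. c j) = (\<Prod>(j, i)\<in>(SIGMA j:{..<r}. {..<j}). c j)"
    by (rule prod.reindex_bij_witness[where i = "\<lambda>(j, i). (i, j)" and j = "\<lambda>(i, j). (j, i)"])
      (auto simp: index_pairs_def)
  also have "\<dots> = (\<Prod>j<r. \<Prod>i<j. c j)" by (rule prod.Sigma[symmetric]) auto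
  finally show ?thesis by simp
qed

text \<open>The denominators of \<open>\<ominus>\<close> with a parameter multiply to
  \<open>d_fac b lam\<close>; those with a variable become the powers of 1 + \<beta> x in
  \<open>wedge_family\<close> and \<open>num\<close>; the differences of variables form
  \<open>den\<close>.\<close>

lemma GP_fin_term:
  fixes b :: "nat \<Rightarrow> ps" and lam :: "nat list"
  defines "r \<equiv> length lam"
  assumes w: "w permutes {..<n}" and r: "r \<le> n"
  defines "u \<equiv> restrict w {..<r}"
  shows "(\<Prod>i<r. to_fract (xv (w i)) * (\<Prod>l<lam ! i - 1. ominus (to_fract beta) (to_fract (xv (w i))) (to_fract (b l)))) *
     (\<Prod>i<r. \<Prod>j=i+1..<n. oplus (to_fract beta) (to_fract (xv (w i))) (to_fract (xv (w j))) /
        ominus (to_fract beta) (to_fract (xv (w i))) (to_fract (xv (w j)))) *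
     to_fract (d_fac b lam * vandermonde n) =
     to_fract (cofac r n u * num r n (wedge_family b ((!) lam)) u)"
proof -
  let ?h = "to_fract :: ps \<Rightarrow> ps fract"
  note hom = hom_simps[OF to_fract_hom]
  have u: "u \<in> injections r n"
    unfolding u_def using r permutes_inj_on[OF w] permutes_in_image[OF w]
    by (intro injectionsI) (auto simp: inj_on_def)
  have nz: "?h (1 + beta * f) \<noteq> 0" for f
    unfolding to_fract_eq_0_iff by (rule one_plus_beta_nonzero)
  let ?A = "\<Prod>i<r. xv (u i) * (\<Prod>l<lam ! i - 1. xv (u i) - b l)"
  let ?c = "\<lambda>a. 1 + beta * xv a"
  let ?P = "inj_pairs r n u"
  have om: "ominus (?h beta) (?h f) (?h g) = ?h (f - g) / ?h (1 + beta * g)" for f g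
    by (simp add: ominus_def hom)
  have part1: "(\<Prod>i<r. ?h (xv (w i)) * (\<Prod>l<lam ! i - 1. ominus (?h beta) (?h (xv (w i))) (?h (b l)))) * ?h (d_fac b lam)
      = ?h ?A"
  proof -
    have e1: "(\<Prod>l<m. ominus (?h beta) (?h x) (?h (b l))) * (\<Prod>l<m. ?h (1 + beta * b l)) = (\<Prod>l<m. ?h (x - b l))" for m x
      unfolding prod.distrib[symmetric] om using nz by (intro prod.cong refl) simp
    have "(\<Prod>i<r. ?h (xv (w i)) * (\<Prod>l<lam ! i - 1. ominus (?h beta) (?h (xv (w i))) (?h (b l)))) * ?h (d_fac b lam)
        = (\<Prod>i<r. ?h (xv (w i)) * (\<Prod>l<lam ! i - 1. ?h (xv (w i) - b l)))"
      unfolding d_fac_def r_def[symmetric] hom_prod[OF to_fract_hom] prod.distrib[symmetric]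
      by (intro prod.cong refl) (simp only: mult.assoc e1)
    also have "\<dots> = ?h ?A"
      unfolding hom_prod[OF to_fract_hom] hom_mult[OF to_fract_hom]
      by (intro prod.cong refl) (simp add: u_def)
    finally show ?thesis .
  qed
  define G where "G p = ?h (x_oplus p) / ?h (x_diff p)" for p
  have "(\<Prod>i<r. \<Prod>j=i+1..<n. oplus (?h beta) (?h (xv (w i))) (?h (xv (w j))) /
        ominus (?h beta) (?h (xv (w i))) (?h (xv (w j)))) =
      (\<Prod>i<r. \<Prod>j=i+1..<n. G (w i, w j)) * (\<Prod>i<r. \<Prod>j=i+1..<n. ?h (?c (w j)))"
    unfolding prod.distrib[symmetric] om G_def
    by (intro prod.cong refl) (simp add: x_oplus_def x_diff_def oplus_def hom)
  also have "(\<Prod>i<r. \<Prod>j=i+1..<n. G (w i, w j)) = prod G ?P"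
    using prod_positions[OF w r, of "\<lambda>a b. G (a, b)", folded u_def]
    unfolding inj_pairs_prod[OF injectionsD(2)[OF u]] by simp
  also have "(\<Prod>i<r. \<Prod>j=i+1..<n. ?h (?c (w j))) = ?h ((\<Prod>i<r. ?c (u i) ^ i) * (\<Prod>b\<in>rest r n u. ?c b ^ r))"
    using prod_positions[OF w r, of "\<lambda>a b. ?h (?c b)", folded u_def]
      prod_index_pairs_snd[of "\<lambda>j. ?h (?c (u j))" r]
    by (simp add: hom_mult[OF to_fract_hom] hom_prod[OF to_fract_hom] hom_power[OF to_fract_hom] prod_power_distrib)
  finally have part2: "(\<Prod>i<r. \<Prod>j=i+1..<n. oplus (?h beta) (?h (xv (w i))) (?h (xv (w j))) /
        ominus (?h beta) (?h (xv (w i))) (?h (xv (w j)))) =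
      prod G ?P * ?h ((\<Prod>i<r. ?c (u i) ^ i) * (\<Prod>b\<in>rest r n u. ?c b ^ r))" .
  have GV: "prod G ?P * ?h (vandermonde n) = ?h (cofac r n u * prod x_oplus ?P)"
  proof -
    have "prod G ?P * ?h (den r n u) = ?h (prod x_oplus ?P)"
      unfolding den_def hom_prod[OF to_fract_hom] prod.distrib[symmetric]
    proof (rule prod.cong[OF refl])
      fix p assume "p \<in> ?P"
      then have "x_diff p \<noteq> 0"
        using inj_pairs_asym(2)[OF injectionsD(2)[OF u], of "fst p" "snd p" n] by (intro x_diff_nonzero) simp
      then show "G p * ?h (x_diff p) = ?h (x_oplus p)" by (simp add: G_def)
    qed
    then show ?thesis
      unfolding den_cofac[OF u, symmetric] hom_mult[OF to_fract_hom] by (simp add: mult_ac)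
  qed
  have numeq: "num r n (wedge_family b ((!) lam)) u =
      ?A * ((\<Prod>i<r. ?c (u i) ^ i) * (\<Prod>b\<in>rest r n u. ?c b ^ r)) * prod x_oplus ?P"
    unfolding num_def wedge_family_def prod.distrib by (simp add: mult_ac)
  have comb: "p * (g * q) * (d * v) = x * y * q" if "p * d = x" "g * v = y" for p g q d v x y :: "ps fract"
    unfolding that[symmetric] by (simp only: mult_ac)
  show ?thesis
    unfolding part2 hom_mult[OF to_fract_hom, of "d_fac b lam"] comb[OF part1 GV]
    by (simp only: numeq hom_mult[OF to_fract_hom] mult_ac)
qed

lemma mps_of_nat_nonzero: "m > 0 \<Longrightarrow> of_nat m \<noteq> (0 :: ps)"
proof -
  have *: "mcoeff (of_nat m :: ps) {#} = int m" by (induction m) (simp_all add: mcoeff_1)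
  assume "m > 0"
  show ?thesis
  proof
    assume "of_nat m = (0 :: ps)"
    with * have "int m = 0" by simp
    with \<open>m > 0\<close> show False by simp
  qed
qed

lemma GP_fin_antisum:
  assumes "length lam \<le> n"
  shows "GP_fin (to_fract beta) (\<lambda>l. to_fract (b l)) (\<lambda>i. to_fract (xv i)) n lam *
      to_fract (d_fac b lam * vandermonde n) =
    to_fract (antisum (length lam) n (wedge_family b ((!) lam)))"
proof -
  let ?r = "length lam"
  let ?h = "to_fract :: ps \<Rightarrow> ps fract"
  define H where "H u = ?h (cofac ?r n u * num ?r n (wedge_family b ((!) lam)) u)" for u
  have "of_nat (fact (n - ?r)) = ?h (of_nat (fact (n - ?r)))"
  proof -
    have "of_nat m = ?h (of_nat m)" for m
      by (induction m) (simp_all add: hom_simps[OF to_fract_hom])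
    then show ?thesis by blast
  qed
  then have nz: "of_nat (fact (n - ?r)) \<noteq> (0 :: ps fract)"
    using mps_of_nat_nonzero[of "fact (n - ?r)"] by (metis fact_gt_zero to_fract_eq_0_iff)
  have "GP_fin (?h beta) (\<lambda>l. ?h (b l)) (\<lambda>i. ?h (xv i)) n lam * ?h (d_fac b lam * vandermonde n) =
      1 / of_nat (fact (n - ?r)) * (\<Sum>w | w permutes {..<n}. H (restrict w {..<?r}))"
    unfolding GP_fin_def H_def mult.assoc[of "1 / _"] sum_distrib_right
    by (intro arg_cong2[of _ _ _ _ "(*)"] sum.cong refl GP_fin_term assms) simp
  also have "\<dots> = (\<Sum>u\<in>injections ?r n. H u)"
    unfolding sum_restrict_permutes[OF assms] using nz by simp
  also have "\<dots> = ?h (antisum ?r n (wedge_family b ((!) lam)))"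
    by (simp add: H_def antisum_def hom_sum[OF to_fract_hom])
  finally show ?thesis .
qed

context
  fixes b :: "nat \<Rightarrow> ps"
  assumes b: "parameter_seq b"
begin

text \<open>Shows that the definite description has a value: the limit of the antisymmetrized sums
  divided by the unit \<open>d_fac b lam\<close>, unique because truncations determine a series. The
  later facts about GP rest on this identity.\<close>

lemma GP_truncate_antisum:
  assumes "length lam \<le> n"
  shows "d_fac b lam * vandermonde n * x_truncate n (GP b lam) =
    antisum (length lam) n (wedge_family b ((!) lam))"
proof -
  let ?r = "length lam"
  let ?h = "to_fract :: ps \<Rightarrow> ps fract"
  let ?g = "wedge_family b ((!) lam)"
  let ?GP = "\<lambda>n. GP_fin (?h beta) (\<lambda>l. ?h (b l)) (\<lambda>i. ?h (xv i)) n lam"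
  note d = mps_div_unit[OF d_fac_unit[OF b], of lam]
  obtain G0 where G0: "\<And>n. n \<ge> ?r \<Longrightarrow> vandermonde n * x_truncate n G0 = antisum ?r n ?g"
    using antisum_limit[OF symmetric_wedge[OF b] truncating_wedge[OF b]] by blast
  define G where "G = G0 div d_fac b lam"
  have G: "d_fac b lam * vandermonde n * x_truncate n G = antisum ?r n ?g" if "n \<ge> ?r" for n
  proof -
    have "d_fac b lam * x_truncate n G = x_truncate n (d_fac b lam * G)"
      by (simp add: hom_mult[OF x_truncate_hom] x_truncate_param[OF d_fac_param[OF b]])
    also have "d_fac b lam * G = G0" unfolding G_def by (rule d(1))
    finally show ?thesis using G0[OF that] by (metis mult.assoc mult.commute)
  qed
  have tr: "?h (x_truncate n G) = ?GP n" if "n \<ge> ?r" for n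
  proof -
    have "?GP n * ?h (d_fac b lam * vandermonde n) = ?h (antisum ?r n ?g)"
      by (rule GP_fin_antisum[OF that])
    also have "\<dots> = ?h (x_truncate n G) * ?h (d_fac b lam * vandermonde n)"
      by (simp only: G[OF that, symmetric] hom_mult[OF to_fract_hom] mult_ac)
    finally have eq: "?GP n * ?h (d_fac b lam * vandermonde n) = ?h (x_truncate n G) * ?h (d_fac b lam * vandermonde n)" .
    have nz: "?h (d_fac b lam * vandermonde n) \<noteq> 0" using d(2) vandermonde_nonzero by simp
    show ?thesis by (rule mult_right_cancel[OF nz, THEN iffD1, OF eq, symmetric])
  qed
  have "GP b lam = G"
    unfolding GP_def
  proof (rule the_equality)
    show "\<forall>n\<ge>?r. ?h (x_truncate n G) = ?GP n" using tr by simp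
    fix G' assume G': "\<forall>n\<ge>?r. ?h (x_truncate n G') = ?GP n"
    then have "x_truncate n G' = x_truncate n G" if "n \<ge> ?r" for n
      using tr[OF that] that by (metis to_fract_eq_iff)
    then show "G' = G" by (rule x_truncate_eqI)
  qed
  then show ?thesis using G[OF assms] by simp
qed

lemma ord_ge_GP:
  assumes lam: "strict_partition lam" shows "ord_ge (sum_list lam) (GP b lam)"
proof -
  let ?r = "length lam"
  have "ord_ge (sum_list lam) (x_truncate n (GP b lam))" if n: "n \<ge> ?r" for n
  proof (rule ord_ge_cancel)
    show "ord_eq (0 + card (index_pairs n)) (d_fac b lam * vandermonde n)"
    proof (rule ord_eq_mult[OF _ ord_eq_vandermonde])
      show "ord_eq 0 (d_fac b lam)" using d_fac_unit[OF b, of lam] by (auto simp: ord_eq_def)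
    qed
    have "ord_ge (card (index_pairs n) + (\<Sum>i<?r. lam ! i)) (antisum ?r n (wedge_family b ((!) lam)))"
      using strict_partition_nth(2)[OF lam] by (intro ord_ge_antisum ord_ge_wedge[OF b]) fastforce
    then show "ord_ge (0 + card (index_pairs n) + sum_list lam) (d_fac b lam * vandermonde n * x_truncate n (GP b lam))"
      unfolding GP_truncate_antisum[OF n] by (simp add: sum_list_sum_nth atLeast0LessThan)
  qed
  note tr = this
  have "mcoeff (GP b lam) M = 0" if "size M < sum_list lam" for M
  proof -
    obtain m where "\<forall>i\<in>{i. X i \<in># M}. i < m"
      using finite_x_indices finite_nat_set_iff_bounded by blast
    then have "\<not> (\<exists>i\<ge>max m ?r. X i \<in># M)" by auto
    from mcoeff_x_truncate[OF this] show ?thesis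
      using ord_geD[OF tr[of "max m ?r"] that] by simp
  qed
  then show ?thesis by (simp add: ord_ge_def)
qed

text \<open>The defining property only speaks of at least \<open>length lam\<close> variables. With
  exactly that many, every injection is onto, so each summand contains an entry at
  \<open>xv n\<close> and vanishes with this variable, whereas the Vandermonde product does
  not.\<close>

lemma GP_truncate_short:
  assumes n: "n < length lam" shows "x_truncate n (GP b lam) = 0"
proof -
  let ?r = "length lam"
  let ?K = "restrict_vars (- {X n}) :: ps \<Rightarrow> ps"
  let ?g = "wedge_family b ((!) lam)"
  note hom = hom_simps[OF restrict_vars_hom]
  have "?K (num ?r ?r ?g u) = 0" if u: "u \<in> injections ?r ?r" for u
  proof -
    have "u ` {..<?r} = {..<?r}"
      using injectionsD[OF u] by (intro card_subset_eq) (auto simp: card_image)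
    then obtain i where i: "i < ?r" "u i = n" using n by (metis imageE lessThan_iff)
    have "?K (?g i (u i)) = 0"
      unfolding wedge_family_def i(2) by (simp add: hom restrict_vars_mvar)
    then have "?K (\<Prod>i<?r. ?g i (u i)) = 0"
      unfolding hom using i(1) by (auto intro!: prod_zero)
    then show ?thesis by (simp add: num_def hom)
  qed
  then have "?K (antisum ?r ?r ?g) = 0" by (simp add: antisum_def hom)
  then have "?K (d_fac b lam) * ?K (vandermonde ?r) * ?K (x_truncate ?r (GP b lam)) = 0"
    using GP_truncate_antisum[of lam ?r] by (metis hom(4) order_refl)
  moreover have "?K (d_fac b lam) = d_fac b lam"
    using vars_in_mono[OF d_fac_param[OF b], of "- {X n}" lam] by (auto simp: vars_in_iff)
  moreover have "?K (vandermonde ?r) \<noteq> 0"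
  proof -
    have "?K (x_diff p) \<noteq> 0" if "p \<in> index_pairs ?r" for p
    proof -
      obtain a c where p: "p = (a, c)" by (cases p)
      have "a \<noteq> c" using that by (auto simp: p index_pairs_def)
      then show ?thesis
        using mvar_diff_nonzero[of "X a" "X c"] mvar_nonzero[of "X a"] mvar_nonzero[of "X c"]
        by (auto simp: p x_diff_def hom restrict_vars_mvar)
    qed
    then show ?thesis by (simp add: vandermonde_def hom prod_zero_iff)
  qed
  ultimately have K: "?K (x_truncate ?r (GP b lam)) = 0"
    using mps_div_unit(2)[OF d_fac_unit[OF b]] by simp
  have "x_truncate n (GP b lam) = x_truncate n (?K (x_truncate ?r (GP b lam)))"
    by (rule mps_eqI) (use n in \<open>auto simp: x_truncate_restrict mcoeff_restrict_vars subset_iff\<close>)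
  then show ?thesis unfolding K by (simp add: hom_0[OF x_truncate_hom])
qed

end

section \<open>Transition coefficients\<close>

context
  fixes b c :: "nat \<Rightarrow> ps"
  assumes b: "parameter_seq b" and c: "parameter_seq c"
begin

lemma transition_coeff_dual_det:
  assumes mu: "strict_partition mu" and len: "length lam = length mu"
  shows "d_fac c mu * transition_coeff b c lam mu =
    d_fac b lam * dual_det b (length mu) ((!) lam) (wedge c ((!) mu))"
proof -
  have "mat (length lam) (length lam) (\<lambda>(i, j). \<Sum>\<^sub>\<infinity>k. beta ^ k * of_int (int_gbinomial (int i - int j) k) *
          super_h (lam ! j) b (mu ! i - 1) (\<lambda>l. - c l) (int (mu ! i) - int (lam ! j) + int k)) =
      mat (length mu) (length mu) (\<lambda>(i, j). dual_beta b (int i - int j) (lam ! j) (fac c (mu ! i)))"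
    using strict_partition_nth(2)[OF mu] len by (intro eq_matI) (auto simp: dual_beta_fac Suc_le_eq)
  then have "transition_coeff b c lam mu = (d_fac b lam div d_fac c mu) *
      dual_det b (length mu) ((!) lam) (wedge c ((!) mu))"
    by (simp add: transition_coeff_def dual_det_wedge Let_def)
  then show ?thesis using mps_div_unit(1)[OF d_fac_unit[OF c], of mu "d_fac b lam"]
    by (simp add: mult.assoc[symmetric])
qed

text \<open>The bound holds for each Leibniz term: the differences
  \<open>mu ! i - lam ! p i\<close>, truncated at 0, add up to at least the difference of the
  sizes.\<close>

lemma dual_det_graded:
  assumes mu: "strict_partition mu" and len: "length lam = length mu"
  shows "ord_ge (sum_list mu - sum_list lam) (dual_det b (length mu) ((!) lam) (wedge c ((!) mu)))"
    and "vars_in param_vars (dual_det b (length mu) ((!) lam) (wedge c ((!) mu)))"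
proof -
  let ?r = "length mu"
  define e where "e i j = dual_beta b (int i - int j) (lam ! j) (fac c (mu ! i))" for i j
  have e: "ord_ge (mu ! i - lam ! j) (e i j)" "vars_in param_vars (e i j)" if "i < ?r" for i j
    unfolding e_def using dual_beta_graded[OF b c] strict_partition_nth(2)[OF mu that] by auto
  have D: "dual_det b ?r ((!) lam) (wedge c ((!) mu)) =
      (\<Sum>p | p permutes {0..<?r}. signof p * (\<Prod>i = 0..<?r. e i (p i)))"
    unfolding dual_det_leibniz e_def wedge_def dual_beta_shift_power by simp
  show "vars_in param_vars (dual_det b ?r ((!) lam) (wedge c ((!) mu)))"
    unfolding D by (intro vars_in_sum vars_in_mult vars_in_of_int vars_in_prod e) auto
  show "ord_ge (sum_list mu - sum_list lam) (dual_det b ?r ((!) lam) (wedge c ((!) mu)))"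
    unfolding D
  proof (intro ord_ge_sum ord_ge_mult_right)
    fix p assume "p \<in> {p. p permutes {0..<?r}}"
    then have p: "p permutes {0..<?r}" by simp
    have "sum_list mu \<le> (\<Sum>i = 0..<?r. (mu ! i - lam ! p i) + lam ! p i)"
      unfolding sum_list_sum_nth by (intro sum_mono) simp
    also have "\<dots> = (\<Sum>i = 0..<?r. mu ! i - lam ! p i) + (\<Sum>i = 0..<?r. lam ! i)"
      unfolding sum.distrib using sum.permute[OF p, of "(!) lam"] by (simp add: comp_def)
    also have "(\<Sum>i = 0..<?r. lam ! i) = sum_list lam" by (simp add: sum_list_sum_nth len)
    finally have "sum_list mu - sum_list lam \<le> (\<Sum>i = 0..<?r. mu ! i - lam ! p i)" by simp
    moreover have "ord_ge (\<Sum>i = 0..<?r. mu ! i - lam ! p i) (\<Prod>i = 0..<?r. e i (p i))"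
      by (intro ord_ge_prod e) simp
    ultimately show "ord_ge (sum_list mu - sum_list lam) (\<Prod>i = 0..<?r. e i (p i))"
      using ord_ge_mono by blast
  qed
qed

lemma transition_coeff_graded:
  assumes mu: "strict_partition mu" and len: "length lam = length mu"
  shows "ord_ge (sum_list mu - sum_list lam) (transition_coeff b c lam mu)"
    and "vars_in param_vars (transition_coeff b c lam mu)"
proof -
  note u = d_fac_unit[OF c, of mu]
  let ?T = "transition_coeff b c lam mu" and ?E = "d_fac b lam * dual_det b (length mu) ((!) lam) (wedge c ((!) mu))"
  have T: "?T = ?E div d_fac c mu"
    using mps_div_unit(2)[OF u] by (simp flip: transition_coeff_dual_det[OF mu len])
  show "vars_in param_vars ?T" unfolding T
    by (intro vars_in_div vars_in_mult d_fac_param[OF b] d_fac_param[OF c] dual_det_graded[OF mu len] u)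
  show "ord_ge (sum_list mu - sum_list lam) ?T"
  proof (rule ord_ge_cancel)
    show "ord_eq 0 (d_fac c mu)" using u by (auto simp: ord_eq_def)
    show "ord_ge (0 + (sum_list mu - sum_list lam)) (d_fac c mu * ?T)"
      unfolding transition_coeff_dual_det[OF mu len] using dual_det_graded(1)[OF mu len]
      by (simp add: ord_ge_mult_right)
  qed
qed

text \<open>Both sides are compared in \<open>n\<close> variables after multiplication by the
  Vandermonde product, where they are values of one alternating form. The coefficients involve no x
  and pass through the truncation.\<close>

lemma GP_transition:
  assumes mu: "strict_partition mu"
  shows "GP c mu = (\<Sum>lam\<in>sub_partitions mu. transition_coeff b c lam mu * GP b lam)"
proof -
  let ?r = "length mu"
  let ?D = "\<lambda>lam. dual_det b ?r ((!) lam) (wedge c ((!) mu))"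
  note hom = hom_simps[OF x_truncate_hom]
  have len: "length lam = ?r" if "lam \<in> sub_partitions mu" for lam
    using that by (simp add: sub_partitions_def)
  have "d_fac c mu * GP c mu = (\<Sum>lam\<in>sub_partitions mu. d_fac b lam * ?D lam * GP b lam)"
  proof (rule x_truncate_eqI[where r = ?r])
    fix n assume n: "n \<ge> ?r"
    have "vandermonde n * x_truncate n (d_fac c mu * GP c mu) =
        d_fac c mu * vandermonde n * x_truncate n (GP c mu)"
      by (simp add: hom x_truncate_param[OF d_fac_param[OF c]])
    also have "\<dots> = antisum ?r n (poly_family (wedge c ((!) mu)))"
      unfolding GP_truncate_antisum[OF c n] poly_family_wedge ..
    also have "\<dots> = (\<Sum>lam\<in>sub_partitions mu. ?D lam * antisum ?r n (poly_family (wedge b ((!) lam))))"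
      by (rule alt_form_transition[OF alt_form_antisum mu])
    also have "\<dots> = (\<Sum>lam\<in>sub_partitions mu. vandermonde n * x_truncate n (d_fac b lam * ?D lam * GP b lam))"
    proof (rule sum.cong[OF refl])
      fix lam assume lam: "lam \<in> sub_partitions mu"
      have "antisum ?r n (poly_family (wedge b ((!) lam))) = d_fac b lam * vandermonde n * x_truncate n (GP b lam)"
        using GP_truncate_antisum[OF b, of lam n] n len[OF lam] by (simp add: poly_family_wedge)
      then show "?D lam * antisum ?r n (poly_family (wedge b ((!) lam))) =
          vandermonde n * x_truncate n (d_fac b lam * ?D lam * GP b lam)"
        by (simp add: hom x_truncate_param d_fac_param[OF b] dual_det_graded(2)[OF mu len[OF lam]])
    qed
    also have "\<dots> = vandermonde n * x_truncate n (\<Sum>lam\<in>sub_partitions mu. d_fac b lam * ?D lam * GP b lam)"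
      unfolding hom_sum[OF x_truncate_hom] sum_distrib_left ..
    finally show "x_truncate n (d_fac c mu * GP c mu) =
        x_truncate n (\<Sum>lam\<in>sub_partitions mu. d_fac b lam * ?D lam * GP b lam)"
      by (rule mult_left_cancel[OF vandermonde_nonzero, THEN iffD1])
  qed
  also have "\<dots> = (\<Sum>lam\<in>sub_partitions mu. d_fac c mu * (transition_coeff b c lam mu * GP b lam))"
    by (intro sum.cong refl) (simp only: transition_coeff_dual_det[OF mu len] mult.assoc[symmetric])
  finally show ?thesis
    unfolding sum_distrib_left[symmetric]
    by (rule mult_left_cancel[OF mps_div_unit(2)[OF d_fac_unit[OF c]], THEN iffD1])
qed

end

section \<open>Independence of the functions \<open>GP\<close>\<close>

lemma has_sum_mcoeff:
  fixes u :: "'i \<Rightarrow> ('a, 'b::comm_ring_1) mps"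
  assumes "(u has_sum s) A" "finite F" "F \<subseteq> A" "\<And>k. k \<in> A - F \<Longrightarrow> mcoeff (u k) M = 0"
  shows "mcoeff s M = (\<Sum>k\<in>F. mcoeff (u k) M)"
proof -
  have "mcoeff s M = (\<Sum>k | k \<in> A \<and> mcoeff (u k) M \<noteq> 0. mcoeff (u k) M)"
    using assms(1) by (simp add: has_sum_mps_iff)
  also have "\<dots> = (\<Sum>k\<in>F. mcoeff (u k) M)"
    using assms(2-4) by (intro sum.mono_neutral_left) auto
  finally show ?thesis .
qed

lemma x_oplus_nonzero: assumes "fst p \<noteq> snd p" shows "x_oplus p \<noteq> 0"
proof
  assume "x_oplus p = 0"
  then have "mcoeff (x_oplus p) {#X (fst p)#} = 0" by simp
  moreover have "mcoeff (x_oplus p) {#X (fst p)#} = 1"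
    using assms
    by (auto simp: x_oplus_def oplus_def case_prod_unfold mult.assoc mcoeff_mvar_mult) (auto simp: mvar_def)
  ultimately show False by simp
qed

lemma inj_pairs_square:
  assumes "u \<in> injections r r" shows "sort_pair ` inj_pairs r r u = index_pairs r"
proof (rule card_subset_eq[OF finite_index_pairs sort_inj_pairs_subset[OF assms]])
  have "u ` {..<r} = {..<r}"
    using injectionsD[OF assms] by (intro card_subset_eq) (auto simp: card_image)
  then have "inj_pairs r r u = map_prod u u ` index_pairs r"
    by (simp add: inj_pairs_def rest_def)
  moreover have "inj_on (map_prod u u) (index_pairs r)"
    using injectionsD(2)[OF assms] by (auto simp: inj_on_def index_pairs_def)
  ultimately show "card (sort_pair ` inj_pairs r r u) = card (index_pairs r)"
    using card_image[OF inj_on_sort_inj_pairs[OF injectionsD(2)[OF assms]], of r] by (simp add: card_image)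
qed

text \<open>The determinant of the matrix with entries \<open>g i a\<close>: for n = r the cofactor
  is the sign of the permutation \<open>u\<close>.\<close>

definition alternant :: "nat \<Rightarrow> (nat \<Rightarrow> nat \<Rightarrow> ps) \<Rightarrow> ps" where
  "alternant r g = (\<Sum>u\<in>injections r r. cofac r r u * (\<Prod>i<r. g i (u i)))"

lemma cofac_square:
  assumes u: "u \<in> injections r r" shows "cofac r r u = 1 \<or> cofac r r u = - 1"
proof -
  note cancel = mult_left_cancel[OF vandermonde_nonzero, THEN iffD1]
  consider "den r r u = vandermonde r" | "den r r u = - vandermonde r"
    using prod_x_diff_sort[OF inj_on_sort_inj_pairs[OF injectionsD(2)[OF u]], of r]
    by (auto simp: den_def vandermonde_def inj_pairs_square[OF u])
  then show ?thesis
  proof cases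
    case 1
    then have "vandermonde r * cofac r r u = vandermonde r * 1" using den_cofac[OF u] by simp
    then have "cofac r r u = 1" by (rule cancel)
    then show ?thesis ..
  next
    case 2
    then have "vandermonde r * - cofac r r u = vandermonde r * 1" using den_cofac[OF u] by simp
    then have "- cofac r r u = 1" by (rule cancel)
    then show ?thesis by (simp add: minus_equation_iff)
  qed
qed

text \<open>With no variables left over, the \<open>\<oplus>\<close> product is symmetric and the
  same for every \<open>u\<close>, so it factors out.\<close>

lemma antisum_square: "antisum r r g = prod x_oplus (index_pairs r) * alternant r g"
proof -
  have "num r r g u = prod x_oplus (index_pairs r) * (\<Prod>i<r. g i (u i))" if u: "u \<in> injections r r" for u
  proof -
    have "u ` {..<r} = {..<r}"
      using injectionsD[OF u] by (intro card_subset_eq) (auto simp: card_image)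
    then have "rest r r u = {}" by (simp add: rest_def)
    moreover have "prod x_oplus (inj_pairs r r u) = prod x_oplus (index_pairs r)"
    proof -
      have "x_oplus (sort_pair p) = x_oplus p" for p
        by (cases p) (simp add: sort_pair_def x_oplus_def oplus_def min_def max_def algebra_simps)
      then show ?thesis
        unfolding inj_pairs_square[OF u, symmetric]
          prod.reindex[OF inj_on_sort_inj_pairs[OF injectionsD(2)[OF u]]] by simp
    qed
    ultimately show ?thesis by (simp add: num_def mult.commute)
  qed
  then show ?thesis
    unfolding antisum_def alternant_def sum_distrib_left by (intro sum.cong refl) (simp add: mult_ac)
qed

definition x_monomial :: "nat list \<Rightarrow> var multiset" where
  "x_monomial kap = (\<Sum>i<length kap. replicate_mset (kap ! i) (X i))"

lemma count_sum_replicate: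
  fixes r :: nat
  assumes "inj_on f {..<r}" "i < r"
  shows "count (\<Sum>j<r. replicate_mset (k j) (X (f j))) (X (f i)) = k i"
proof -
  have "count (\<Sum>j<r. replicate_mset (k j) (X (f j))) (X (f i)) = (\<Sum>j<r. if j = i then k i else 0)"
    unfolding count_sum using assms by (intro sum.cong refl) (auto dest: inj_onD)
  also have "\<dots> = k i" using assms(2) by (subst sum.delta) auto
  finally show ?thesis .
qed

lemma strict_partition_unique:
  assumes "strict_partition lam" "strict_partition kap" "set lam = set kap"
  shows "lam = kap"
proof -
  have "rev lam = rev kap"
    using assms by (intro strict_sorted_equal) (simp_all add: strict_partition_def sorted_wrt_rev)
  then show ?thesis by simp
qed

text \<open>On monomials in x alone, \<beta> and the parameters may be set to 0, which turns each
  entry into a pure power. Two strictly decreasing exponent sequences agree after a permutation only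
  if they are equal and the permutation is the identity.\<close>

lemma mcoeff_alternant:
  assumes b: "parameter_seq b" and lam: "strict_partition lam" and kap: "strict_partition kap"
    and len: "length lam = r" "length kap = r"
  shows "mcoeff (alternant r (wedge_family b ((!) lam))) (x_monomial kap) = (if lam = kap then 1 else 0)"
proof -
  let ?pi = "restrict_vars (range X) :: ps \<Rightarrow> ps"
  note hom = hom_simps[OF restrict_vars_hom]
  let ?id = "restrict id {..<r} :: nat \<Rightarrow> nat"
  have set_kap: "set_mset (x_monomial kap) \<subseteq> range X"
    by (auto simp: x_monomial_def set_mset_sum)
  have pib: "?pi (b l) = 0" for l
  proof (rule mps_eqI)
    fix M
    have "\<not> (set_mset M \<subseteq> range X \<and> mcoeff (b l) M \<noteq> 0)"
    proof
      assume M: "set_mset M \<subseteq> range X \<and> mcoeff (b l) M \<noteq> 0"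
      then have "set_mset M \<subseteq> param_vars" using parameter_seqD(2)[OF b, of l] by (auto simp: vars_in_def)
      with M have "set_mset M = {}" by blast
      with M show False using parameter_seqD(1)[OF b, of l] by simp
    qed
    then show "mcoeff (?pi (b l)) M = mcoeff 0 M" by (auto simp: mcoeff_restrict_vars)
  qed
  have pi_term: "mcoeff (cofac r r u * (\<Prod>i<r. wedge_family b ((!) lam) i (u i))) (x_monomial kap) =
      (if lam = kap \<and> u = ?id then 1 else 0)" if u: "u \<in> injections r r" for u
  proof -
    let ?N = "\<Sum>i<r. replicate_mset (lam ! i) (X (u i))"
    have w: "?pi (wedge_family b ((!) lam) i a) = mmono (replicate_mset (lam ! i) (X a))" if "i < r" for i a
    proof -
      have pos: "lam ! i > 0" using strict_partition_nth(2)[OF lam, of i] that len by simp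
      have "Beta \<notin> range X" by auto
      then have "?pi (wedge_family b ((!) lam) i a) = xv a ^ (lam ! i - 1) * xv a"
        by (simp add: wedge_family_def hom pib restrict_vars_mvar)
      also have "\<dots> = xv a ^ (lam ! i)" by (rule power_minus_mult[OF pos])
      also have "\<dots> = mmono (replicate_mset (lam ! i) (X a))"
        unfolding mvar_eq_mmono mmono_power by simp
      finally show ?thesis .
    qed
    have coef: "mcoeff (\<Prod>i<r. wedge_family b ((!) lam) i (u i)) (x_monomial kap) =
        (if x_monomial kap = ?N then 1 else 0)"
    proof -
      have "mcoeff (\<Prod>i<r. wedge_family b ((!) lam) i (u i)) (x_monomial kap) =
          mcoeff (?pi (\<Prod>i<r. wedge_family b ((!) lam) i (u i))) (x_monomial kap)"
        using set_kap by (simp add: mcoeff_restrict_vars)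
      also have "?pi (\<Prod>i<r. wedge_family b ((!) lam) i (u i)) = mmono ?N"
        by (simp add: hom w mmono_prod)
      finally show ?thesis by (simp add: mcoeff_mmono)
    qed
    have uN: "x_monomial kap = ?N \<longleftrightarrow> lam = kap \<and> u = ?id"
    proof
      assume eq: "x_monomial kap = ?N"
      have ku: "kap ! u i = lam ! i" if "i < r" for i
      proof -
        have "count ?N (X (u i)) = lam ! i"
          by (rule count_sum_replicate[OF injectionsD(2)[OF u] that])
        moreover have "count (x_monomial kap) (X (u i)) = kap ! u i"
          using count_sum_replicate[of id r "u i" "(!) kap"] injectionsD(1)[OF u that] len
          by (simp add: x_monomial_def)
        ultimately show ?thesis using eq by simp
      qed
      have "u ` {..<r} = {..<r}"
        using injectionsD[OF u] by (intro card_subset_eq) (auto simp: card_image)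
      then have "set lam = set kap"
        using ku len by (auto simp: set_conv_nth) (metis imageE imageI lessThan_iff)+
      then have lk: "lam = kap" using strict_partition_unique lam kap by blast
      have "distinct kap" using kap unfolding strict_partition_def
        by (auto simp: sorted_wrt_iff_nth_less distinct_conv_nth nat_neq_iff)
      then have "u i = i" if "i < r" for i
        using ku[OF that] lk that len injectionsD(1)[OF u that] by (simp add: nth_eq_iff_index_eq)
      then have "u = ?id" using injectionsD(3)[OF u] by (auto simp: extensional_def)
      with lk show "lam = kap \<and> u = ?id" by simp
    qed (simp add: x_monomial_def len)
    show ?thesis
    proof (cases "lam = kap \<and> u = ?id")
      case True
      have "map_prod u u ` index_pairs r = id ` index_pairs r"
        by (rule image_cong[OF refl]) (use True in \<open>auto simp: index_pairs_def\<close>)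
      moreover have "rest r r u = {}" using True by (simp add: rest_def)
      ultimately have "inj_pairs r r u = index_pairs r" by (simp add: inj_pairs_def)
      then have "den r r u = vandermonde r" by (simp only: den_def vandermonde_def)
      then have "cofac r r u = 1"
        using den_cofac[OF u] vandermonde_nonzero[of r] by simp
      then show ?thesis using coef uN True by simp
    next
      case False
      then have "mcoeff (\<Prod>i<r. wedge_family b ((!) lam) i (u i)) (x_monomial kap) = 0"
        using coef uN by simp
      then show ?thesis using cofac_square[OF u] False by auto
    qed
  qed
  have "?id \<in> injections r r" by (intro injectionsI) (auto simp: inj_on_def)
  then show ?thesis
    unfolding alternant_def mcoeff_sum by (simp add: pi_term cong: sum.cong)
qed

lemma length_le_sum_list: "0 \<notin> set xs \<Longrightarrow> length xs \<le> sum_list (xs :: nat list)"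
  by (induction xs) auto

lemma finite_strict_partitions: "finite {lam. strict_partition lam \<and> sum_list lam \<le> n}"
proof (rule finite_subset)
  show "{lam. strict_partition lam \<and> sum_list lam \<le> n} \<subseteq> {lam. set lam \<subseteq> {..n} \<and> length lam \<le> n}"
  proof safe
    fix lam x assume lam: "strict_partition lam" "sum_list lam \<le> n"
    show "length lam \<le> n"
      using length_le_sum_list[of lam] lam by (simp add: strict_partition_def)
    assume "x \<in> set lam"
    then show "x \<le> n" using member_le_sum_list[of x lam] lam(2) by simp
  qed
qed (rule finite_lists_length_le, simp)

text \<open>Induction on the length: truncation to \<open>r\<close> variables removes longer
  partitions, and the induction hypothesis removes shorter ones. For length \<open>r\<close> a
  coefficient of least degree among all \<open>a'\<close> is isolated by the leading monomials of
  the alternants.\<close>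

theorem GP_independent:
  assumes b: "parameter_seq b"
    and a: "\<And>lam. strict_partition lam \<Longrightarrow> vars_in (- range X) (a lam)"
    and sum: "((\<lambda>lam. GP b lam * a lam) has_sum 0) {lam. strict_partition lam}"
    and lam: "strict_partition lam"
  shows "a lam = 0"
  using lam
proof (induction "length lam" arbitrary: lam rule: less_induct)
  case less
  define r where "r = length lam"
  have IH: "a mu = 0" if "strict_partition mu" "length mu < r" for mu
    using less.hyps that by (simp add: r_def)
  define L where "L = {lam. strict_partition lam \<and> length lam = r}"
  define a' where "a' mu = a mu div d_fac b mu" for mu
  have d: "d_fac b mu * a' mu = a mu" for mu
    unfolding a'_def by (rule mps_div_unit(1)[OF d_fac_unit[OF b]])
  have a'_vars: "vars_in (- range X) (a' mu)" if "mu \<in> L" for mu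
    unfolding a'_def using that
    by (intro vars_in_div a d_fac_unit[OF b] vars_in_mono[OF d_fac_param[OF b]]) (auto simp: L_def)
  let ?E = "prod x_oplus (index_pairs r)"
  let ?A = "\<lambda>mu. alternant r (wedge_family b ((!) mu))"
  have E: "?E \<noteq> 0"
  proof
    assume "?E = 0"
    then obtain p where "p \<in> index_pairs r" "x_oplus p = 0"
      unfolding prod_zero_iff[OF finite_index_pairs] by blast
    then show False using x_oplus_nonzero[of p] by (auto simp: index_pairs_def)
  qed
  have term_L: "vandermonde r * (x_truncate r (GP b mu) * a mu) = ?E * (?A mu * a' mu)" if "mu \<in> L" for mu
  proof -
    have mu: "length mu = r" using that by (simp add: L_def)
    have "d_fac b mu * vandermonde r * x_truncate r (GP b mu) = ?E * ?A mu"
      using GP_truncate_antisum[OF b, of mu r] mu by (simp add: antisum_square)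
    then have "?E * ?A mu * a' mu = vandermonde r * (x_truncate r (GP b mu) * (d_fac b mu * a' mu))"
      by (metis (no_types, opaque_lifting) mult.assoc mult.commute)
    then show ?thesis by (simp add: d mult.assoc)
  qed
  have "((\<lambda>mu. x_truncate r (GP b mu * a mu)) has_sum x_truncate r 0) {lam. strict_partition lam}"
    using has_sum_restrict_vars[OF sum] unfolding x_truncate_restrict by simp
  then have "((\<lambda>mu. vandermonde r * x_truncate r (GP b mu * a mu)) has_sum vandermonde r * x_truncate r 0)
      {lam. strict_partition lam}"
    by (rule has_sum_mps_mult)
  moreover have "((\<lambda>mu. vandermonde r * x_truncate r (GP b mu * a mu)) has_sum vandermonde r * x_truncate r 0)
      {lam. strict_partition lam} \<longleftrightarrow>
      ((\<lambda>mu. ?E * (?A mu * a' mu)) has_sum vandermonde r * x_truncate r 0) L"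
  proof (rule has_sum_cong_neutral)
    fix mu assume "mu \<in> {lam. strict_partition lam} - L"
    then have mu: "strict_partition mu" "length mu \<noteq> r" by (auto simp: L_def)
    show "vandermonde r * x_truncate r (GP b mu * a mu) = 0"
    proof (cases "length mu < r")
      case True
      then show ?thesis using IH mu by (simp add: hom_0[OF x_truncate_hom])
    next
      case False
      then show ?thesis using GP_truncate_short[OF b, of r mu] mu
        by (simp add: hom_mult[OF x_truncate_hom])
    qed
  next
    fix mu assume "mu \<in> {lam. strict_partition lam} \<inter> L"
    then have mu: "mu \<in> L" "strict_partition mu" by auto
    have "x_truncate r (a mu) = a mu"
      unfolding x_truncate_restrict vars_in_iff[symmetric] using a[OF mu(2)] by (rule vars_in_mono) auto
    then show "vandermonde r * x_truncate r (GP b mu * a mu) = ?E * (?A mu * a' mu)"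
      using term_L[OF mu(1)] by (simp add: hom_mult[OF x_truncate_hom])
  qed (auto simp: L_def)
  ultimately have sumL: "((\<lambda>mu. ?E * (?A mu * a' mu)) has_sum 0) L"
    by (simp add: hom_0[OF x_truncate_hom])
  have ordA: "ord_ge (sum_list mu) (?A mu * a' mu)" if "mu \<in> L" for mu
  proof -
    have mu: "strict_partition mu" "length mu = r" using that by (auto simp: L_def)
    have "ord_ge (\<Sum>i<r. mu ! i) (\<Prod>i<r. wedge_family b ((!) mu) i (u i))" for u
      using strict_partition_nth(2)[OF mu(1)] mu(2) by (intro ord_ge_prod ord_ge_wedge[OF b]) fastforce
    then have "ord_ge (sum_list mu) (?A mu)"
      unfolding alternant_def by (intro ord_ge_sum ord_ge_mult_right) (simp add: sum_list_sum_nth atLeast0LessThan mu(2))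
    then show ?thesis by (rule ord_ge_mult_left)
  qed
  have "finite {mu \<in> L. sum_list mu \<le> n}" for n
    by (rule finite_subset[OF _ finite_strict_partitions[of n]]) (auto simp: L_def)
  \<comment> \<open>The common factor \<open>?E\<close> can be cancelled only after the sum without
    it is known to converge; the orders in \<open>ordA\<close> provide this.\<close>
  then obtain S where S: "((\<lambda>mu. ?A mu * a' mu) has_sum S) L"
    using has_sum_mps_ord[of L sum_list "\<lambda>mu. ?A mu * a' mu", OF ordA] by blast
  have "?E * S = 0"
    using infsumI[OF has_sum_mps_mult[OF S, of ?E]] infsumI[OF sumL] by simp
  then have S0: "S = 0" using E by simp
  have "a' mu = 0" if mu0: "mu \<in> L" for mu
  proof (rule ccontr)
    assume "a' mu \<noteq> 0"
    then obtain M0 where "mcoeff (a' mu) M0 \<noteq> 0" by (metis mps_eqI mcoeff_0)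
    then have "\<exists>n. \<exists>kap\<in>L. \<exists>N. size N = n \<and> mcoeff (a' kap) N \<noteq> 0" using mu0 by blast
    \<comment> \<open>The minimum is taken over all partitions of this length at once, so that
      \<open>small\<close> applies to every \<open>nu\<close> in \<open>L\<close>.\<close>
    then obtain n where n: "\<exists>kap\<in>L. \<exists>N. size N = n \<and> mcoeff (a' kap) N \<noteq> 0"
      "\<And>m. m < n \<Longrightarrow> \<not> (\<exists>kap\<in>L. \<exists>N. size N = m \<and> mcoeff (a' kap) N \<noteq> 0)"
      using exists_least_iff[of "\<lambda>n. \<exists>kap\<in>L. \<exists>N. size N = n \<and> mcoeff (a' kap) N \<noteq> 0"] by blast
    then obtain kap N where kap: "kap \<in> L" and N: "size N = n" "mcoeff (a' kap) N \<noteq> 0" by blast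
    have small: "mcoeff (a' nu) Q = 0" if "nu \<in> L" "size Q < size N" for nu Q
      using n(2)[of "size Q"] that N(1) by blast
    have N_free: "set_mset N \<subseteq> - range X" using a'_vars[OF kap] N(2) by (auto simp: vars_in_def)
    let ?x = "x_monomial kap"
    have x_vars: "set_mset ?x \<subseteq> range X" by (auto simp: x_monomial_def set_mset_sum)
    have coeff: "mcoeff (?A nu * a' nu) (?x + N) = (if nu = kap then mcoeff (a' kap) N else 0)" if nu: "nu \<in> L" for nu
    proof -
      \<comment> \<open>The part \<open>Q\<close> taken from \<open>a' nu\<close> is free of x and
        hence divides \<open>N\<close>; by minimality it is \<open>N\<close>, so the alternant must
        supply exactly the monomial of \<open>kap\<close>.\<close>
      have "mcoeff (?A nu) P * mcoeff (a' nu) (?x + N - P) = 0" if P: "P \<subseteq># ?x + N" "P \<noteq> ?x" for P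
      proof (rule ccontr)
        assume nz: "mcoeff (?A nu) P * mcoeff (a' nu) (?x + N - P) \<noteq> 0"
        define Q where "Q = ?x + N - P"
        have Q: "P + Q = ?x + N" using P(1) by (simp add: Q_def)
        have "set_mset Q \<subseteq> - range X" using a'_vars[OF nu] nz by (auto simp: vars_in_def Q_def)
        then have "count Q v \<le> count N v" for v
        proof (cases "v \<in> range X")
          case True
          then have "v \<notin># Q" using \<open>set_mset Q \<subseteq> - range X\<close> by blast
          then show ?thesis by (simp add: not_in_iff)
        next
          case False
          then have "v \<notin># ?x" using x_vars by blast
          then have "count (?x + N) v = count N v" by (simp add: not_in_iff)
          then show ?thesis unfolding Q[symmetric] by simp
        qed
        then have QN: "Q \<subseteq># N" by (simp add: subseteq_mset_def)
        moreover have "\<not> size Q < size N" using small[OF nu, of Q] nz by (auto simp: Q_def)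
        ultimately have "Q = N" using mset_subset_size[of Q N] by (auto simp: subset_mset.le_less)
        with Q P(2) show False by simp
      qed
      then have "mcoeff (?A nu * a' nu) (?x + N) =
          (\<Sum>P | P \<subseteq># ?x + N. if P = ?x then mcoeff (?A nu) ?x * mcoeff (a' nu) N else 0)"
        unfolding mcoeff_mult by (intro sum.cong refl) auto
      also have "\<dots> = mcoeff (?A nu) ?x * mcoeff (a' nu) N" by (simp add: finite_submultisets)
      also have "mcoeff (?A nu) ?x = (if nu = kap then 1 else 0)"
        using nu kap by (intro mcoeff_alternant[OF b]) (auto simp: L_def)
      finally show ?thesis by simp
    qed
    have "mcoeff S (?x + N) = (\<Sum>nu\<in>{kap}. mcoeff (?A nu * a' nu) (?x + N))"
      using kap coeff by (intro has_sum_mcoeff[OF S]) auto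
    then show False using coeff[OF kap] N(2) by (simp add: S0)
  qed
  then have "a' lam = 0" using less.prems by (simp add: L_def r_def)
  then show ?case using d[of lam] by simp
qed

section \<open>The dual functions\<close>

lemma coeff_ring_params:
  assumes b: "parameter_seq b" and "f \<in> coeff_ring b" shows "vars_in param_vars f"
  using assms(2)
proof induction
  case (param_bar i)
  show ?case unfolding obar_def
    by (intro vars_in_div vars_in_uminus vars_in_add vars_in_1 vars_in_mult vars_in_beta parameter_seqD[OF b])
      (simp add: mcoeff_1 mcoeff_mvar_mult)
qed (auto intro: vars_in_beta vars_in_diff vars_in_mult parameter_seqD[OF b])

text \<open>A monomial splits into its part in y and a rest; the rest is a monomial of some
  \<open>y_coeff\<close>, which lies in the coefficient ring and so involves only \<beta> and
  \<open>Par\<close>.\<close>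

lemma completed_symmetric_vars:
  assumes b: "parameter_seq b" and f: "completed_symmetric (coeff_ring b) f"
  shows "vars_in (- range X) f"
  unfolding vars_in_def
proof (intro allI impI)
  fix N assume nz: "mcoeff f N \<noteq> 0"
  let ?Ny = "filter_mset (\<lambda>v. v \<in> range Y) N" and ?N0 = "filter_mset (\<lambda>v. v \<notin> range Y) N"
  define M where "M = image_mset (inv_into UNIV Y) ?Ny"
  have "image_mset Y M = image_mset id ?Ny"
    unfolding M_def multiset.map_comp by (intro image_mset_cong) (auto simp: f_inv_into_f)
  then have N: "image_mset Y M + ?N0 = N" by (simp add: multiset_partition[of N "\<lambda>v. v \<in> range Y", symmetric])
  have "\<not> (\<exists>j. Y j \<in># ?N0)" by auto
  then have "mcoeff (y_coeff f M) ?N0 = mcoeff f N"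
    unfolding y_coeff_def mcoeff_Mps by (simp only: if_False N)
  moreover have "vars_in param_vars (y_coeff f M)"
    using coeff_ring_params[OF b] f by (simp add: completed_symmetric_def)
  ultimately have "set_mset ?N0 \<subseteq> param_vars" using nz by (simp only: vars_in_def) metis
  then show "set_mset N \<subseteq> - range X" by auto
qed

lemma sum_list_sub_partitions:
  assumes "lam \<in> sub_partitions mu" shows "sum_list lam \<le> sum_list mu"
  using assms unfolding sub_partitions_def
  by (auto simp: sum_list_sum_nth shifted_diagram_subset intro!: sum_mono)

text \<open>Let \<open>s lam\<close> be the claimed sum. Inserting \<open>GP_transition\<close> into
  the Cauchy identity for \<open>c\<close> and interchanging the summations gives an expansion of
  the same kernel along GP for \<open>b\<close> with coefficients \<open>s lam\<close>; independence
  identifies them with \<open>gqb lam\<close>.\<close>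

theorem gq_transition:
  assumes b: "parameter_seq b" and c: "parameter_seq c"
    and gqb: "is_gq b gqb" and gqc: "is_gq c gqc" and lam: "strict_partition lam"
  shows "((\<lambda>mu. transition_coeff b c lam mu * gqc mu) has_sum gqb lam)
    {mu. strict_partition mu \<and> lam \<in> sub_partitions mu}"
proof -
  let ?S = "{lam. strict_partition lam}"
  let ?T = "transition_coeff b c"
  define up where "up lam = {mu. strict_partition mu \<and> lam \<in> sub_partitions mu}" for lam
  define small where "small n = {lam. strict_partition lam \<and> sum_list lam \<le> n}" for n
  have fin: "finite (small n)" for n unfolding small_def by (rule finite_strict_partitions)
  have len: "length lam = length mu" "strict_partition mu" "sum_list lam \<le> sum_list mu" if "mu \<in> up lam" for lam mu
    using that sum_list_sub_partitions[of lam mu] by (auto simp: up_def sub_partitions_def)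
  have "\<exists>s. ((\<lambda>mu. ?T lam mu * gqc mu) has_sum s) (up lam)" for lam
  proof -
    have "ord_ge (sum_list mu - sum_list lam) (?T lam mu * gqc mu)" if "mu \<in> up lam" for mu
      using len[OF that] by (intro ord_ge_mult_left transition_coeff_graded[OF b c])
    moreover have "finite {mu \<in> up lam. sum_list mu - sum_list lam \<le> n}" for n
      by (rule finite_subset[OF _ fin[of "n + sum_list lam"]]) (auto simp: small_def up_def)
    ultimately show ?thesis
      using has_sum_mps_ord[of "up lam" "\<lambda>mu. sum_list mu - sum_list lam" "\<lambda>mu. ?T lam mu * gqc mu"] by blast
  qed
  then obtain s where s: "\<And>lam. ((\<lambda>mu. ?T lam mu * gqc mu) has_sum s lam) (up lam)" by metis
  have sum_s: "((\<lambda>lam. GP b lam * s lam) has_sum cauchy_kernel) ?S"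
  proof (rule has_sum_mpsI)
    fix M :: "var multiset"
    \<comment> \<open>One finite window for both summations: outside it GP has order above
      \<open>size M\<close>, so the interchange happens between finite sums, one monomial at a
      time.\<close>
    define F where "F = small (size M)"
    have F: "finite F" "F \<subseteq> ?S" unfolding F_def using fin by (auto simp: small_def)
    have z: "mcoeff (GP b' lam * f) M = 0" if "parameter_seq b'" "lam \<in> ?S - F" for b' lam f
    proof -
      have lam: "strict_partition lam" "size M < sum_list lam" using that(2) by (auto simp: F_def small_def)
      show ?thesis by (rule ord_geD[OF ord_ge_mult_left[OF ord_ge_GP[OF that(1) lam(1)]] lam(2)])
    qed
    have GPs: "mcoeff (GP b lam * s lam) M =
        (\<Sum>mu | mu \<in> F \<and> lam \<in> sub_partitions mu. mcoeff (?T lam mu * GP b lam * gqc mu) M)"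
      if lam: "lam \<in> F" for lam
    proof -
      have lam': "strict_partition lam" using lam F(2) by blast
      have "mcoeff (GP b lam * s lam) M =
          (\<Sum>mu\<in>{mu. mu \<in> F \<and> lam \<in> sub_partitions mu}. mcoeff (GP b lam * (?T lam mu * gqc mu)) M)"
      proof (rule has_sum_mcoeff[OF has_sum_mps_mult[OF s]])
        show "{mu. mu \<in> F \<and> lam \<in> sub_partitions mu} \<subseteq> up lam" using F(2) by (auto simp: up_def)
        fix mu assume "mu \<in> up lam - {mu. mu \<in> F \<and> lam \<in> sub_partitions mu}"
        then have mu: "mu \<in> up lam" "size M < sum_list mu" by (auto simp: up_def F_def small_def)
        \<comment> \<open>The orders of GP and of the transition coefficient add up to the size of
          \<open>mu\<close>, which removes every \<open>mu\<close> outside the window.\<close>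
        have "ord_ge (sum_list lam + (sum_list mu - sum_list lam)) (GP b lam * (?T lam mu * gqc mu))"
          using len[OF mu(1)] by (intro ord_ge_mult ord_ge_mult_left ord_ge_GP[OF b lam'] transition_coeff_graded[OF b c])
        then show "mcoeff (GP b lam * (?T lam mu * gqc mu)) M = 0"
          using len(3)[OF mu(1)] mu(2) by (intro ord_geD) auto
      qed (use F in simp)
      then show ?thesis by (simp add: mult_ac)
    qed
    have "mcoeff cauchy_kernel M = (\<Sum>mu\<in>F. mcoeff (GP c mu * gqc mu) M)"
      using gqc F z[OF c] by (intro has_sum_mcoeff[where A = ?S]) (auto simp: is_gq_def)
    also have "\<dots> = (\<Sum>mu\<in>F. \<Sum>lam | lam \<in> F \<and> lam \<in> sub_partitions mu. mcoeff (?T lam mu * GP b lam * gqc mu) M)"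
    proof (rule sum.cong[OF refl])
      fix mu assume mu: "mu \<in> F"
      have "{lam. lam \<in> F \<and> lam \<in> sub_partitions mu} = sub_partitions mu"
        using mu sum_list_sub_partitions[of _ mu] by (fastforce simp: F_def small_def sub_partitions_def)
      moreover have "GP c mu = (\<Sum>lam\<in>sub_partitions mu. ?T lam mu * GP b lam)"
        using mu F(2) by (intro GP_transition[OF b c]) auto
      ultimately show "mcoeff (GP c mu * gqc mu) M =
          (\<Sum>lam | lam \<in> F \<and> lam \<in> sub_partitions mu. mcoeff (?T lam mu * GP b lam * gqc mu) M)"
        by (simp only: sum_distrib_right mcoeff_sum)
    qed
    also have "\<dots> = (\<Sum>lam\<in>F. \<Sum>mu | mu \<in> F \<and> lam \<in> sub_partitions mu. mcoeff (?T lam mu * GP b lam * gqc mu) M)"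
      by (rule sum.swap_restrict[OF F(1) F(1)])
    also have "\<dots> = (\<Sum>lam\<in>F. mcoeff (GP b lam * s lam) M)"
      by (intro sum.cong refl GPs[symmetric])
    finally show "\<exists>F. finite F \<and> F \<subseteq> ?S \<and> (\<forall>lam\<in>?S - F. mcoeff (GP b lam * s lam) M = 0) \<and>
        mcoeff cauchy_kernel M = (\<Sum>lam\<in>F. mcoeff (GP b lam * s lam) M)"
      using F z[OF b] by (intro exI[of _ F]) blast
  qed
  have "((\<lambda>lam. GP b lam * gqb lam - GP b lam * s lam) has_sum cauchy_kernel - cauchy_kernel) ?S"
    using gqb by (intro has_sum_mps_diff sum_s) (simp add: is_gq_def)
  then have "((\<lambda>lam. GP b lam * (gqb lam - s lam)) has_sum 0) ?S"
    by (simp add: right_diff_distrib)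
  moreover have "vars_in (- range X) (gqb mu - s mu)" if mu: "strict_partition mu" for mu
  proof (rule vars_in_diff)
    show "vars_in (- range X) (gqb mu)"
      using gqb mu by (intro completed_symmetric_vars[OF b]) (simp add: is_gq_def)
    show "vars_in (- range X) (s mu)"
    proof (rule vars_in_has_sum[OF s], rule vars_in_mult)
      fix nu assume nu: "nu \<in> up mu"
      show "vars_in (- range X) (?T mu nu)"
        using transition_coeff_graded(2)[OF b c len(2)[OF nu] len(1)[OF nu]] by (rule vars_in_mono) auto
      show "vars_in (- range X) (gqc nu)"
        using gqc len(2)[OF nu] by (intro completed_symmetric_vars[OF c]) (simp add: is_gq_def)
    qed
  qed
  ultimately have "gqb lam - s lam = 0" by (intro GP_independent[OF b _ _ lam])
  then show ?thesis using s[of lam] by (simp add: up_def)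
qed

theorem theorem3p15:
  fixes b c :: "nat \<Rightarrow> ps"
  assumes "parameter_seq b" and "parameter_seq c"
  shows "\<exists>cgq cGP :: nat list \<Rightarrow> nat list \<Rightarrow> ps.
     (\<forall>gqb gqc lam. is_gq b gqb \<and> is_gq c gqc \<and> strict_partition lam \<longrightarrow>
        ((\<lambda>mu. cgq lam mu * gqc mu) has_sum gqb lam)
          {mu. strict_partition mu \<and> shifted_diagram lam \<subseteq> shifted_diagram mu \<and> length mu = length lam}) \<and>
     (\<forall>mu. strict_partition mu \<longrightarrow>
        GP c mu =
          (\<Sum>lam | strict_partition lam \<and> shifted_diagram lam \<subseteq> shifted_diagram mu \<and> length lam = length mu.
             cGP mu lam * GP b lam)) \<and>
     (\<forall>lam mu. strict_partition lam \<and> strict_partition mu \<and>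
        shifted_diagram lam \<subseteq> shifted_diagram mu \<and> length lam = length mu \<longrightarrow>
        cgq lam mu = cGP mu lam \<and> cGP mu lam = transition_coeff b c lam mu)"
\<comment> \<open>Both families are instantiated with \<open>transition_coeff b c\<close>, with the
  two partitions in opposite order for \<open>cGP\<close>.\<close>
proof (intro exI conjI allI impI)
  fix gqb gqc :: "nat list \<Rightarrow> ps" and lam
  assume A: "is_gq b gqb \<and> is_gq c gqc \<and> strict_partition lam"
  then have "{mu. strict_partition mu \<and> shifted_diagram lam \<subseteq> shifted_diagram mu \<and> length mu = length lam} =
      {mu. strict_partition mu \<and> lam \<in> sub_partitions mu}"
    by (auto simp: sub_partitions_def)
  then show "((\<lambda>mu. transition_coeff b c lam mu * gqc mu) has_sum gqb lam)
      {mu. strict_partition mu \<and> shifted_diagram lam \<subseteq> shifted_diagram mu \<and> length mu = length lam}"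
    using gq_transition[OF assms] A by simp
next
  fix mu assume "strict_partition mu"
  then show "GP c mu =
      (\<Sum>lam | strict_partition lam \<and> shifted_diagram lam \<subseteq> shifted_diagram mu \<and> length lam = length mu.
         (\<lambda>mu lam. transition_coeff b c lam mu) mu lam * GP b lam)"
    using GP_transition[OF assms] by (simp add: sub_partitions_def)
qed simp_all

end
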